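(* Let $\theta>0$. View the Poisson-Dirichlet process with parameter $\theta$, $(X_1,X_2,\dots)$, as the random multisubset of $(0,1]$ given by $A=\{X_1,X_2,\dots\}$. Then PD($\theta$) is the unique (in distribution) random multisubset $A$ of $(0,1]$ for which both of the following hold: (i) $T:=\sum_{x\in A}x$ (sum taken with multiplicities) satisfies $\mathbb{P}(T\le 1)=1$; (ii) for each $k=1,2,\dots$, the multi-intensity density of $A$ is given, for distinct $x_1,\dots,x_k\in(0,1]$ with $t:=x_1+\cdots+x_k$, by $$f_k(x_1,\dots,x_k)=\begin{cases}\dfrac{\theta^k(1-t)^{\theta-1}}{x_1\cdots x_k}&\text{if } t<1,\\[2mm] 0&\text{if } t>1.\end{cases}$$
   Context: Random multisubsets: a multisubset $A$ of $(0,1]$ assigns to each $u\in(0,1]$ a finite nonnegative integer multiplicity; only at most countable multisets are considered. For $S\subset(0,1]$, $|A\cap S|$ denotes the cardinality of the intersection counted with multiplicities. A random multisubset $A$ is specified by the joint distributions of $|A\cap S_1|,\dots,|A\cap S_k|$ for finite collections of Borel sets $S_i\subset(0,1]$ (equivalently, it is a random $\sigma$-finite integer-valued measure on $(0,1]$). Multi-intensity density: a random multisubset $A$ of $(0,1]$ has ($k$-fold) multi-intensity density $f_k$, a function on $(0,1]^k\setminus\bigcup_{1\le i<j\le k}\{x_i=x_j\}$, if for every choice of $k$ pairwise disjoint closed intervals $I_i=[a_i,b_i]\subset(0,1]$, with $B=\prod_{i=1}^k[a_i,b_i]$, $$\mathbb{E}\,|A\cap I_1|\cdots|A\cap I_k|=\int_B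 f_k(x_1,\dots,x_k)\,dx_1\cdots dx_k.$$ The value of $f_k$ on the null set $t=1$ is irrelevant. Poisson-Dirichlet process PD($\theta$), $\theta>0$: let $U_1,U_2,\dots$ be independent uniform random variables on $(0,1)$, $V_i=U_i^{1/\theta}$, and $G_1=1-V_1$, $G_2=V_1(1-V_2)$, $G_3=V_1V_2(1-V_3),\dots$. Then PD($\theta$) is the distribution of the sequence obtained by sorting $G_1,G_2,\dots$ into descending order. (Equivalently, it is the Poisson point process with intensity $\theta\,dx/x$ on $(0,1)$ conditioned on the sum of the arrivals being $1$.) *)

theory Defs
  imports "HOL-Probability.Probability"
begin

text \<open>A multisubset of \<open>(0,1]\<close> is given by its multiplicity function.\<close>

definition multisubset :: "(real \<Rightarrow> nat) \<Rightarrow> bool" where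
  "multisubset m \<longleftrightarrow> countable {u. m u \<noteq> 0} \<and> {u. m u \<noteq> 0} \<subseteq> {0<..1}"

definition mcount :: "(real \<Rightarrow> nat) \<Rightarrow> real set \<Rightarrow> ennreal" where
  "mcount m S = (\<integral>\<^sup>+u. of_nat (m u) \<partial>count_space S)"

definition msum :: "(real \<Rightarrow> nat) \<Rightarrow> ennreal" where
  "msum m = (\<integral>\<^sup>+u. of_nat (m u) * ennreal u \<partial>count_space {0<..1})"

definition random_multisubset :: "'w measure \<Rightarrow> ('w \<Rightarrow> real \<Rightarrow> nat) \<Rightarrow> bool" where
  "random_multisubset M A \<longleftrightarrow>
     prob_space M \<and>
     (\<forall>\<omega>\<in>space M. multisubset (A \<omega>)) \<and>
     (\<forall>S\<in>sets borel. S \<subseteq> {0<..1} \<longrightarrow> (\<lambda>\<omega>. mcount (A \<omega>) S) \<in> borel_measurable M)"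

definition same_distribution ::
    "'v measure \<Rightarrow> ('v \<Rightarrow> real \<Rightarrow> nat) \<Rightarrow> 'w measure \<Rightarrow> ('w \<Rightarrow> real \<Rightarrow> nat) \<Rightarrow> bool" where
  "same_distribution M A N B \<longleftrightarrow>
     (\<forall>k. \<forall>S :: nat \<Rightarrow> real set.
        (\<forall>i<k. S i \<in> sets borel \<and> S i \<subseteq> {0<..1}) \<longrightarrow>
        distr M (Pi\<^sub>M {..<k} (\<lambda>_. borel)) (\<lambda>\<omega>. \<lambda>i\<in>{..<k}. mcount (A \<omega>) (S i)) =
        distr N (Pi\<^sub>M {..<k} (\<lambda>_. borel)) (\<lambda>\<omega>. \<lambda>i\<in>{..<k}. mcount (B \<omega>) (S i)))"

definition off_diagonal :: "nat \<Rightarrow> (nat \<Rightarrow> real) set" where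
  "off_diagonal k = {x \<in> {..<k} \<rightarrow>\<^sub>E {0<..1}. inj_on x {..<k}}"

text \<open>
  Points of \<open>(0,1]\<^sup>k\<close> are extensional functions on \<open>{..<k}\<close>. Only the values of \<open>f\<close> on
  \<open>off_diagonal k\<close> matter, since a product of pairwise disjoint intervals is contained in it.
\<close>

definition has_multi_intensity_density ::
    "'w measure \<Rightarrow> ('w \<Rightarrow> real \<Rightarrow> nat) \<Rightarrow> nat \<Rightarrow> ((nat \<Rightarrow> real) \<Rightarrow> ennreal) \<Rightarrow> bool" where
  "has_multi_intensity_density M A k f \<longleftrightarrow>
     f \<in> borel_measurable (restrict_space (Pi\<^sub>M {..<k} (\<lambda>_. lborel)) (off_diagonal k)) \<and>
     (\<forall>a b :: nat \<Rightarrow> real.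
        (\<forall>i<k. 0 < a i \<and> a i \<le> b i \<and> b i \<le> 1) \<longrightarrow>
        disjoint_family_on (\<lambda>i. {a i..b i}) {..<k} \<longrightarrow>
        (\<integral>\<^sup>+\<omega>. (\<Prod>i<k. mcount (A \<omega>) {a i..b i}) \<partial>M) =
        (\<integral>\<^sup>+x\<in>(\<Pi>\<^sub>E i\<in>{..<k}. {a i..b i}). f x \<partial>Pi\<^sub>M {..<k} (\<lambda>_. lborel)))"

definition stick_breaking :: "real \<Rightarrow> (nat \<Rightarrow> real) \<Rightarrow> nat \<Rightarrow> real" where
  "stick_breaking \<theta> u n = (\<Prod>i<n. u i powr (1 / \<theta>)) * (1 - u n powr (1 / \<theta>))"

text \<open>
  The descending rearrangement is unique when it exists. It exists for every sequence of positive
  reals tending to \<open>0\<close>, hence almost surely for the stick-breaking sequence; otherwise the value is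
  a fixed unspecified sequence.
\<close>

definition desc_sort :: "(nat \<Rightarrow> real) \<Rightarrow> nat \<Rightarrow> real" where
  "desc_sort g = (THE y. decseq y \<and> (\<exists>\<sigma>. bij \<sigma> \<and> y = g \<circ> \<sigma>))"

definition Poisson_Dirichlet :: "real \<Rightarrow> (nat \<Rightarrow> real) measure" where
  "Poisson_Dirichlet \<theta> =
     distr (\<Pi>\<^sub>M i\<in>UNIV. uniform_measure lborel {0<..<1}) (\<Pi>\<^sub>M i\<in>UNIV. borel)
       (\<lambda>u. desc_sort (stick_breaking \<theta> u))"

text \<open>
  The multisubset \<open>{X 0, X 1, \<dots>}\<close>. A value taken infinitely often gets multiplicity
  \<open>card _ = 0\<close>; under \<open>Poisson_Dirichlet \<theta>\<close> this happens with probability \<open>0\<close>.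
\<close>

definition multisubset_of_seq :: "(nat \<Rightarrow> real) \<Rightarrow> real \<Rightarrow> nat" where
  "multisubset_of_seq X u = (if u \<in> {0<..1} then card {n. X n = u} else 0)"

text \<open>At \<open>\<Sum>i<k. x i = 1\<close>, a null set, the value is set to \<open>0\<close>.\<close>

definition PD_density :: "real \<Rightarrow> nat \<Rightarrow> (nat \<Rightarrow> real) \<Rightarrow> ennreal" where
  "PD_density \<theta> k x =
     (let t = \<Sum>i<k. x i in
      if t < 1 then ennreal (\<theta> ^ k * (1 - t) powr (\<theta> - 1) / (\<Prod>i<k. x i)) else 0)"

definition PD_conditions :: "real \<Rightarrow> 'w measure \<Rightarrow> ('w \<Rightarrow> real \<Rightarrow> nat) \<Rightarrow> bool" where
  "PD_conditions \<theta> M A \<longleftrightarrow>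
     measure M {\<omega> \<in> space M. msum (A \<omega>) \<le> 1} = 1 \<and>
     (\<forall>k\<ge>1. has_multi_intensity_density M A k (PD_density \<theta> k))"

end

theory Submission imports Defs begin

text \<open>
  The stick-breaking sequence consists of \<open>1 - V\<close> and \<open>V\<close> times an independent copy of itself, where
  \<open>V\<close> has density \<open>\<theta> v\<^sup>\<theta>\<^sup>-\<^sup>1\<close>. Hence its moments over disjoint sets satisfy a recursion, and the
  integrals of the claimed intensities satisfy the same one, because
  \<open>f\<^sub>k = x\<^sub>1 f\<^sub>k + \<dots> + x\<^sub>k f\<^sub>k + (1 - t) f\<^sub>k\<close> matches the cases where \<open>1 - V\<close> is one of the
  \<open>x\<^sub>i\<close> or none of them. For sets bounded away from \<open>0\<close> the recursion is a contraction.

  For uniqueness, \<open>f\<^sub>1\<close> and \<open>f\<^sub>2\<close> yield \<open>\<integral> x\<^sup>2 f\<^sub>1 + \<integral>\<integral> x y f\<^sub>2 = 1\<close>, so that \<open>T\<^sup>2 \<le> 1\<close> forbids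
  multiple points, which the intensities alone cannot see. Since at most \<open>1 / \<epsilon>\<close> points exceed
  \<open>\<epsilon>\<close>, the probability that a union of dyadic cells contains no point is the limit, over ever finer
  partitions into cells with counts \<open>N\<close>, of the expectation of the product of the \<open>1 - N\<close>, and this
  expands into the given moments. These void events form an intersection-stable generator of the
  \<open>\<sigma>\<close>-algebra of simple configurations.
\<close>

subsection \<open>Beta integrals and scaling\<close>

text \<open>The obstacle to uniqueness: doubling or deleting each point, independently with
  probability 1/2, leaves the expected products of counts over disjoint sets unchanged. So T \<le> 1
  must do more than make counts finite. It enters through a square: weighting points by the left
  ends of their dyadic cells gives a lower bound for T, whose square is at most 1, while the part of
  that square visible to f_1 and f_2 already has expectation tending to 1. There a cell holding N
  points contributes N instead of N^2 on the diagonal, so no probability is left for cells with N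
  \<ge> 2 that persist at all levels. For existence, moments and intensity integrals solve the same
  affine equation, which alone says nothing about infinite solutions. Separation from 0 does two
  things: it makes both sides finite, and it makes the first step annihilate them whenever the
  remaining mass v is small. The algebra behind the equation is v^(\<theta>-1) (1 -
  s/v)^(\<theta>-1) = (v - s)^(\<theta>-1), while the Jacobian of dividing the points by v cancels
  against the product in the denominator.\<close>

abbreviation lborel_PiM :: "'i set \<Rightarrow> ('i \<Rightarrow> real) measure" where
  "lborel_PiM I \<equiv> Pi\<^sub>M I (\<lambda>_. lborel)"

abbreviation borel_seq :: "(nat \<Rightarrow> real) measure" where
  "borel_seq \<equiv> \<Pi>\<^sub>M i\<in>UNIV. borel"

text \<open>The derivative of v^\<theta> is unbounded near 0 when \<theta> < 1, so the change of
  variables is made on the compact intervals [\<open>a n\<close>, c] and carried to (0, c] by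
  continuity of measures from below.\<close>

lemma nn_integral_powr_substitution:
  fixes \<theta> c :: real and f :: "real \<Rightarrow> ennreal"
  assumes \<theta>: "0 < \<theta>" and c: "0 < c" and f[measurable]: "f \<in> borel_measurable borel"
  shows "(\<integral>\<^sup>+y. f y * indicator {0<..c powr \<theta>} y \<partial>lborel) =
         (\<integral>\<^sup>+v. f (v powr \<theta>) * ennreal (\<theta> * v powr (\<theta> - 1)) * indicator {0<..c} v \<partial>lborel)"
proof -
  define a where "a n = c / (real n + 2)" for n
  have a: "0 < a n" "a n < c" for n using c by (auto simp: a_def field_simps add_pos_nonneg)
  have dec: "m \<le> n \<Longrightarrow> a n \<le> a m" for m n
    using c by (auto simp: a_def intro!: divide_left_mono)
  have un: "(\<Union>n. {a n..c}) = {0<..c}"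
  proof safe
    fix x assume x: "x \<in> {0<..c}"
    obtain n where "c / x < real n" using reals_Archimedean2 by blast
    with x c have "a n < x" by (simp add: a_def field_simps add_strict_increasing2)
    with x show "x \<in> (\<Union>n. {a n..c})" by (auto intro!: exI[of _ n])
  qed (use a in \<open>auto intro: less_le_trans\<close>)
  have un': "(\<Union>n. {a n powr \<theta>..c powr \<theta>}) = {0<..c powr \<theta>}"
  proof safe
    fix x assume x: "x \<in> {0<..c powr \<theta>}"
    have "x powr (1/\<theta>) \<le> (c powr \<theta>) powr (1/\<theta>)" using x \<theta> by (intro powr_mono2) auto
    then have "x powr (1/\<theta>) \<in> {0<..c}" using x \<theta> c by (auto simp: powr_powr)
    then obtain n where "a n \<le> x powr (1/\<theta>)" unfolding un[symmetric] by auto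
    then have "a n powr \<theta> \<le> (x powr (1/\<theta>)) powr \<theta>" using a(1)[of n] \<theta> by (intro powr_mono2) auto
    then have "a n powr \<theta> \<le> x" using x \<theta> by (simp add: powr_powr)
    with x show "x \<in> (\<Union>n. {a n powr \<theta>..c powr \<theta>})" by auto
  qed (use a in \<open>auto intro: less_le_trans simp: less_imp_neq\<close>, metis a(1) powr_gt_zero less_le_trans less_irrefl)
  let ?h = "\<lambda>v. f (v powr \<theta>) * ennreal (\<theta> * v powr (\<theta> - 1))"
  have eq: "emeasure (density lborel f) {a n powr \<theta>..c powr \<theta>} = emeasure (density lborel ?h) {a n..c}" for n
  proof -
    have "(\<integral>\<^sup>+x. f x * indicator {a n powr \<theta>..c powr \<theta>} x \<partial>lborel) =
             (\<integral>\<^sup>+x. f (x powr \<theta>) * ennreal (\<theta> * x powr (\<theta> - 1)) * indicator {a n..c} x \<partial>lborel)"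
    proof (rule nn_integral_substitution_aux)
      fix x assume "x \<in> {a n..c}"
      then have "0 < x" using a(1)[of n] by auto
      then show "((\<lambda>x. x powr \<theta>) has_real_derivative \<theta> * x powr (\<theta> - 1)) (at x)"
        by (auto intro!: derivative_eq_intros)
    next
      show "continuous_on {a n..c} (\<lambda>x. \<theta> * x powr (\<theta> - 1))" using a(1)[of n] by (auto intro!: continuous_intros)
    qed (use \<theta> a in auto)
    then show ?thesis by (simp add: emeasure_density)
  qed
  have dec': "m \<le> n \<Longrightarrow> a n powr \<theta> \<le> a m powr \<theta>" for m n
    using dec[of m n] a(1)[of n] \<theta> by (intro powr_mono2) auto
  have "(SUP n. emeasure (density lborel f) {a n powr \<theta>..c powr \<theta>}) = emeasure (density lborel f) {0<..c powr \<theta>}"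
    unfolding un'[symmetric]
    by (intro SUP_emeasure_incseq) (auto simp: incseq_def intro: order_trans[OF dec'])
  moreover have "(SUP n. emeasure (density lborel ?h) {a n..c}) = emeasure (density lborel ?h) {0<..c}"
    using a dec \<theta> unfolding un[symmetric]
    by (intro SUP_emeasure_incseq) (auto simp: incseq_def intro: order_trans[rotated])
  ultimately show ?thesis using eq by (simp add: emeasure_density)
qed

definition stick_density :: "real \<Rightarrow> real \<Rightarrow> ennreal" where
  "stick_density \<theta> v = ennreal (\<theta> * v powr (\<theta> - 1)) * indicator {0<..<1} v"

lemma measurable_stick_density[measurable]: "stick_density \<theta> \<in> borel_measurable borel"
  unfolding stick_density_def by measurable

lemma nn_integral_stick:
  fixes g :: "real \<Rightarrow> ennreal"
  assumes \<theta>: "0 < \<theta>" and g[measurable]: "g \<in> borel_measurable borel"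
  shows "(\<integral>\<^sup>+u. g (u powr (1 / \<theta>)) \<partial>uniform_measure lborel {0<..<1}) =
         (\<integral>\<^sup>+v. g v * stick_density \<theta> v \<partial>lborel)" (is "?L = _")
proof -
  have "?L =
        (\<integral>\<^sup>+u. g (u powr (1 / \<theta>)) * indicator {0<..<1} u \<partial>lborel)"
    by (subst nn_integral_uniform_measure) (auto simp: divide_ennreal_def)
  also have "\<dots> = (\<integral>\<^sup>+u. g (u powr (1 / \<theta>)) * indicator {0<..1 powr \<theta>} u \<partial>lborel)"
    by (rule nn_integral_cong_AE, rule AE_mp[OF AE_lborel_singleton[of 1]]) (auto split: split_indicator)
  also have "\<dots> = (\<integral>\<^sup>+v. g ((v powr \<theta>) powr (1/\<theta>)) * ennreal (\<theta> * v powr (\<theta> - 1)) * indicator {0<..1} v \<partial>lborel)"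
    using \<theta> by (intro nn_integral_powr_substitution) auto
  also have "\<dots> = (\<integral>\<^sup>+v. g v * stick_density \<theta> v \<partial>lborel)"
    by (rule nn_integral_cong_AE, rule AE_mp[OF AE_lborel_singleton[of 1]])
       (use \<theta> in \<open>auto split: split_indicator simp: powr_powr stick_density_def\<close>)
  finally show ?thesis .
qed

lemma nn_integral_powr_upto:
  fixes \<theta> c :: real
  assumes \<theta>: "0 < \<theta>" and c: "0 < c"
  shows "(\<integral>\<^sup>+v. ennreal (\<theta> * v powr (\<theta> - 1)) * indicator {0<..<c} v \<partial>lborel) = ennreal (c powr \<theta>)" (is "?L = _")
proof -
  have "?L =
        (\<integral>\<^sup>+v. 1 * ennreal (\<theta> * v powr (\<theta> - 1)) * indicator {0<..c} v \<partial>lborel)"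
    using AE_lborel_singleton[of c]
    by (intro nn_integral_cong_AE) (auto split: split_indicator)
  also have "\<dots> = (\<integral>\<^sup>+y. 1 * indicator {0<..c powr \<theta>} y \<partial>lborel)"
    using nn_integral_powr_substitution[OF \<theta> c, of "\<lambda>_. 1"] by simp
  also have "\<dots> = ennreal (c powr \<theta>)" by simp
  finally show ?thesis .
qed

lemma nn_integral_powr_shift:
  fixes \<theta> s b :: real
  assumes \<theta>: "0 < \<theta>" and s: "s < b"
  shows "(\<integral>\<^sup>+v. ennreal (\<theta> * (v - s) powr (\<theta> - 1)) * indicator {s<..<b} v \<partial>lborel) = ennreal ((b - s) powr \<theta>)" (is "?L = _")
proof -
  have "?L =
     (\<integral>\<^sup>+v. ennreal (\<theta> * v powr (\<theta> - 1)) * indicator {0<..<b-s} v \<partial>lborel)"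
    by (subst nn_integral_real_affine[where t=s and c=1]) (auto intro!: nn_integral_cong split: split_indicator)
  then show ?thesis using nn_integral_powr_upto[OF \<theta>, of "b-s"] s by simp
qed

lemma nn_integral_powr_reflect:
  fixes \<theta> c :: real
  assumes \<theta>: "0 < \<theta>" and c: "0 < c"
  shows "(\<integral>\<^sup>+y. ennreal (\<theta> * (c - y) powr (\<theta> - 1)) * indicator {0<..<c} y \<partial>lborel) = ennreal (c powr \<theta>)" (is "?L = _")
proof -
  have "?L =
     (\<integral>\<^sup>+v. ennreal (\<theta> * v powr (\<theta> - 1)) * indicator {0<..<c} v \<partial>lborel)"
    by (subst nn_integral_real_affine[where t=c and c="-1"]) (auto intro!: nn_integral_cong split: split_indicator)
  then show ?thesis using nn_integral_powr_upto[OF \<theta> c] by simp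
qed

text \<open>Each coordinate contributes one factor v; the induction peels off one coordinate and
  applies the one-dimensional affine substitution to it.\<close>

lemma nn_integral_lborel_PiM_scale:
  fixes v :: real and g :: "('i \<Rightarrow> real) \<Rightarrow> ennreal"
  assumes v: "0 < v" and "finite I" and "g \<in> borel_measurable (lborel_PiM I)"
  shows "(\<integral>\<^sup>+x. g x \<partial>lborel_PiM I) =
    ennreal (v ^ card I) * (\<integral>\<^sup>+x. g (\<lambda>i\<in>I. v * x i) \<partial>lborel_PiM I)"
  using assms(2,3)
proof (induction I arbitrary: g)
  case empty
  interpret p: product_sigma_finite "\<lambda>_::'i. lborel :: real measure" ..
  show ?case by (subst (1 2) p.nn_integral_empty) (simp_all add: restrict_def)
next
  case (insert i J)
  interpret product_sigma_finite "\<lambda>_::'i. lborel :: real measure" ..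
  note [measurable] = insert.prems
  have [measurable]: "(\<lambda>x. g (\<lambda>j\<in>insert i J. v * x j)) \<in> borel_measurable (lborel_PiM (insert i J))"
    by measurable
  interpret J: finite_product_sigma_finite "\<lambda>_::'i. lborel :: real measure" J
    using insert.hyps by unfold_locales
  have [measurable]: "(\<lambda>(y, x). (\<lambda>j\<in>J. v * x j)(i := y)) \<in>
      borel \<Otimes>\<^sub>M lborel_PiM J \<rightarrow>\<^sub>M lborel_PiM (insert i J)"
    unfolding split_beta' by (intro measurable_fun_upd[where J=J]) (auto, measurable)
  have m1: "(\<lambda>y. ennreal (v ^ card J) * \<integral>\<^sup>+x. g ((\<lambda>j\<in>J. v * x j)(i := y)) \<partial>lborel_PiM J) \<in> borel_measurable borel"
    using insert.hyps by measurable
  have m2: "(\<lambda>y. \<integral>\<^sup>+x. g ((\<lambda>j\<in>J. v * x j)(i := v * y)) \<partial>lborel_PiM J) \<in> borel_measurable lborel"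
    using insert.hyps by measurable
  have "(\<integral>\<^sup>+x. g x \<partial>lborel_PiM (insert i J)) =
     (\<integral>\<^sup>+y. \<integral>\<^sup>+x. g (x(i := y)) \<partial>lborel_PiM J \<partial>lborel)"
    using insert by (intro product_nn_integral_insert_rev) auto
  also have "\<dots> = (\<integral>\<^sup>+y. ennreal (v ^ card J) * \<integral>\<^sup>+x. g ((\<lambda>j\<in>J. v * x j)(i := y)) \<partial>lborel_PiM J \<partial>lborel)"
    using insert by (intro nn_integral_cong insert.IH) measurable
  also have "\<dots> = ennreal v * (\<integral>\<^sup>+y. ennreal (v ^ card J) * \<integral>\<^sup>+x. g ((\<lambda>j\<in>J. v * x j)(i := v * y)) \<partial>lborel_PiM J \<partial>lborel)"
    using v by (subst nn_integral_real_affine[OF m1, where t=0 and c=v]) simp_all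
  also have "\<dots> = ennreal v * (ennreal (v ^ card J) * (\<integral>\<^sup>+y. \<integral>\<^sup>+x. g ((\<lambda>j\<in>J. v * x j)(i := v * y)) \<partial>lborel_PiM J \<partial>lborel))"
    by (subst nn_integral_cmult[OF m2]) simp
  also have "(\<integral>\<^sup>+y. \<integral>\<^sup>+x. g ((\<lambda>j\<in>J. v * x j)(i := v * y)) \<partial>lborel_PiM J \<partial>lborel) =
      (\<integral>\<^sup>+y. \<integral>\<^sup>+x. g (\<lambda>j\<in>insert i J. v * (x(i := y)) j) \<partial>lborel_PiM J \<partial>lborel)"
    by (intro nn_integral_cong arg_cong[of _ _ g]) (use insert.hyps in auto)
  also have "\<dots> = (\<integral>\<^sup>+x. g (\<lambda>j\<in>insert i J. v * x j) \<partial>lborel_PiM (insert i J))"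
    using insert.hyps by (intro product_nn_integral_insert_rev[symmetric]) auto
  also have "ennreal v * (ennreal (v ^ card J) * A) = ennreal (v ^ card (insert i J)) * A" for A
    using v insert.hyps by (simp add: ennreal_mult mult.assoc)
  finally show ?case .
qed

subsection \<open>The recursion for the intensities\<close>

text \<open>The index set is an arbitrary finite set rather than an initial segment of the naturals,
  because the recursion deletes an arbitrary coordinate.\<close>

definition pd_dens :: "real \<Rightarrow> 'i set \<Rightarrow> ('i \<Rightarrow> real) \<Rightarrow> ennreal" where
  "pd_dens \<theta> I x =
     (if sum x I < 1 then ennreal (\<theta> ^ card I * (1 - sum x I) powr (\<theta> - 1) / prod x I) else 0)"

definition box_intensity :: "real \<Rightarrow> 'i set \<Rightarrow> ('i \<Rightarrow> real set) \<Rightarrow> ennreal" where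
  "box_intensity \<theta> I S =
     (\<integral>\<^sup>+x. (\<Prod>i\<in>I. indicator (S i) (x i)) * pd_dens \<theta> I x \<partial>lborel_PiM I)"

lemma pd_dens_cong: "(\<And>i. i \<in> I \<Longrightarrow> x i = y i) \<Longrightarrow> pd_dens \<theta> I x = pd_dens \<theta> I y"
  unfolding pd_dens_def by (simp cong: sum.cong prod.cong)

lemma measurable_pd_dens[measurable (raw)]:
  assumes "\<And>i. i \<in> I \<Longrightarrow> (\<lambda>z. x z i) \<in> borel_measurable M"
  shows "(\<lambda>z. pd_dens \<theta> I (x z)) \<in> borel_measurable M"
  using assms unfolding pd_dens_def by measurable

text \<open>For v > 0 this is division of the sets by v: a sequence multiplied by v hits
  \<open>S i\<close> exactly where the sequence itself hits \<open>rescale v S i\<close>.\<close>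

abbreviation rescale :: "real \<Rightarrow> ('i \<Rightarrow> real set) \<Rightarrow> 'i \<Rightarrow> real set" where
  "rescale v S \<equiv> \<lambda>i. (*) v -` S i"

lemma prod_indicator_eq:
  "finite I \<Longrightarrow> (\<Prod>i\<in>I. indicator (S i) (x i) :: ennreal) = (if \<forall>i\<in>I. x i \<in> S i then 1 else 0)"
  by (auto simp: indicator_def intro!: prod.neutral)

text \<open>Substituting x / v moves the rescaling from the sets to the density, so that one can
  afterwards integrate over v with the sets fixed.\<close>

lemma box_intensity_scale:
  fixes v :: real
  assumes v: "0 < v" and I: "finite I" and S: "\<And>i. i \<in> I \<Longrightarrow> S i \<in> sets borel"
  shows "box_intensity \<theta> I (rescale v S) = ennreal (inverse (v ^ card I)) *
    (\<integral>\<^sup>+x. (\<Prod>i\<in>I. indicator (S i) (x i)) * pd_dens \<theta> I (\<lambda>i. x i / v) \<partial>lborel_PiM I)" (is "_ = _ * ?R")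
proof -
  note [measurable] = S
  have "?R = ennreal (v ^ card I) * (\<integral>\<^sup>+x. (\<Prod>i\<in>I. indicator (S i) ((\<lambda>i\<in>I. v * x i) i)) *
       pd_dens \<theta> I (\<lambda>i. (\<lambda>i\<in>I. v * x i) i / v) \<partial>lborel_PiM I)" (is "_ = _ * ?Q")
    by (rule nn_integral_lborel_PiM_scale[OF v I]) measurable
  also have "?Q = box_intensity \<theta> I (rescale v S)"
    unfolding box_intensity_def
    by (intro nn_integral_cong arg_cong2[where f="(*)"] prod.cong pd_dens_cong)
       (use v in \<open>auto split: split_indicator\<close>)
  finally have "ennreal (inverse (v ^ card I)) * ?R =
      (ennreal (inverse (v ^ card I)) * ennreal (v ^ card I)) * box_intensity \<theta> I (rescale v S)"
    by (simp only: mult.assoc)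
  also have "ennreal (inverse (v ^ card I)) * ennreal (v ^ card I) = 1"
    using v by (subst ennreal_mult[symmetric]) auto
  finally show ?thesis by simp
qed

text \<open>The first stick 1 - v is the point x_i, and the other points, divided by v, come from
  the independent copy. With s the sum over J, the powers of v combine to (v - s)^(\<theta>-1), and
  v - s is 1 minus the total of all points. The density on J lacks the factor 1 / x_i, which
  accounts for the weight 1 - v on the right.\<close>

lemma stick_density_first:
  fixes v :: real
  assumes \<theta>: "0 < \<theta>" and v: "0 < v" "v < 1" and J: "finite J" "i \<notin> J" and x: "\<And>j. j \<in> J \<Longrightarrow> 0 < x j"
  shows "stick_density \<theta> v * ennreal (inverse (v ^ card J)) * pd_dens \<theta> J (\<lambda>j. x j / v) =
    ennreal (1 - v) * pd_dens \<theta> (insert i J) (x(i := 1 - v))"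
proof -
  let ?s = "sum x J"
  have s: "sum (x(i := 1 - v)) (insert i J) = ?s + 1 - v"
    using J by (auto intro!: sum.cong)
  have p: "prod (x(i := 1 - v)) (insert i J) = (1 - v) * prod x J"
    using J by (auto intro!: prod.cong)
  have s': "(\<Sum>j\<in>J. x j / v) = ?s / v" by (simp add: sum_divide_distrib)
  have p': "(\<Prod>j\<in>J. x j / v) = prod x J / v ^ card J" by (simp add: prod_dividef)
  show ?thesis
  proof (cases "?s < v")
    case True
    have "0 < prod x J" using x by (intro prod_pos) auto
    moreover have "1 - ?s / v = (v - ?s) / v" using v by (simp add: field_simps)
    moreover have "v powr (\<theta> - 1) > 0" using v by auto
    ultimately have "\<theta> * v powr (\<theta> - 1) * inverse (v ^ card J) *
       (\<theta> ^ card J * (1 - ?s / v) powr (\<theta> - 1) / (prod x J / v ^ card J)) =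
      \<theta> ^ card (insert i J) * (1 - (?s + 1 - v)) powr (\<theta> - 1) / prod x J"
      using J v True by (simp add: powr_divide field_simps)
    also have "\<dots> = (1 - v) * (\<theta> ^ card (insert i J) * (1 - (?s + 1 - v)) powr (\<theta> - 1) / ((1 - v) * prod x J))"
      using v by (simp del: diff_diff_eq2)
    finally have "\<theta> * v powr (\<theta> - 1) * inverse (v ^ card J) *
       (\<theta> ^ card J * (1 - ?s / v) powr (\<theta> - 1) / (prod x J / v ^ card J)) = \<dots>" .
    then show ?thesis using True v \<theta> \<open>0 < prod x J\<close> unfolding pd_dens_def s p s' p' stick_density_def
      by (simp flip: ennreal_mult)
  next
    case False
    then show ?thesis using v unfolding pd_dens_def s s' by (simp add: field_simps)
  qed
qed

text \<open>Here none of the points is the first stick. The same cancellation leaves \<theta> (v -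
  s)^(\<theta>-1) as the only dependence on v, with s the sum over I; its integral over (s, 1) is (1
  - s)^\<theta> = (1 - s) (1 - s)^(\<theta>-1).\<close>

lemma stick_density_rest:
  assumes \<theta>: "0 < \<theta>" and I: "finite I" "I \<noteq> {}" and x: "\<And>j. j \<in> I \<Longrightarrow> 0 < x j"
  shows "(\<integral>\<^sup>+v. stick_density \<theta> v * ennreal (inverse (v ^ card I)) * pd_dens \<theta> I (\<lambda>j. x j / v) \<partial>lborel) =
    ennreal (1 - sum x I) * pd_dens \<theta> I x" (is "?L = _")
proof -
  let ?s = "sum x I"
  have spos: "0 < ?s" using I x by (intro sum_pos) auto
  have ppos: "0 < prod x I" using x by (intro prod_pos) auto
  show ?thesis
  proof (cases "?s < 1")
    case True
    have "stick_density \<theta> v * ennreal (inverse (v ^ card I)) * pd_dens \<theta> I (\<lambda>j. x j / v) =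
       ennreal (\<theta> ^ card I / prod x I) * (ennreal (\<theta> * (v - ?s) powr (\<theta> - 1)) * indicator {?s<..<1} v)" for v
    proof (cases "0 < v \<and> v < 1")
      case v: True
      have s': "(\<Sum>j\<in>I. x j / v) = ?s / v" by (simp add: sum_divide_distrib)
      have p': "(\<Prod>j\<in>I. x j / v) = prod x I / v ^ card I" by (simp add: prod_dividef)
      show ?thesis
      proof (cases "?s < v")
        case True
        have "1 - ?s / v = (v - ?s) / v" using v by (simp add: field_simps)
        moreover have "v powr (\<theta> - 1) > 0" using v by auto
        ultimately have "\<theta> * v powr (\<theta> - 1) * inverse (v ^ card I) *
             (\<theta> ^ card I * (1 - ?s / v) powr (\<theta> - 1) / (prod x I / v ^ card I)) =
           \<theta> ^ card I / prod x I * (\<theta> * (v - ?s) powr (\<theta> - 1))"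
          using v True ppos by (simp add: powr_divide field_simps)
        then show ?thesis using True v \<theta> ppos spos unfolding pd_dens_def s' p' stick_density_def
          by (simp flip: ennreal_mult)
      next
        case False
        then show ?thesis using v unfolding pd_dens_def s' by (simp add: field_simps)
      qed
    qed (use spos in \<open>auto simp: stick_density_def\<close>)
    then have "?L =
       ennreal (\<theta> ^ card I / prod x I) * (\<integral>\<^sup>+v. ennreal (\<theta> * (v - ?s) powr (\<theta> - 1)) * indicator {?s<..<1} v \<partial>lborel)"
      by (simp add: nn_integral_cmult)
    also have "\<dots> = ennreal (\<theta> ^ card I / prod x I) * ennreal ((1 - ?s) powr \<theta>)"
      using nn_integral_powr_shift[OF \<theta> True] by simp
    also have "\<dots> = ennreal (1 - ?s) * pd_dens \<theta> I x"
      using True \<theta> ppos powr_mult_base[of "1 - ?s" "\<theta> - 1"]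
      by (simp add: pd_dens_def flip: ennreal_mult)
    finally show ?thesis .
  next
    case False
    have *: "stick_density \<theta> v * ennreal (inverse (v ^ card I)) * pd_dens \<theta> I (\<lambda>j. x j / v) = 0" for v
      using False by (auto simp: stick_density_def pd_dens_def field_simps simp flip: sum_divide_distrib split: split_indicator)
    show ?thesis unfolding * using False by (simp add: pd_dens_def)
  qed
qed

text \<open>Fubini isolates x_i, and x_i = 1 - v turns it into the first stick. Values v \<le> 0
  mean x_i \<ge> 1, where the density vanishes, so the cutoff in \<open>stick_density\<close> loses
  nothing.\<close>

lemma box_intensity_first:
  assumes \<theta>: "0 < \<theta>" and J: "finite J" "i \<notin> J"
    and S: "\<And>j. j \<in> insert i J \<Longrightarrow> S j \<in> sets borel" "\<And>j. j \<in> insert i J \<Longrightarrow> S j \<subseteq> {0<..}"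
  shows "(\<integral>\<^sup>+v. indicator (S i) (1 - v) * box_intensity \<theta> J (rescale v S) * stick_density \<theta> v \<partial>lborel) =
    (\<integral>\<^sup>+x. (\<Prod>j\<in>insert i J. indicator (S j) (x j)) * (ennreal (x i) * pd_dens \<theta> (insert i J) x)
       \<partial>lborel_PiM (insert i J))" (is "?L = ?R")
proof -
  interpret product_sigma_finite "\<lambda>_. lborel :: real measure" ..
  note [measurable] = S(1)
  have Smem: "x \<in> S j \<Longrightarrow> j \<in> insert i J \<Longrightarrow> 0 < x" for x j using S(2) by auto
  define H where "H a x = (\<Prod>j\<in>insert i J. indicator (S j) ((x(i := a)) j)) * (ennreal ((x(i := a)) i) * pd_dens \<theta> (insert i J) (x(i := a)))"
    for a and x :: "'a \<Rightarrow> real"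
  have H_eq: "H a x = indicator (S i) a * ((\<Prod>j\<in>J. indicator (S j) (x j)) * (ennreal a * pd_dens \<theta> (insert i J) (x(i := a))))" for a x
  proof -
    have "(\<Prod>j\<in>J. indicator (S j) ((x(i := a)) j)) = (\<Prod>j\<in>J. indicator (S j) (x j) :: ennreal)"
      using J by (intro prod.cong) auto
    then show ?thesis using J by (simp add: H_def mult.assoc)
  qed
  have "?R = (\<integral>\<^sup>+a. \<integral>\<^sup>+x. H a x \<partial>lborel_PiM J \<partial>lborel)"
    unfolding H_def using J by (intro product_nn_integral_insert_rev) auto
  also have "\<dots> = (\<integral>\<^sup>+v. \<integral>\<^sup>+x. H (1 - v) x \<partial>lborel_PiM J \<partial>lborel)"
  proof -
    interpret J: finite_product_sigma_finite "\<lambda>_. lborel :: real measure" J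
      using J by unfold_locales
    have [measurable]: "(\<lambda>(y, x). x(i := y)) \<in>
        borel \<Otimes>\<^sub>M lborel_PiM J \<rightarrow>\<^sub>M lborel_PiM (insert i J)"
      unfolding split_beta' by (intro measurable_fun_upd[where J=J]) (auto, measurable)
    have "(\<lambda>a. \<integral>\<^sup>+x. H a x \<partial>lborel_PiM J) \<in> borel_measurable borel"
      unfolding H_def by measurable
    from nn_integral_real_affine[OF this, where t=1 and c="-1"] show ?thesis by simp
  qed
  also have "\<dots> = ?L"
  proof (intro nn_integral_cong)
    fix v :: real
    show "(\<integral>\<^sup>+x. H (1 - v) x \<partial>lborel_PiM J) =
      indicator (S i) (1 - v) * box_intensity \<theta> J (rescale v S) * stick_density \<theta> v"
    proof (cases "1 - v \<in> S i \<and> 0 < v")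
      case True
      then have v: "0 < v" "v < 1" using Smem[of "1 - v" i] by auto
      have "H (1 - v) x = stick_density \<theta> v * ennreal (inverse (v ^ card J)) *
         ((\<Prod>j\<in>J. indicator (S j) (x j)) * pd_dens \<theta> J (\<lambda>j. x j / v))" for x
      proof (cases "\<forall>j\<in>J. x j \<in> S j")
        case t: True
        then have "(\<Prod>j\<in>J. indicator (S j) (x j) :: ennreal) = 1" by simp
        moreover have "\<And>j. j \<in> J \<Longrightarrow> 0 < x j" using t Smem by auto
        ultimately show ?thesis using True stick_density_first[OF \<theta> v J, of x] by (simp add: H_eq)
      next
        case False
        then have z: "(\<Prod>j\<in>J. indicator (S j) (x j) :: ennreal) = 0" using J by (auto simp: prod_indicator_eq)
        show ?thesis unfolding H_eq z by simp
      qed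
      moreover have [measurable]: "(\<lambda>x. (\<Prod>j\<in>J. indicator (S j) (x j)) * pd_dens \<theta> J (\<lambda>j. x j / v))
          \<in> borel_measurable (lborel_PiM J)" by measurable
      ultimately show ?thesis
        using box_intensity_scale[OF v(1) J(1), of S \<theta>] True S(1)
        by (simp add: nn_integral_cmult mult_ac)
    next
      case False
      have "\<not> (0 < v \<and> 1 - v \<in> S i \<and> v < 1)" using False by auto
      moreover have "pd_dens \<theta> (insert i J) (x(i := 1 - v)) = 0"
        if "\<forall>j\<in>J. x j \<in> S j" "v \<le> 0" for x
      proof -
        have "sum (x(i := 1 - v)) (insert i J) = (1 - v) + sum x J"
          using J by (auto intro!: sum.cong)
        moreover have "0 \<le> sum x J" using that Smem by (intro sum_nonneg) (auto intro: less_imp_le)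
        ultimately show ?thesis using that unfolding pd_dens_def by simp
      qed
      then have "H (1 - v) x = 0" for x
      proof (cases "\<forall>j\<in>J. x j \<in> S j")
        case False
        then have z: "(\<Prod>j\<in>J. indicator (S j) (x j) :: ennreal) = 0" using J by (auto simp: prod_indicator_eq)
        show ?thesis unfolding H_eq z by simp
      qed (use False in \<open>auto simp: H_eq\<close>)
      ultimately show ?thesis using False by (auto simp: stick_density_def split: split_indicator)
    qed
  qed
  finally show ?thesis ..
qed

text \<open>Once Fubini has exchanged the integrals over v and x, \<open>stick_density_rest\<close>
  applies pointwise in x.\<close>

lemma box_intensity_rest:
  assumes \<theta>: "0 < \<theta>" and I: "finite I" "I \<noteq> {}"
    and S: "\<And>j. j \<in> I \<Longrightarrow> S j \<in> sets borel" "\<And>j. j \<in> I \<Longrightarrow> S j \<subseteq> {0<..}"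
  shows "(\<integral>\<^sup>+v. box_intensity \<theta> I (rescale v S) * stick_density \<theta> v \<partial>lborel) =
    (\<integral>\<^sup>+x. (\<Prod>j\<in>I. indicator (S j) (x j)) * (ennreal (1 - sum x I) * pd_dens \<theta> I x) \<partial>lborel_PiM I)" (is "?L = _")
proof -
  interpret product_sigma_finite "\<lambda>_. lborel :: real measure" ..
  interpret I: finite_product_sigma_finite "\<lambda>_. lborel :: real measure" I
    using I by unfold_locales
  interpret P: pair_sigma_finite "lborel :: real measure" "lborel_PiM I" ..
  note [measurable] = S(1)
  define p where "p x = (\<Prod>j\<in>I. indicator (S j) (x j) :: ennreal)" for x
  have [measurable]: "p \<in> borel_measurable (lborel_PiM I)" unfolding p_def by measurable
  define G where "G v x = p x * (stick_density \<theta> v * ennreal (inverse (v ^ card I)) * pd_dens \<theta> I (\<lambda>j. x j / v))" for v x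
  have [measurable]: "case_prod G \<in> borel_measurable (lborel \<Otimes>\<^sub>M lborel_PiM I)"
    unfolding G_def by measurable
  have "?L =
     (\<integral>\<^sup>+v. \<integral>\<^sup>+x. G v x \<partial>lborel_PiM I \<partial>lborel)"
  proof (intro nn_integral_cong)
    fix v :: real
    show "box_intensity \<theta> I (rescale v S) * stick_density \<theta> v = (\<integral>\<^sup>+x. G v x \<partial>lborel_PiM I)"
    proof (cases "0 < v \<and> v < 1")
      case True
      have "G v x = stick_density \<theta> v * ennreal (inverse (v ^ card I)) * (p x * pd_dens \<theta> I (\<lambda>j. x j / v))" for x
        by (simp add: G_def mult_ac)
      then have "(\<integral>\<^sup>+x. G v x \<partial>lborel_PiM I) = stick_density \<theta> v * ennreal (inverse (v ^ card I)) *
          (\<integral>\<^sup>+x. p x * pd_dens \<theta> I (\<lambda>j. x j / v) \<partial>lborel_PiM I)"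
        by (simp add: nn_integral_cmult)
      with True box_intensity_scale[OF _ I(1), of v S \<theta>] S(1) show ?thesis by (simp add: p_def mult_ac)
    qed (auto simp: G_def stick_density_def)
  qed
  also have "\<dots> = (\<integral>\<^sup>+x. \<integral>\<^sup>+v. G v x \<partial>lborel \<partial>lborel_PiM I)"
    by (rule P.Fubini'[symmetric]) measurable
  also have "\<dots> = (\<integral>\<^sup>+x. p x * (ennreal (1 - sum x I) * pd_dens \<theta> I x) \<partial>lborel_PiM I)"
  proof (intro nn_integral_cong)
    fix x :: "'a \<Rightarrow> real"
    show "(\<integral>\<^sup>+v. G v x \<partial>lborel) = p x * (ennreal (1 - sum x I) * pd_dens \<theta> I x)"
    proof (cases "\<forall>j\<in>I. x j \<in> S j")
      case True
      then have "\<And>j. j \<in> I \<Longrightarrow> 0 < x j" using S(2) by auto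
      moreover have "p x = 1" using True by (simp add: p_def)
      ultimately show ?thesis using stick_density_rest[OF \<theta> I, of x] by (simp add: G_def)
    next
      case False
      then have "p x = 0" using I by (auto simp: p_def prod_indicator_eq)
      then show ?thesis by (simp add: G_def)
    qed
  qed
  finally show ?thesis by (simp add: p_def)
qed

lemma box_intensity_recursion:
  assumes \<theta>: "0 < \<theta>" and I: "finite I" "I \<noteq> {}"
    and S: "\<And>j. j \<in> I \<Longrightarrow> S j \<in> sets borel" "\<And>j. j \<in> I \<Longrightarrow> S j \<subseteq> {0<..}"
  shows "box_intensity \<theta> I S =
    (\<integral>\<^sup>+v. box_intensity \<theta> I (rescale v S) * stick_density \<theta> v \<partial>lborel) +
    (\<Sum>i\<in>I. \<integral>\<^sup>+v. indicator (S i) (1 - v) * box_intensity \<theta> (I - {i}) (rescale v S) * stick_density \<theta> v \<partial>lborel)"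
proof -
  let ?t = "\<lambda>i. \<integral>\<^sup>+v. indicator (S i) (1 - v) * box_intensity \<theta> (I - {i}) (rescale v S) * stick_density \<theta> v \<partial>lborel"
  note [measurable] = S(1)
  let ?p = "\<lambda>x. (\<Prod>j\<in>I. indicator (S j) (x j)) :: ennreal"
  let ?s = "\<lambda>x. \<Sum>i\<in>I. ?p x * (ennreal (x i) * pd_dens \<theta> I x)"
  have "(\<Sum>i\<in>I. ?t i) =
     (\<Sum>i\<in>I. \<integral>\<^sup>+x. ?p x * (ennreal (x i) * pd_dens \<theta> I x) \<partial>lborel_PiM I)"
  proof (intro sum.cong refl)
    fix i assume i: "i \<in> I"
    then have "insert i (I - {i}) = I" by auto
    note ins = this
    show "?t i =
      (\<integral>\<^sup>+x. ?p x * (ennreal (x i) * pd_dens \<theta> I x) \<partial>lborel_PiM I)"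
      by (rule box_intensity_first[OF \<theta>, of "I - {i}" i S, unfolded ins]) (use I S in auto)
  qed
  also have "\<dots> = (\<integral>\<^sup>+x. ?s x \<partial>lborel_PiM I)"
    by (rule nn_integral_sum[symmetric]) measurable
  finally have eq: "(\<Sum>i\<in>I. ?t i) = \<dots>" .
  have "box_intensity \<theta> I S = (\<integral>\<^sup>+x. ?p x * (ennreal (1 - sum x I) * pd_dens \<theta> I x) \<partial>lborel_PiM I) +
    (\<integral>\<^sup>+x. ?s x \<partial>lborel_PiM I)"
    unfolding box_intensity_def
  proof (subst nn_integral_add[symmetric])
    show "(\<integral>\<^sup>+x. ?p x * pd_dens \<theta> I x \<partial>lborel_PiM I) =
      (\<integral>\<^sup>+x. ?p x * (ennreal (1 - sum x I) * pd_dens \<theta> I x) + ?s x \<partial>lborel_PiM I)"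
    proof (intro nn_integral_cong)
      fix x :: "'a \<Rightarrow> real"
      show "?p x * pd_dens \<theta> I x = ?p x * (ennreal (1 - sum x I) * pd_dens \<theta> I x) + ?s x"
      proof (cases "(\<forall>j\<in>I. x j \<in> S j) \<and> sum x I < 1")
        case True
        then have pos: "\<And>j. j \<in> I \<Longrightarrow> 0 \<le> x j" using S(2) by (auto intro: less_imp_le)
        have "(\<Sum>i\<in>I. ennreal (x i)) = ennreal (sum x I)"
          using pos by (rule sum_ennreal)
        moreover have "ennreal (1 - sum x I) + ennreal (sum x I) = ennreal (1 - sum x I + sum x I)"
          using pos True by (intro ennreal_plus[symmetric] sum_nonneg) auto
        ultimately have "?p x * pd_dens \<theta> I x = ?p x * pd_dens \<theta> I x * (ennreal (1 - sum x I) + (\<Sum>i\<in>I. ennreal (x i)))"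
          by simp
        also have "\<dots> = ?p x * (ennreal (1 - sum x I) * pd_dens \<theta> I x) + ?s x"
          unfolding distrib_left sum_distrib_left by (simp only: mult_ac)
        finally show ?thesis .
      next
        case False
        then have "?p x = 0 \<or> pd_dens \<theta> I x = 0" using I by (auto simp: pd_dens_def prod_indicator_eq)
        then show ?thesis
          by (elim disjE) (simp_all only: mult_zero_left mult_zero_right sum.neutral_const add_0_left)
      qed
    qed
  qed measurable
  also note box_intensity_rest[OF \<theta> I S, symmetric]
  finally show ?thesis unfolding eq .
qed

text \<open>The a priori bound for the contraction argument. Each 1 / x_j is at most 1 / \<epsilon>,
  but (1 - t)^(\<theta>-1) is unbounded for \<theta> < 1 and has to be integrated out. One
  coordinate suffices for that, since \<theta> times this power has integral at most 1; the factor
  \<theta> spent there explains the division by \<theta>.\<close>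

lemma box_intensity_finite:
  assumes \<theta>: "0 < \<theta>" and \<epsilon>: "0 < \<epsilon>" and I: "finite I" "I \<noteq> {}"
    and S: "\<And>j. j \<in> I \<Longrightarrow> S j \<in> sets borel" "\<And>j. j \<in> I \<Longrightarrow> S j \<subseteq> {\<epsilon>..}"
  shows "box_intensity \<theta> I S \<le> ennreal ((\<theta> / \<epsilon>) ^ card I / \<theta>)"
proof -
  let ?C = "ennreal ((\<theta> / \<epsilon>) ^ card I / \<theta>)"
  let ?g = "\<lambda>s y. ennreal (\<theta> * (1 - s - y) powr (\<theta> - 1)) * indicator {0<..<1 - s} y"
  let ?p = "\<lambda>J x. \<Prod>j\<in>J. indicator {0..1} (x j :: real) :: ennreal"
  interpret product_sigma_finite "\<lambda>_. lborel :: real measure" ..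
  note [measurable] = S(1)
  \<comment> \<open>The coordinate x_i absorbs the singular factor; the coordinates in J only range
    over the unit cube, of volume 1.\<close>
  obtain i J where J: "finite J" "i \<notin> J" "I = insert i J"
  proof -
    from I obtain i where "i \<in> I" by auto
    with I show ?thesis by (intro that[of "I - {i}" i]) auto
  qed
  have "box_intensity \<theta> I S \<le> (\<integral>\<^sup>+x. ?p J x * (?C *
      ?g (sum x J) (x i)) \<partial>lborel_PiM I)"
    unfolding box_intensity_def
  proof (intro nn_integral_mono)
    fix x :: "'a \<Rightarrow> real"
    show "(\<Prod>j\<in>I. indicator (S j) (x j)) * pd_dens \<theta> I x \<le> ?p J x * (?C *
      ?g (sum x J) (x i))"
    proof (cases "(\<forall>j\<in>I. x j \<in> S j) \<and> sum x I < 1")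
      case True
      then have ge: "\<And>j. j \<in> I \<Longrightarrow> \<epsilon> \<le> x j" using S(2) by auto
      then have pos: "\<And>j. j \<in> I \<Longrightarrow> 0 < x j" using \<epsilon> by (auto intro: less_le_trans)
      have "x j \<le> sum x I" if "j \<in> I" for j using pos that I by (intro member_le_sum) (auto intro: less_imp_le)
      then have "?p J x = 1"
        using True pos J by (intro prod.neutral) (force simp: less_imp_le)
      moreover have "indicator {0<..<1 - sum x J} (x i) = (1::ennreal)" using True pos J by auto
      moreover have "(\<Prod>j\<in>I. indicator (S j) (x j) :: ennreal) = 1" using True by (intro prod.neutral) auto
      moreover have "pd_dens \<theta> I x \<le> ?C * ennreal (\<theta> * (1 - sum x J - x i) powr (\<theta> - 1))"
      proof -
        have "\<epsilon> ^ card I \<le> prod x I" using ge \<epsilon> prod_mono[of I "\<lambda>_. \<epsilon>" x] by (simp add: less_imp_le)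
        then have "\<theta> ^ card I * (1 - sum x I) powr (\<theta> - 1) / prod x I \<le> \<theta> ^ card I * (1 - sum x I) powr (\<theta> - 1) / \<epsilon> ^ card I"
          using \<theta> \<epsilon> by (intro divide_left_mono) (auto intro!: mult_pos_pos prod_pos pos)
        moreover have e: "1 - sum x J - x i = 1 - sum x I" using J by simp
        ultimately show ?thesis using True \<theta> \<epsilon> unfolding pd_dens_def e
          by (simp add: power_divide ennreal_leI flip: ennreal_mult)
      qed
      ultimately show ?thesis by simp
    next
      case False
      then have "(\<Prod>j\<in>I. indicator (S j) (x j) :: ennreal) = 0 \<or> pd_dens \<theta> I x = 0"
        using I by (auto simp: pd_dens_def prod_indicator_eq)
      then show ?thesis by (elim disjE) (simp_all only: mult_zero_left mult_zero_right zero_le)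
    qed
  qed
  also have "\<dots> = (\<integral>\<^sup>+x. \<integral>\<^sup>+y. ?p J x * (?C *
      ?g (sum x J) y) \<partial>lborel \<partial>lborel_PiM J)"
  proof -
    have eqs: "sum (x(i := y)) J = sum x J" "(\<Prod>j\<in>J. indicator {0..1} ((x(i := y)) j)) = ?p J x"
      "(x(i := y)) i = y" for x :: "'a \<Rightarrow> real" and y
      using J by (auto intro!: sum.cong prod.cong)
    let ?f = "\<lambda>x. ?p J x * (?C *
      ?g (sum x J) (x i)) :: ennreal"
    have c: "(\<lambda>x. x j :: real) \<in> borel_measurable (lborel_PiM I)" if "j \<in> I" for j
      using measurable_component_singleton[OF that, of "\<lambda>_. lborel"] by simp
    have iI: "i \<in> I" "\<And>j. j \<in> J \<Longrightarrow> j \<in> I" using J(3) by auto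
    have *: "Measurable.pred M (\<lambda>x. 0 < g x \<and> g x < 1 - h x)"
      if [measurable]: "g \<in> borel_measurable M" "h \<in> borel_measurable M" for M and g h :: "('a \<Rightarrow> real) \<Rightarrow> real"
      by measurable
    have [measurable]: "Measurable.pred (lborel_PiM I) (\<lambda>x. x i \<in> {0<..<1 - sum x J :: real})"
      unfolding greaterThanLessThan_iff by (rule *[of "\<lambda>x. x i" _ "\<lambda>x. sum x J"]) (intro c borel_measurable_sum iI, assumption?)+
    have "?f \<in> borel_measurable (lborel_PiM I)"
    proof -
      have [measurable]: "(\<lambda>x. x i :: real) \<in> borel_measurable (lborel_PiM I)"
        by (intro c iI)
      have [measurable]: "(\<lambda>x. sum x J :: real) \<in> borel_measurable (lborel_PiM I)"
        by (intro c iI borel_measurable_sum)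
      have [measurable]: "(\<lambda>x. \<Prod>j\<in>J. indicator {0..1} (x j :: real) :: ennreal) \<in> borel_measurable (lborel_PiM I)"
        by (intro borel_measurable_prod_ennreal measurable_compose[OF c] iI) auto
      show ?thesis by measurable
    qed
    then have f: "?f \<in> borel_measurable (lborel_PiM (insert i J))"
      by (simp only: J(3))
    have "(\<integral>\<^sup>+x. ?f x \<partial>lborel_PiM (insert i J)) = (\<integral>\<^sup>+x. \<integral>\<^sup>+y. ?f (x(i := y)) \<partial>lborel \<partial>lborel_PiM J)"
      by (rule product_nn_integral_insert[OF J(1,2) f])
    then show ?thesis unfolding J(3)[symmetric] by (simp only: eqs)
  qed
  also have "\<dots> \<le> (\<integral>\<^sup>+x. ?p J x * ?C \<partial>lborel_PiM J)"
  proof (rule nn_integral_mono)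
    fix x :: "'a \<Rightarrow> real"
    let ?k = "\<integral>\<^sup>+y. ?g (sum x J) y \<partial>lborel"
    have k: "?k \<le> 1" if "\<forall>j\<in>J. 0 \<le> x j"
    proof (cases "sum x J < 1")
      case True
      have "0 \<le> sum x J" using that by (intro sum_nonneg) auto
      then have "(1 - sum x J) powr \<theta> \<le> 1" using True \<theta> by (intro powr_le1) auto
      then show ?thesis using nn_integral_powr_reflect[OF \<theta>, of "1 - sum x J"] True by simp
    qed simp
    have z: "?p J x = 0" if "\<not> (\<forall>j\<in>J. 0 \<le> x j)"
      using that J by (auto simp: prod_indicator_eq)
    have fac: "(\<integral>\<^sup>+y. c * (d * ?g (sum x J) y) \<partial>lborel) =
      c * d * ?k" for c d by (simp add: nn_integral_cmult mult.assoc)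
    show "(\<integral>\<^sup>+y. ?p J x * (?C *
      ?g (sum x J) y) \<partial>lborel)
      \<le> ?p J x * ?C"
    proof (cases "\<forall>j\<in>J. 0 \<le> x j")
      case True
      with k have "c * ?k \<le> c" for c
        using mult_left_mono[of ?k 1 c] by simp
      then show ?thesis unfolding fac .
    next
      case False
      show ?thesis unfolding z[OF False] by simp
    qed
  qed
  also have "\<dots> = ?C"
    using J by (simp add: nn_integral_multc product_nn_integral_prod[where f="\<lambda>_. indicator {0..1}"])
  finally show ?thesis .
qed

subsection \<open>The recursion for the stick-breaking sequence\<close>

lemma prob_space_uniform_01: "prob_space (uniform_measure lborel {0<..<1::real})"
  by (rule prob_space_uniform_measure) auto

abbreviation unif_seq :: "(nat \<Rightarrow> real) measure" where
  "unif_seq \<equiv> \<Pi>\<^sub>M i\<in>UNIV. uniform_measure lborel {0<..<1}"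

interpretation unif_seq: sequence_space "uniform_measure lborel {0<..<1::real}"
  unfolding sequence_space_def product_prob_space_def product_prob_space_axioms_def product_sigma_finite_def
  by (simp add: prob_space_uniform_01 prob_space_imp_sigma_finite)

lemma sets_unif_seq[measurable_cong]: "sets unif_seq = sets borel_seq"
  by (intro sets_PiM_cong) auto

lemma AE_unif_seq: "AE u in unif_seq. \<forall>n. 0 < u n \<and> u n < 1"
proof (rule AE_all_countable[THEN iffD2], rule allI)
  fix n :: nat
  have "AE x in uniform_measure lborel {0<..<1::real}. 0 < x \<and> x < 1"
    by (rule AE_uniform_measureI) auto
  then show "AE u in unif_seq. 0 < u n \<and> u n < 1"
    by (intro AE_PiM_component prob_space_uniform_01) auto
qed

lemma measurable_stick_breaking[measurable]:
  "(\<lambda>u. stick_breaking \<theta> u n) \<in> borel_measurable borel_seq"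
  unfolding stick_breaking_def by measurable

lemma stick_breaking_case_nat:
  "stick_breaking \<theta> (case_nat s w) 0 = 1 - s powr (1 / \<theta>)"
  "stick_breaking \<theta> (case_nat s w) (Suc n) = s powr (1 / \<theta>) * stick_breaking \<theta> w n"
  by (simp_all add: stick_breaking_def prod.lessThan_Suc_shift del: prod.lessThan_Suc)

lemma sum_stick_breaking: "(\<Sum>n<N. stick_breaking \<theta> u n) = 1 - (\<Prod>i<N. u i powr (1 / \<theta>))"
  by (induction N) (simp_all add: stick_breaking_def algebra_simps)

lemma stick_breaking_bounds:
  assumes "0 < \<theta>" "\<And>n. 0 < u n \<and> u n < 1"
  shows "0 < stick_breaking \<theta> u n" "stick_breaking \<theta> u n < 1" "(\<Sum>n<N. stick_breaking \<theta> u n) \<le> 1"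
proof -
  have v: "0 < u n powr (1 / \<theta>)" "u n powr (1 / \<theta>) < 1" for n
    using assms(1) assms(2)[of n] powr_less_mono2[of "1/\<theta>" "u n" 1] by auto
  show p: "0 < stick_breaking \<theta> u n" for n
    unfolding stick_breaking_def using v by (intro mult_pos_pos prod_pos) auto
  show "(\<Sum>n<N. stick_breaking \<theta> u n) \<le> 1" for N
    unfolding sum_stick_breaking using prod_nonneg[of "{..<N}" "\<lambda>i. u i powr (1 / \<theta>)"] by simp
  have "(\<Prod>i<Suc n. u i powr (1 / \<theta>)) > 0" using v by (intro prod_pos) auto
  moreover have "stick_breaking \<theta> u n \<le> (\<Sum>i<Suc n. stick_breaking \<theta> u i)"
    using p by (intro member_le_sum) (auto intro: less_imp_le)
  ultimately show "stick_breaking \<theta> u n < 1" unfolding sum_stick_breaking by linarith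
qed

text \<open>Counts run along the unsorted sequence, where the first stick can be split off; sorting
  does not change them, by \<open>multisubset_of_desc_sort_stick\<close>.\<close>

definition stick_count :: "real \<Rightarrow> (nat \<Rightarrow> real) \<Rightarrow> real set \<Rightarrow> ennreal" where
  "stick_count \<theta> u S = (\<Sum>n. indicator S (stick_breaking \<theta> u n))"

lemma measurable_stick_count[measurable]:
  assumes [measurable]: "S \<in> sets borel"
  shows "(\<lambda>u. stick_count \<theta> u S) \<in> borel_measurable borel_seq"
  unfolding stick_count_def by measurable

lemma measurable_stick_count_scale[measurable]:
  assumes [measurable]: "S \<in> sets borel"
  shows "(\<lambda>(v, u). stick_count \<theta> u ((*) v -` S)) \<in> borel_measurable (borel \<Otimes>\<^sub>M borel_seq)"
proof -
  have "(\<lambda>(v, u). stick_count \<theta> u ((*) v -` S)) = (\<lambda>(v, u). \<Sum>n. indicator S (v * stick_breaking \<theta> u n))"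
    by (auto simp: stick_count_def indicator_def fun_eq_iff)
  also have "\<dots> \<in> borel_measurable (borel \<Otimes>\<^sub>M borel_seq)" by measurable
  finally show ?thesis .
qed

lemma stick_count_case_nat:
  "stick_count \<theta> (case_nat s w) S =
     indicator S (1 - s powr (1 / \<theta>)) + stick_count \<theta> w ((*) (s powr (1 / \<theta>)) -` S)"
proof -
  let ?f = "\<lambda>n. indicator S (stick_breaking \<theta> (case_nat s w) n) :: ennreal"
  have "(\<lambda>n. ?f (Suc n)) sums (\<Sum>n. ?f (Suc n))" by (rule summable_sums) simp
  then have "?f sums ((\<Sum>n. ?f (Suc n)) + ?f 0)" by (rule sums_Suc)
  then have "suminf ?f = (\<Sum>n. ?f (Suc n)) + ?f 0" by (rule sums_unique[symmetric])
  then show ?thesis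
    by (simp add: stick_count_def stick_breaking_case_nat add.commute indicator_def)
qed

text \<open>Every stick in S weighs at least \<epsilon>, and all sticks together weigh at most
  1.\<close>

lemma stick_count_atLeast:
  assumes "0 < \<theta>" "\<And>n. 0 < u n \<and> u n < 1" "0 < \<epsilon>" "S \<subseteq> {\<epsilon>..}"
  shows "stick_count \<theta> u S \<le> ennreal (1 / \<epsilon>)"
proof -
  note b = stick_breaking_bounds[of \<theta> u, OF assms(1,2)]
  have "stick_count \<theta> u S \<le> (\<Sum>n. ennreal (1 / \<epsilon>) * ennreal (stick_breaking \<theta> u n))"
    unfolding stick_count_def
  proof (intro suminf_le)
    fix n
    show "indicator S (stick_breaking \<theta> u n) \<le> ennreal (1 / \<epsilon>) * ennreal (stick_breaking \<theta> u n)"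
    proof (cases "stick_breaking \<theta> u n \<in> S")
      case True
      then have "1 \<le> 1 / \<epsilon> * stick_breaking \<theta> u n" using assms(3,4) by (auto simp: field_simps)
      then show ?thesis using True assms(3) b(1)[of n]
        by (simp add: less_imp_le flip: ennreal_mult ennreal_1 del: ennreal_1)
    qed simp
  qed auto
  also have "\<dots> = ennreal (1 / \<epsilon>) * (\<Sum>n. ennreal (stick_breaking \<theta> u n))" by simp
  also have "(\<Sum>n. ennreal (stick_breaking \<theta> u n)) \<le> 1"
    using b by (intro suminf_le_const) (auto simp: less_imp_le ennreal_le_1 intro: sum_nonneg)
  finally show ?thesis by (simp add: mult_left_mono)
qed

definition stick_moment :: "real \<Rightarrow> 'i set \<Rightarrow> ('i \<Rightarrow> real set) \<Rightarrow> ennreal" where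
  "stick_moment \<theta> I S = (\<integral>\<^sup>+u. (\<Prod>i\<in>I. stick_count \<theta> u (S i)) \<partial>unif_seq)"

lemma prod_mono_ennreal:
  fixes f g :: "'i \<Rightarrow> ennreal"
  assumes "\<And>i. i \<in> I \<Longrightarrow> f i \<le> g i" shows "prod f I \<le> prod g I"
  using assms by (induction I rule: infinite_finite_induct) (auto intro: mult_mono)

text \<open>A point lies in at most one of the disjoint sets, so all terms of the expanded product
  with two indicators vanish.\<close>

lemma prod_add_disjoint_indicator:
  fixes b :: "'i \<Rightarrow> ennreal"
  assumes "finite I" "disjoint_family_on S I"
  shows "(\<Prod>i\<in>I. indicator (S i) a + b i) = (\<Prod>i\<in>I. b i) + (\<Sum>i\<in>I. indicator (S i) a * (\<Prod>j\<in>I - {i}. b j))"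
proof (cases "\<exists>i\<in>I. a \<in> S i")
  case True
  then obtain i where i: "i \<in> I" "a \<in> S i" by auto
  have o: "a \<notin> S j" if "j \<in> I" "j \<noteq> i" for j
    using disjoint_family_onD[OF assms(2) that(1) i(1) that(2)] i(2) by auto
  have "(\<Prod>j\<in>I. indicator (S j) a + b j) = (1 + b i) * (\<Prod>j\<in>I - {i}. indicator (S j) a + b j)"
    using i assms(1) by (subst prod.remove[of I i]) auto
  also have "(\<Prod>j\<in>I - {i}. indicator (S j) a + b j) = (\<Prod>j\<in>I - {i}. b j)"
    using o by (intro prod.cong) auto
  also have "(1 + b i) * \<dots> = (\<Prod>j\<in>I. b j) + (\<Prod>j\<in>I - {i}. b j)"
    using i assms(1) by (subst prod.remove[of I i b]) (auto simp: distrib_right add.commute)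
  also have "(\<Prod>j\<in>I - {i}. b j) = (\<Sum>k\<in>I. indicator (S k) a * (\<Prod>j\<in>I - {k}. b j))"
    using i assms(1) o by (subst sum.remove[of I i]) auto
  finally show ?thesis .
qed auto

lemma measurable_stick_moment_integrand[measurable (raw)]:
  assumes [measurable]: "\<And>i. i \<in> I \<Longrightarrow> S i \<in> sets borel"
  shows "(\<lambda>(v, u). \<Prod>i\<in>I. stick_count \<theta> u ((*) v -` S i)) \<in> borel_measurable (borel \<Otimes>\<^sub>M unif_seq)"
  unfolding split_beta'
  by (intro borel_measurable_prod_ennreal)
     (use measurable_stick_count_scale[of "S _" \<theta>, unfolded split_beta'] assms in \<open>auto cong: measurable_cong_sets\<close>)

lemma stick_moment_recursion:
  assumes \<theta>: "0 < \<theta>" and I: "finite I" "disjoint_family_on S I" and S: "\<And>i. i \<in> I \<Longrightarrow> S i \<in> sets borel"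
  shows "stick_moment \<theta> I S =
    (\<integral>\<^sup>+v. stick_moment \<theta> I (rescale v S) * stick_density \<theta> v \<partial>lborel) +
    (\<Sum>i\<in>I. \<integral>\<^sup>+v. indicator (S i) (1 - v) * stick_moment \<theta> (I - {i}) (rescale v S) * stick_density \<theta> v \<partial>lborel)"
proof -
  let ?t = "\<lambda>i. \<integral>\<^sup>+v. indicator (S i) (1 - v) * stick_moment \<theta> (I - {i}) (rescale v S) * stick_density \<theta> v \<partial>lborel"
  note [measurable] = S
  let ?b = "\<lambda>v w j. stick_count \<theta> w ((*) v -` S j)"
  define H where "H v = (\<integral>\<^sup>+w. (\<Prod>i\<in>I. indicator (S i) (1 - v) + ?b v w i) \<partial>unif_seq)" for v
  have mb[measurable]: "(\<lambda>(v, w). \<Prod>i\<in>J. ?b v w i) \<in> borel_measurable (borel \<Otimes>\<^sub>M unif_seq)" if "J \<subseteq> I" for J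
    using that S by (intro measurable_stick_moment_integrand) auto
  have mw[measurable]: "(\<lambda>w. \<Prod>i\<in>J. ?b v w i) \<in> borel_measurable unif_seq" if "J \<subseteq> I" for J v
    using measurable_compose[OF measurable_Pair1' mb[OF that], of v] by simp
  have mm[measurable]: "(\<lambda>v. stick_moment \<theta> J (rescale v S)) \<in> borel_measurable borel" if "J \<subseteq> I" for J
    unfolding stick_moment_def using mb[OF that] by (rule unif_seq.borel_measurable_nn_integral)
  have H: "H v = stick_moment \<theta> I (rescale v S) +
      (\<Sum>i\<in>I. indicator (S i) (1 - v) * stick_moment \<theta> (I - {i}) (rescale v S))" for v
    unfolding H_def prod_add_disjoint_indicator[OF I]
    by (subst nn_integral_add) (auto simp: nn_integral_sum nn_integral_cmult stick_moment_def intro!: mw borel_measurable_sum)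
  have [measurable]: "H \<in> borel_measurable borel" unfolding H by measurable
  \<comment> \<open>\<open>PiM_iter\<close> presents the sequence of uniform variables as one
    variable in front of an independent sequence; the one in front becomes v.\<close>
  have "stick_moment \<theta> I S = (\<integral>\<^sup>+u. (\<Prod>i\<in>I. stick_count \<theta> u (S i))
      \<partial>distr (uniform_measure lborel {0<..<1} \<Otimes>\<^sub>M unif_seq) unif_seq (\<lambda>(s, \<omega>). case_nat s \<omega>))"
    unfolding stick_moment_def unif_seq.PiM_iter ..
  also have "\<dots> = (\<integral>\<^sup>+z. (\<Prod>i\<in>I. stick_count \<theta> (case_nat (fst z) (snd z)) (S i))
      \<partial>(uniform_measure lborel {0<..<1} \<Otimes>\<^sub>M unif_seq))"
    by (subst nn_integral_distr) (auto simp: split_beta')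
  also have "\<dots> = (\<integral>\<^sup>+s. \<integral>\<^sup>+w. (\<Prod>i\<in>I. stick_count \<theta> (case_nat s w) (S i)) \<partial>unif_seq \<partial>uniform_measure lborel {0<..<1})"
    by (subst unif_seq.nn_integral_fst[symmetric]) auto
  also have "\<dots> = (\<integral>\<^sup>+s. H (s powr (1 / \<theta>)) \<partial>uniform_measure lborel {0<..<1})"
    unfolding H_def stick_count_case_nat ..
  also have "\<dots> = (\<integral>\<^sup>+v. H v * stick_density \<theta> v \<partial>lborel)"
    by (rule nn_integral_stick[OF \<theta>]) measurable
  also have "\<dots> = (\<integral>\<^sup>+v. stick_moment \<theta> I (rescale v S) * stick_density \<theta> v +
     (\<Sum>i\<in>I. indicator (S i) (1 - v) * stick_moment \<theta> (I - {i}) (rescale v S) * stick_density \<theta> v) \<partial>lborel)"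
    unfolding H distrib_right sum_distrib_right ..
  also have "\<dots> = (\<integral>\<^sup>+v. stick_moment \<theta> I (rescale v S) * stick_density \<theta> v \<partial>lborel) +
    (\<Sum>i\<in>I. ?t i)"
    by (subst nn_integral_add) (auto simp: nn_integral_sum)
  finally show ?thesis .
qed

lemma stick_density_total:
  assumes "0 < \<theta>" shows "(\<integral>\<^sup>+v. stick_density \<theta> v \<partial>lborel) = 1"
  using nn_integral_powr_upto[OF assms, of 1] by (simp add: stick_density_def)

text \<open>The mass below \<epsilon> is min(\<epsilon>, 1)^\<theta> > 0, so the contraction factor
  q stays strictly below 1.\<close>

lemma stick_density_tail:
  assumes \<theta>: "0 < \<theta>" and \<epsilon>: "0 < \<epsilon>"
  obtains q where "0 \<le> q" "q < 1" "(\<integral>\<^sup>+v. stick_density \<theta> v * indicator {\<epsilon>..} v \<partial>lborel) = ennreal q"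
proof -
  let ?p = "\<integral>\<^sup>+v. stick_density \<theta> v * indicator {\<epsilon>..} v \<partial>lborel"
  define c where "c = min \<epsilon> 1 powr \<theta>"
  have c: "0 < c" "c \<le> 1" using \<theta> \<epsilon> by (auto simp: c_def intro!: powr_le1)
  have "(\<integral>\<^sup>+v. stick_density \<theta> v * indicator {..<\<epsilon>} v \<partial>lborel) =
     (\<integral>\<^sup>+v. ennreal (\<theta> * v powr (\<theta> - 1)) * indicator {0<..<min \<epsilon> 1} v \<partial>lborel)"
    unfolding stick_density_def by (intro nn_integral_cong) (auto split: split_indicator)
  also have "\<dots> = ennreal c" using nn_integral_powr_upto[OF \<theta>, of "min \<epsilon> 1"] \<epsilon> by (simp add: c_def)
  finally have "?p + ennreal c = (\<integral>\<^sup>+v. stick_density \<theta> v * indicator {\<epsilon>..} v + stick_density \<theta> v * indicator {..<\<epsilon>} v \<partial>lborel)"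
    by (subst nn_integral_add) auto
  also have "\<dots> = (\<integral>\<^sup>+v. stick_density \<theta> v \<partial>lborel)"
    by (intro nn_integral_cong) (auto split: split_indicator)
  finally have "?p + ennreal c = 1" using stick_density_total[OF \<theta>] by simp
  then have "?p = ennreal (1 - c)"
    using c by (metis ennreal_1 ennreal_add_diff_cancel_right ennreal_minus ennreal_neq_top less_imp_le)
  with c show ?thesis by (intro that[of "1 - c"]) auto
qed

text \<open>One step of the recursion reproduces the excess of \<open>X\<close> over \<open>Y\<close> only with the probability
  \<open>q < 1\<close> that the first stick leaves at least \<open>\<epsilon>\<close>.\<close>

lemma stick_recursion_le:
  fixes X Y c :: "'s \<Rightarrow> ennreal"
  assumes \<theta>: "0 < \<theta>" and \<epsilon>: "0 < \<epsilon>"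
    and X: "\<And>S. S \<in> C \<Longrightarrow> X S = (\<integral>\<^sup>+v. X (sc v S) * stick_density \<theta> v \<partial>lborel) + c S"
    and Y: "\<And>S. S \<in> C \<Longrightarrow> Y S = (\<integral>\<^sup>+v. Y (sc v S) * stick_density \<theta> v \<partial>lborel) + c S"
    and Ym: "\<And>S. S \<in> C \<Longrightarrow> (\<lambda>v. Y (sc v S)) \<in> borel_measurable borel"
    and C: "\<And>S v. S \<in> C \<Longrightarrow> 0 < v \<Longrightarrow> v < 1 \<Longrightarrow> sc v S \<in> C"
    and zero: "\<And>S v. S \<in> C \<Longrightarrow> 0 < v \<Longrightarrow> v < \<epsilon> \<Longrightarrow> X (sc v S) = 0"
    and bound: "\<And>S. S \<in> C \<Longrightarrow> X S \<le> ennreal K"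
    and S: "S \<in> C"
  shows "X S \<le> Y S"
proof -
  \<comment> \<open>Subtraction in \<open>ennreal\<close> truncates at 0, so D measures only the
    excess of X over Y. The reverse inequality comes from exchanging the roles of X and Y.\<close>
  define D where "D = (SUP S\<in>C. X S - Y S)"
  have "D \<le> ennreal K" unfolding D_def by (intro SUP_least ennreal_diff_le_mono_left bound)
  then obtain d where d: "0 \<le> d" "D = ennreal d" by (cases D) (auto simp: top_unique)
  have XY: "X S \<le> Y S + D" if "S \<in> C" for S
  proof -
    have "X S - Y S \<le> D" using that unfolding D_def by (rule SUP_upper)
    then show ?thesis by (simp add: ennreal_minus_le_iff)
  qed
  obtain q where q: "0 \<le> q" "q < 1" "(\<integral>\<^sup>+v. stick_density \<theta> v * indicator {\<epsilon>..} v \<partial>lborel) = ennreal q"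
    using stick_density_tail[OF \<theta> \<epsilon>] .
  have "X S - Y S \<le> D * ennreal q" if S: "S \<in> C" for S
  proof -
    note [measurable] = Ym[OF S]
    have "X S \<le> (\<integral>\<^sup>+v. Y (sc v S) * stick_density \<theta> v + D * (stick_density \<theta> v * indicator {\<epsilon>..} v) \<partial>lborel) + c S"
      unfolding X[OF S]
    proof (intro add_right_mono nn_integral_mono)
      fix v :: real
      show "X (sc v S) * stick_density \<theta> v \<le> Y (sc v S) * stick_density \<theta> v + D * (stick_density \<theta> v * indicator {\<epsilon>..} v)"
      proof (cases "0 < v \<and> v < 1")
        case v: True
        show ?thesis
        proof (cases "v < \<epsilon>")
          case True
          then show ?thesis using zero[OF S, of v] v by simp
        next
          case False
          have "X (sc v S) * stick_density \<theta> v \<le> (Y (sc v S) + D) * stick_density \<theta> v"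
            using v by (intro mult_right_mono XY C S) auto
          then show ?thesis using False by (simp add: distrib_right)
        qed
      qed (auto simp: stick_density_def)
    qed
    also have "\<dots> = Y S + D * ennreal q"
      unfolding Y[OF S] by (subst nn_integral_add) (auto simp: nn_integral_cmult q(3) ac_simps)
    finally show ?thesis using bound[OF S] by (auto simp: ennreal_minus_le_iff top_unique)
  qed
  then have "D \<le> D * ennreal q" unfolding D_def by (intro SUP_least) (simp add: D_def)
  \<comment> \<open>Finiteness of D, obtained from the bound K on X, is essential: an infinite D
    could satisfy D \<le> D q as well.\<close>
  then have "d \<le> d * q" using d q by (simp flip: ennreal_mult)
  then have "d = 0" using d q by (smt (verit) mult_left_le mult_less_cancel_left2)
  with XY[OF S] d show ?thesis by simp
qed

text \<open>Induction over I: the inhomogeneous part c involves only the index sets I - {i}, where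
  both sides agree already. The class C is closed under rescaling, since division by v < 1 moves
  sets away from 0, and both sides vanish once v < \<epsilon> pushes the sets past 1. Comparing in
  both directions gives equality.\<close>

lemma stick_moment_eq_box_intensity:
  assumes \<theta>: "0 < \<theta>" and \<epsilon>: "0 < \<epsilon>" and "finite I" and "disjoint_family_on S I"
    and "\<And>i. i \<in> I \<Longrightarrow> S i \<in> sets borel" "\<And>i. i \<in> I \<Longrightarrow> S i \<subseteq> {\<epsilon>..}"
  shows "stick_moment \<theta> I S = box_intensity \<theta> I S"
  using assms(3-)
proof (induction I arbitrary: S rule: finite_psubset_induct)
  case (psubset I)
  show ?case
  proof (cases "I = {}")
    case True
    interpret p: product_sigma_finite "\<lambda>_. lborel :: real measure" ..
    show ?thesis unfolding True box_intensity_def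
      by (subst p.nn_integral_empty) (simp_all add: stick_moment_def pd_dens_def unif_seq.emeasure_space_1)
  next
    case False
    define C where "C = {S. disjoint_family_on S I \<and> (\<forall>i\<in>I. S i \<in> sets borel \<and> S i \<subseteq> {\<epsilon>..})}"
    define sc where "sc v S = (rescale v S)" for v :: real and S :: "'a \<Rightarrow> real set"
    define c where "c S = (\<Sum>i\<in>I. \<integral>\<^sup>+v. indicator (S i) (1 - v) * stick_moment \<theta> (I - {i}) (sc v S) * stick_density \<theta> v \<partial>lborel)" for S
    have sc: "sc v S \<in> C" if "S \<in> C" "0 < v" "v < 1" for v S
    proof -
      have "(*) v -` S i \<in> sets borel" if "i \<in> I" for i
        using measurable_sets[of "(*) v" borel borel "S i"] that \<open>S \<in> C\<close> by (auto simp: C_def)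
      moreover have "(*) v -` S i \<subseteq> {\<epsilon>..}" if "i \<in> I" for i
      proof
        fix x assume "x \<in> (*) v -` S i"
        then have "\<epsilon> \<le> v * x" using that \<open>S \<in> C\<close> by (auto simp: C_def)
        moreover have "0 < x" using calculation \<epsilon> \<open>0 < v\<close> by (smt (verit) mult_nonneg_nonpos)
        moreover have "v * x \<le> 1 * x" using calculation \<open>v < 1\<close> by (intro mult_right_mono) auto
        ultimately have "\<epsilon> \<le> x" by linarith
        then show "x \<in> {\<epsilon>..}" by simp
      qed
      moreover have "disjoint_family_on (sc v S) I"
        using \<open>S \<in> C\<close> by (fastforce simp: C_def sc_def disjoint_family_on_def)
      ultimately show ?thesis by (auto simp: C_def sc_def)
    qed
    have rec_m: "stick_moment \<theta> I S = (\<integral>\<^sup>+v. stick_moment \<theta> I (sc v S) * stick_density \<theta> v \<partial>lborel) + c S"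
      if "S \<in> C" for S
      using that stick_moment_recursion[OF \<theta> psubset.hyps, of S] by (auto simp: C_def c_def sc_def)
    have rec_b: "box_intensity \<theta> I S = (\<integral>\<^sup>+v. box_intensity \<theta> I (sc v S) * stick_density \<theta> v \<partial>lborel) + c S"
      if S: "S \<in> C" for S
    proof -
      have "(\<integral>\<^sup>+v. indicator (S i) (1 - v) * box_intensity \<theta> (I - {i}) (sc v S) * stick_density \<theta> v \<partial>lborel) =
         (\<integral>\<^sup>+v. indicator (S i) (1 - v) * stick_moment \<theta> (I - {i}) (sc v S) * stick_density \<theta> v \<partial>lborel)"
        if i: "i \<in> I" for i
      proof (intro nn_integral_cong)
        fix v :: real
        show "indicator (S i) (1 - v) * box_intensity \<theta> (I - {i}) (sc v S) * stick_density \<theta> v =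
          indicator (S i) (1 - v) * stick_moment \<theta> (I - {i}) (sc v S) * stick_density \<theta> v"
        proof (cases "0 < v \<and> v < 1")
          case True
          then have "sc v S \<in> C" using sc S by auto
          then have "stick_moment \<theta> (I - {i}) (sc v S) = box_intensity \<theta> (I - {i}) (sc v S)"
            using i by (intro psubset.IH) (auto simp: C_def intro: disjoint_family_on_mono[rotated])
          then show ?thesis by simp
        qed (auto simp: stick_density_def)
      qed
      moreover have "S i \<in> sets borel" "S i \<subseteq> {0<..}" if "i \<in> I" for i
        using S that \<epsilon> by (force simp: C_def)+
      ultimately show ?thesis
        using box_intensity_recursion[OF \<theta> psubset.hyps False, of S] by (simp add: c_def sc_def)
    qed
    have m_m: "(\<lambda>v. stick_moment \<theta> I (sc v S)) \<in> borel_measurable borel" if "S \<in> C" for S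
      unfolding stick_moment_def sc_def using that
      by (intro unif_seq.borel_measurable_nn_integral measurable_stick_moment_integrand) (auto simp: C_def)
    have m_b: "(\<lambda>v. box_intensity \<theta> I (sc v S)) \<in> borel_measurable borel" if "S \<in> C" for S
    proof -
      interpret I: finite_product_sigma_finite "\<lambda>_. lborel :: real measure" I
        using psubset.hyps by unfold_locales
      have [measurable]: "\<And>i. i \<in> I \<Longrightarrow> S i \<in> sets borel" using that by (auto simp: C_def)
      have "box_intensity \<theta> I (sc v S) = (\<integral>\<^sup>+x. (\<Prod>i\<in>I. indicator (S i) (v * x i)) * pd_dens \<theta> I x \<partial>lborel_PiM I)" for v
        by (simp add: box_intensity_def sc_def indicator_def)
      then show ?thesis by simp
    qed
    have outside: "S i \<subseteq> {1<..}" if "\<exists>S'\<in>C. S = sc v S'" "i \<in> I" "0 < v" "v < \<epsilon>" for S i v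
    proof
      fix x assume "x \<in> S i"
      then have "\<epsilon> \<le> v * x" using that by (auto simp: C_def sc_def)
      then have "v * 1 < v * x" using that(4) by linarith
      then have "1 < x" using that(3) by (simp only: mult_less_cancel_left_pos)
      then show "x \<in> {1<..}" by simp
    qed
    have z_m: "stick_moment \<theta> I (sc v S) = 0" if "S \<in> C" "0 < v" "v < \<epsilon>" for v S
    proof -
      obtain i where i: "i \<in> I" using False by auto
      have "AE u in unif_seq. (\<Prod>i\<in>I. stick_count \<theta> u (sc v S i)) = 0"
        using AE_unif_seq
      proof eventually_elim
        case (elim u)
        have "stick_count \<theta> u (sc v S i) = 0"
        proof -
          have "sc v S i \<subseteq> {1<..}" using outside[of "sc v S" v i] that i by blast
          moreover have "stick_breaking \<theta> u n < 1" for n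
            using stick_breaking_bounds(2)[of \<theta> u n] \<theta> elim by auto
          ultimately have "stick_breaking \<theta> u n \<notin> sc v S i" for n by (meson greaterThan_iff less_asym subsetD)
          then have "indicator (sc v S i) (stick_breaking \<theta> u n) = (0::ennreal)" for n by simp
          then show ?thesis by (simp add: stick_count_def)
        qed
        then show ?case using i psubset.hyps by auto
      qed
      then show ?thesis unfolding stick_moment_def by (simp add: nn_integral_cong_AE[where v="\<lambda>_. 0"])
    qed
    have z_b: "box_intensity \<theta> I (sc v S) = 0" if "S \<in> C" "0 < v" "v < \<epsilon>" for v S
    proof -
      have z: "(\<Prod>i\<in>I. indicator (sc v S i) (x i)) * pd_dens \<theta> I x = 0" for x
      proof (cases "\<forall>i\<in>I. x i \<in> sc v S i")
        case True
        then have "1 < x i" if "i \<in> I" for i using outside[of "sc v S" v i] that \<open>S \<in> C\<close> \<open>0 < v\<close> \<open>v < \<epsilon>\<close> by auto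
        moreover obtain i where i: "i \<in> I" using False by auto
        ultimately have "1 < x i" "x i \<le> sum x I"
          using psubset.hyps by (auto intro!: member_le_sum less_imp_le[OF less_trans[OF zero_less_one]])
        then show ?thesis by (simp add: pd_dens_def)
      next
        case False
        then have "(\<Prod>i\<in>I. indicator (sc v S i) (x i) :: ennreal) = 0"
          using psubset.hyps by (auto simp: prod_indicator_eq)
        then show ?thesis by (simp only: mult_zero_left)
      qed
      show ?thesis unfolding box_intensity_def z by simp
    qed
    have k_m: "stick_moment \<theta> I S \<le> ennreal ((1 / \<epsilon>) ^ card I)" if "S \<in> C" for S
    proof -
      have "stick_moment \<theta> I S \<le> (\<integral>\<^sup>+u. ennreal ((1 / \<epsilon>) ^ card I) \<partial>unif_seq)"
        unfolding stick_moment_def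
      proof (intro nn_integral_mono_AE, use AE_unif_seq in eventually_elim)
        case (elim u)
        have "(\<Prod>i\<in>I. stick_count \<theta> u (S i)) \<le> (\<Prod>i\<in>I. ennreal (1 / \<epsilon>))"
          using that elim \<theta> \<epsilon> by (intro prod_mono_ennreal stick_count_atLeast) (auto simp: C_def)
        also have "\<dots> = ennreal ((1 / \<epsilon>) ^ card I)" using \<epsilon> by (simp add: ennreal_power)
        finally show ?case .
      qed
      then show ?thesis by (simp add: unif_seq.emeasure_space_1)
    qed
    have k_b: "box_intensity \<theta> I S \<le> ennreal ((\<theta> / \<epsilon>) ^ card I / \<theta>)" if "S \<in> C" for S
      using that by (intro box_intensity_finite[OF \<theta> \<epsilon> psubset.hyps False]) (auto simp: C_def)
    have S: "S \<in> C" using psubset.prems by (auto simp: C_def)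
    show ?thesis
    proof (rule antisym)
      show "stick_moment \<theta> I S \<le> box_intensity \<theta> I S"
        by (rule stick_recursion_le[OF \<theta> \<epsilon> rec_m rec_b m_b sc z_m k_m S])
      show "box_intensity \<theta> I S \<le> stick_moment \<theta> I S"
        by (rule stick_recursion_le[OF \<theta> \<epsilon> rec_b rec_m m_m sc z_b k_b S])
    qed
  qed
qed

subsection \<open>Descending rearrangements\<close>

text \<open>The relation c < y n for a descending rearrangement y of g, phrased by counting. It
  ignores the order of g, which gives uniqueness of y, and it is a union over countably many finite
  index sets, which gives measurability.\<close>

definition many_above :: "(nat \<Rightarrow> real) \<Rightarrow> real \<Rightarrow> nat \<Rightarrow> bool" where
  "many_above g c n \<longleftrightarrow> (\<exists>A\<in>{A. finite A \<and> card A = Suc n}. \<forall>m\<in>A. c < g m)"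

lemma many_above_bij:
  assumes "bij \<sigma>" shows "many_above (g \<circ> \<sigma>) c n \<longleftrightarrow> many_above g c n"
proof
  assume "many_above (g \<circ> \<sigma>) c n"
  then obtain A where "finite A" "card A = Suc n" "\<forall>m\<in>A. c < g (\<sigma> m)" by (auto simp: many_above_def)
  moreover have "inj_on \<sigma> A" using assms by (meson bij_is_inj inj_on_subset subset_UNIV)
  ultimately show "many_above g c n" unfolding many_above_def
    by (intro bexI[of _ "\<sigma> ` A"]) (auto simp: card_image)
next
  assume "many_above g c n"
  then obtain A where "finite A" "card A = Suc n" "\<forall>m\<in>A. c < g m" by (auto simp: many_above_def)
  moreover have "inj_on (inv \<sigma>) A" using assms by (meson bij_imp_bij_inv bij_is_inj inj_on_subset subset_UNIV)
  ultimately show "many_above (g \<circ> \<sigma>) c n" unfolding many_above_def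
    using assms by (intro bexI[of _ "inv \<sigma> ` A"]) (auto simp: card_image bij_is_surj surj_f_inv_f)
qed

text \<open>The n + 1 indices cannot all lie below n, and an index m \<ge> n with c < y m gives c <
  y n.\<close>

lemma decseq_gt_iff_many_above:
  assumes "decseq y" shows "c < y n \<longleftrightarrow> many_above y c n"
proof
  assume "c < y n"
  then have "\<forall>m\<in>{..n}. c < y m" using decseqD[OF assms] by (auto intro: less_le_trans)
  then show "many_above y c n" unfolding many_above_def by (intro bexI[of _ "{..n}"]) auto
next
  assume "many_above y c n"
  then obtain A where A: "finite A" "card A = Suc n" "\<forall>m\<in>A. c < y m" by (auto simp: many_above_def)
  have "\<not> A \<subseteq> {..<n}" using A card_mono[of "{..<n}" A] by auto
  then obtain m where "m \<in> A" "n \<le> m" by (meson lessThan_iff not_le subsetI)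
  then show "c < y n" using A decseqD[OF assms] by (meson less_le_trans)
qed

text \<open>By \<open>many_above\<close>, two descending rearrangements exceed the same levels c at
  each place, hence agree.\<close>

lemma desc_sort_eqI:
  assumes "decseq y" "bij \<sigma>" "y = g \<circ> \<sigma>"
  shows "desc_sort g = y"
  unfolding desc_sort_def
proof (rule the_equality)
  fix y' assume "decseq y' \<and> (\<exists>\<sigma>. bij \<sigma> \<and> y' = g \<circ> \<sigma>)"
  then obtain \<tau> where t: "decseq y'" "bij \<tau>" "y' = g \<circ> \<tau>" by auto
  have "c < y' n \<longleftrightarrow> c < y n" for c n
    unfolding decseq_gt_iff_many_above[OF t(1)] decseq_gt_iff_many_above[OF assms(1)]
    unfolding t(3) assms(3) many_above_bij[OF t(2)] many_above_bij[OF assms(2)] ..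
  then show "y' = y" by (metis ext less_irrefl linorder_neqE)
qed (use assms in auto)

text \<open>Order the indices by decreasing value, ties by increasing index. The rank r n counts the
  predecessors B n; it is injective and maps B n onto {..<r n}, so its unbounded range is all of the
  naturals. The rearrangement is the inverse of r.\<close>

lemma descending_rearrangement_exists:
  fixes g :: "nat \<Rightarrow> real"
  assumes fin: "\<And>n. finite {m. g n < g m}"
  obtains \<sigma> where "bij \<sigma>" "decseq (g \<circ> \<sigma>)"
proof -
  define B where "B n = {m. g n < g m \<or> (g m = g n \<and> m < n)}" for n
  have finB: "finite (B n)" for n
    by (rule finite_subset[of _ "{m. g n < g m} \<union> {..<n}"]) (auto simp: B_def fin)
  define r where "r n = card (B n)" for n
  have tot: "m \<in> B n \<or> n \<in> B m" if "m \<noteq> n" for m n using that by (auto simp: B_def)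
  have sub: "insert m (B m) \<subseteq> B n" if "m \<in> B n" for m n using that by (auto simp: B_def)
  have irr: "n \<notin> B n" for n by (auto simp: B_def)
  have mono: "r m < r n" if "m \<in> B n" for m n
    unfolding r_def using sub[OF that] irr[of m] finB[of m] card_mono[OF finB[of n] sub[OF that]] by simp
  have inj: "inj r" using tot mono by (metis injI less_irrefl)
  have imgB: "r ` B n = {..<r n}" for n
  proof (rule card_subset_eq)
    show "r ` B n \<subseteq> {..<r n}" using mono by auto
    have "card (r ` B n) = card (B n)" using inj by (intro card_image) (auto intro: inj_on_subset)
    then show "card (r ` B n) = card {..<r n}" by (simp add: r_def)
  qed simp
  have "surj r"
    unfolding surj_def
  proof
    fix k
    have "infinite (range r)" using inj by (simp add: finite_image_iff)
    then obtain n where "k < r n" by (metis infinite_nat_iff_unbounded rangeE)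
    then show "\<exists>x. k = r x" using imgB[of n] by (metis imageE lessThan_iff)
  qed
  then have bij: "bij r" using inj by (simp add: bij_def)
  have "decseq (g \<circ> inv r)"
    unfolding decseq_def
  proof (intro allI impI)
    fix i j :: nat assume "i \<le> j"
    have "inv r j \<notin> B (inv r i)"
      using mono[of "inv r j" "inv r i"] \<open>i \<le> j\<close> bij by (auto simp: bij_is_surj surj_f_inv_f)
    then show "(g \<circ> inv r) j \<le> (g \<circ> inv r) i" by (auto simp: B_def)
  qed
  with bij show ?thesis by (intro that[of "inv r"]) (auto intro: bij_imp_bij_inv)
qed

text \<open>Measurability of \<open>desc_sort\<close> requires knowing exactly when a rearrangement
  exists, since elsewhere the definite description has a default value. In the forward direction,
  all entries larger than g n must occupy places before that of n.\<close>

lemma descending_rearrangement_exists_iff: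
  fixes g :: "nat \<Rightarrow> real"
  shows
  "(\<exists>y. decseq y \<and> (\<exists>\<sigma>. bij \<sigma> \<and> y = g \<circ> \<sigma>)) \<longleftrightarrow> (\<forall>n. finite {m. g n < g m})"
proof
  assume "\<exists>y. decseq y \<and> (\<exists>\<sigma>. bij \<sigma> \<and> y = g \<circ> \<sigma>)"
  then obtain \<sigma> where s: "decseq (g \<circ> \<sigma>)" "bij \<sigma>" by auto
  show "\<forall>n. finite {m. g n < g m}"
  proof
    fix n
    have "{m. g n < g m} \<subseteq> \<sigma> ` {..<inv \<sigma> n}"
    proof
      fix m assume "m \<in> {m. g n < g m}"
      moreover have "g m = (g \<circ> \<sigma>) (inv \<sigma> m)" "g n = (g \<circ> \<sigma>) (inv \<sigma> n)"
        using s(2) by (auto simp: bij_is_surj surj_f_inv_f)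
      ultimately have "(g \<circ> \<sigma>) (inv \<sigma> n) < (g \<circ> \<sigma>) (inv \<sigma> m)" by simp
      then have "inv \<sigma> m < inv \<sigma> n" using decseqD[OF s(1), of "inv \<sigma> n" "inv \<sigma> m"] by (meson not_le)
      moreover have "m = \<sigma> (inv \<sigma> m)" using s(2) by (auto simp: bij_is_surj surj_f_inv_f)
      ultimately show "m \<in> \<sigma> ` {..<inv \<sigma> n}" by auto
    qed
    then show "finite {m. g n < g m}" by (rule finite_subset) auto
  qed
next
  assume "\<forall>n. finite {m. g n < g m}"
  then show "\<exists>y. decseq y \<and> (\<exists>\<sigma>. bij \<sigma> \<and> y = g \<circ> \<sigma>)"
    using descending_rearrangement_exists[of g] by metis
qed

lemma measurable_desc_sort[measurable]:
  "desc_sort \<in> borel_seq \<rightarrow>\<^sub>M borel_seq"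
proof (rule measurable_PiM_single')
  fix n :: nat
  define E where "E = {g :: nat \<Rightarrow> real. \<forall>n. finite {m. g n < g m}}"
  \<comment> \<open>When no rearrangement exists, the predicate under the definite description is
    constantly false, so \<open>desc_sort g\<close> is this one sequence whatever g is.\<close>
  define d :: "nat \<Rightarrow> real" where "d = (THE y. False)"
  have E: "desc_sort g = d" if "g \<notin> E" for g
  proof -
    have "(\<lambda>y. decseq y \<and> (\<exists>\<sigma>. bij \<sigma> \<and> y = g \<circ> \<sigma>)) = (\<lambda>_. False)"
      using that descending_rearrangement_exists_iff[of g] unfolding E_def by blast
    then show ?thesis unfolding desc_sort_def d_def by metis
  qed
  have E': "c < desc_sort g n \<longleftrightarrow> many_above g c n" if gE: "g \<in> E" for g c n
  proof -
    obtain \<sigma> where s: "bij \<sigma>" "decseq (g \<circ> \<sigma>)"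
    proof (rule descending_rearrangement_exists[of g])
      show "finite {m. g n < g m}" for n using gE by (simp add: E_def)
    qed
    show ?thesis
      unfolding desc_sort_eqI[OF s(2,1) refl] decseq_gt_iff_many_above[OF s(2)] many_above_bij[OF s(1)] ..
  qed
  \<comment> \<open>Finiteness of an index set is stated as boundedness, which uses only countable
    quantifiers.\<close>
  let ?E = "\<lambda>g. \<forall>n. \<exists>N::nat. \<forall>m. g n < (g m::real) \<longrightarrow> m \<le> N"
  have "Measurable.pred borel_seq ?E"
    by measurable
  also have "?E = (\<lambda>g. g \<in> E)"
    by (auto simp: E_def fun_eq_iff finite_nat_set_iff_bounded_le)
  finally have [measurable]: "Measurable.pred borel_seq (\<lambda>g. g \<in> E)" .
  have [measurable]: "Measurable.pred borel_seq (\<lambda>g. many_above g c n)" for c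
  proof -
    let ?F = "{A :: nat set. finite A \<and> card A = Suc n}"
    have "countable ?F" by (rule countable_subset[OF _ countable_Collect_finite]) auto
    have P: "{g \<in> space borel_seq. \<forall>m\<in>A. c < g m} \<in> sets borel_seq"
      if "A \<in> ?F" for A
      using that by (intro sets.sets_Collect_finite_All) auto
    have "(\<Union>A\<in>?F. {g \<in> space borel_seq. \<forall>m\<in>A. c < g m}) \<in> sets borel_seq"
      by (rule sets.countable_UN''[OF \<open>countable ?F\<close>]) (rule P)
    also have "(\<Union>A\<in>?F. {g \<in> space borel_seq. \<forall>m\<in>A. c < g m}) =
        {g \<in> space borel_seq. many_above g c n}"
      by (auto simp: many_above_def)
    finally show ?thesis by (simp add: pred_def)
  qed
  show "(\<lambda>g. desc_sort g n) \<in> borel_measurable borel_seq"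
  proof (rule borel_measurableI_greater)
    fix c
    have "Measurable.pred borel_seq (\<lambda>g. (g \<in> E \<and> many_above g c n) \<or> (g \<notin> E \<and> c < d n))" by measurable
    also have "(\<lambda>g. (g \<in> E \<and> many_above g c n) \<or> (g \<notin> E \<and> c < d n)) = (\<lambda>g. c < desc_sort g n)"
    proof
      fix g show "((g \<in> E \<and> many_above g c n) \<or> (g \<notin> E \<and> c < d n)) = (c < desc_sort g n)"
        using E[of g] E'[of g c] by (cases "g \<in> E") auto
    qed
    finally show "{g \<in> space borel_seq. c < desc_sort g n} \<in> sets borel_seq"
      by (simp add: pred_def)
  qed
qed (auto simp: space_PiM)

text \<open>The multiplicity of u is the number of n with X n = u, so two counting integrals are
  exchanged. The finiteness condition comes from \<open>card\<close>, which is 0 on infinite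
  sets.\<close>

lemma nn_integral_multisubset_of_seq:
  "(\<integral>\<^sup>+u. of_nat (multisubset_of_seq X u) * g u \<partial>count_space S) =
     (\<Sum>n. (if X n \<in> S \<inter> {0<..1} \<and> finite {m. X m = X n} then 1 else 0) * g (X n))" (is "?L = _")
proof -
  let ?c = "\<lambda>u. (if u \<in> S \<inter> {0<..1} \<and> finite {m. X m = u} then 1 else 0) * g u"
  have card: "of_nat (multisubset_of_seq X u) * g u * indicator S u = (\<integral>\<^sup>+n. indicator {X n} u * ?c u \<partial>count_space UNIV)" for u
  proof -
    have "(\<integral>\<^sup>+n. indicator {X n} u * ?c u \<partial>count_space UNIV) = (\<integral>\<^sup>+n. indicator {m. X m = u} n \<partial>count_space UNIV) * ?c u"
      by (subst nn_integral_multc[symmetric]) (auto intro!: nn_integral_cong split: split_indicator)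
    also have "(\<integral>\<^sup>+n. indicator {m. X m = u} n \<partial>count_space UNIV) = emeasure (count_space UNIV) {m. X m = u}"
      by simp
    finally show ?thesis by (auto simp: multisubset_of_seq_def split: split_indicator)
  qed
  have "?L =
    (\<integral>\<^sup>+u. \<integral>\<^sup>+n. indicator {X n} u * ?c u \<partial>count_space UNIV \<partial>count_space UNIV)"
    by (subst nn_integral_count_space_indicator) (simp_all only: NO_MATCH_def card)
  also have "\<dots> = (\<integral>\<^sup>+z. (\<lambda>(u, n). indicator {X n} u * ?c u) z \<partial>count_space UNIV)"
    using nn_integral_fst_count_space[of "\<lambda>(u, n). indicator {X n} u * ?c u"] by simp
  also have "\<dots> = (\<integral>\<^sup>+n. \<integral>\<^sup>+u. indicator {X n} u * ?c u \<partial>count_space UNIV \<partial>count_space UNIV)"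
    using nn_integral_snd_count_space[of "\<lambda>(u, n). indicator {X n} u * ?c u"] by simp
  also have "\<dots> = (\<integral>\<^sup>+n. ?c (X n) \<partial>count_space UNIV)"
  proof (intro nn_integral_cong)
    fix n
    have "(\<integral>\<^sup>+u. indicator {X n} u * ?c u \<partial>count_space UNIV) = (\<integral>\<^sup>+u. ?c (X n) * indicator {X n} u \<partial>count_space UNIV)"
      by (intro nn_integral_cong) (auto split: split_indicator)
    then show "(\<integral>\<^sup>+u. indicator {X n} u * ?c u \<partial>count_space UNIV) = ?c (X n)"
      by (simp add: nn_integral_cmult_indicator del: mult_eq_0_iff)
  qed
  finally show ?thesis by (simp add: nn_integral_count_space_nat)
qed

lemma measurable_nn_integral_multisubset_of_seq:
  assumes [measurable]: "g \<in> borel_measurable borel" "S \<in> sets borel"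
  shows "(\<lambda>X. \<integral>\<^sup>+u. of_nat (multisubset_of_seq X u) * g u \<partial>count_space S) \<in> borel_measurable borel_seq"
proof -
  have [measurable]: "Measurable.pred borel_seq (\<lambda>X. finite {m. X m = (X n :: real)})" for n :: nat
  proof -
    let ?F = "\<lambda>X. \<exists>N::nat. \<forall>m. X m < X n \<or> X n < (X m::real) \<or> m \<le> N"
    have "Measurable.pred borel_seq ?F" by measurable
    also have "?F = (\<lambda>X. finite {m. X m = X n})"
      by (intro ext) (simp add: finite_nat_set_iff_bounded_le, metis less_irrefl linorder_neqE)
    finally show ?thesis .
  qed
  show ?thesis unfolding nn_integral_multisubset_of_seq by measurable
qed

lemma suminf_ennreal_bij:
  fixes f :: "nat \<Rightarrow> ennreal"
  assumes "bij \<sigma>" shows "(\<Sum>n. f (\<sigma> n)) = (\<Sum>n. f n)"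
  using nn_integral_bij_count_space[OF assms, of f] by (simp add: nn_integral_count_space_nat)

text \<open>The sticks tend to 0 because their sum converges, so only finitely many exceed a
  positive level. Hence the descending rearrangement exists, no value is taken infinitely often, and
  permuting a nonnegative series does not change its sum. With g = 1 this gives the count, with g
  the identity the total.\<close>

lemma multisubset_of_desc_sort_stick:
  assumes \<theta>: "0 < \<theta>" and u: "\<And>n. 0 < u n \<and> u n < 1"
  shows "(\<integral>\<^sup>+x. of_nat (multisubset_of_seq (desc_sort (stick_breaking \<theta> u)) x) * g x \<partial>count_space S) =
     (\<Sum>n. indicator S (stick_breaking \<theta> u n) * g (stick_breaking \<theta> u n))"
proof -
  let ?G = "stick_breaking \<theta> u"
  note b = stick_breaking_bounds[of \<theta> u, OF \<theta> u]
  have "summable ?G"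
  proof (rule bounded_imp_summable[of _ 1])
    show "sum ?G {..n} \<le> 1" for n using b(3)[of "Suc n"] by (simp only: lessThan_Suc_atMost)
  qed (use b in \<open>auto intro: less_imp_le\<close>)
  then have lim: "?G \<longlonglongrightarrow> 0" by (rule summable_LIMSEQ_zero)
  have fin: "finite {m. c \<le> ?G m}" if c: "0 < c" for c
  proof -
    obtain N where N: "\<forall>m\<ge>N. ?G m < c"
      using order_tendstoD(2)[OF lim c] unfolding eventually_sequentially by blast
    have "{m. c \<le> ?G m} \<subseteq> {..<N}"
    proof
      fix m assume "m \<in> {m. c \<le> ?G m}"
      then show "m \<in> {..<N}" using N[rule_format, of m] by (cases "N \<le> m") auto
    qed
    then show ?thesis by (rule finite_subset) simp
  qed
  obtain \<sigma> where s: "bij \<sigma>" "decseq (?G \<circ> \<sigma>)"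
  proof (rule descending_rearrangement_exists[of ?G])
    show "finite {m. ?G n < ?G m}" for n
      by (rule finite_subset[OF _ fin[OF b(1)[of n]]]) auto
  qed
  have fin': "finite {m. (?G \<circ> \<sigma>) m = (?G \<circ> \<sigma>) n}" for n
  proof -
    have "finite (\<sigma> -` {m. ?G (\<sigma> n) \<le> ?G m})"
      by (rule finite_vimageI[OF fin[OF b(1)] bij_is_inj[OF s(1)]])
    then show ?thesis by (rule finite_subset[rotated]) (simp add: subset_eq)
  qed
  have mem: "(?G \<circ> \<sigma>) n \<in> {0<..1}" for n using b(1,2)[of "\<sigma> n"] by (simp add: less_imp_le)
  have "(\<integral>\<^sup>+x. of_nat (multisubset_of_seq (desc_sort ?G) x) * g x \<partial>count_space S) =
     (\<Sum>n. indicator S (?G (\<sigma> n)) * g (?G (\<sigma> n)))"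
    unfolding desc_sort_eqI[OF s(2,1) refl] nn_integral_multisubset_of_seq
    using fin' mem by (simp add: indicator_def of_bool_def cong: if_cong)
  also have "\<dots> = (\<Sum>n. indicator S (?G n) * g (?G n))"
    using suminf_ennreal_bij[OF s(1), of "\<lambda>n. indicator S (?G n) * g (?G n)"] .
  finally show ?thesis .
qed

section \<open>The Poisson-Dirichlet law satisfies both conditions\<close>

lemma measurable_desc_sort_stick_breaking[measurable]:
  "(\<lambda>u. desc_sort (stick_breaking \<theta> u)) \<in> unif_seq \<rightarrow>\<^sub>M borel_seq"
proof -
  have "(\<lambda>u. stick_breaking \<theta> u) \<in> borel_seq \<rightarrow>\<^sub>M borel_seq"
    by (rule measurable_PiM_single') (simp_all add: space_PiM)
  then show ?thesis
    unfolding measurable_cong_sets[OF sets_unif_seq refl] by (rule measurable_compose[OF _ measurable_desc_sort])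
qed

lemma sets_Poisson_Dirichlet[measurable_cong]: "sets (Poisson_Dirichlet \<theta>) = sets borel_seq"
  by (simp add: Poisson_Dirichlet_def)

lemma space_Poisson_Dirichlet[simp]: "space (Poisson_Dirichlet \<theta>) = UNIV"
  by (simp add: Poisson_Dirichlet_def space_PiM)

lemma prob_space_Poisson_Dirichlet: "prob_space (Poisson_Dirichlet \<theta>)"
  unfolding Poisson_Dirichlet_def by (rule unif_seq.prob_space_distr[OF measurable_desc_sort_stick_breaking])

lemma multisubset_multisubset_of_seq: "multisubset (multisubset_of_seq X)"
proof -
  have "{u. multisubset_of_seq X u \<noteq> 0} \<subseteq> range X"
  proof
    fix u assume "u \<in> {u. multisubset_of_seq X u \<noteq> 0}"
    then have "card {n. X n = u} \<noteq> 0" by (simp add: multisubset_of_seq_def split: if_splits)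
    then have "{n. X n = u} \<noteq> {}" by (rule contrapos_nn) (simp only: card.empty)
    then show "u \<in> range X" by blast
  qed
  then have "countable {u. multisubset_of_seq X u \<noteq> 0}"
    by (rule countable_subset) simp
  moreover have "u \<in> {0<..1}" if "multisubset_of_seq X u \<noteq> 0" for u
    using that unfolding multisubset_of_seq_def by presburger
  ultimately show ?thesis unfolding multisubset_def by blast
qed

lemma random_multisubset_Poisson_Dirichlet:
  "random_multisubset (Poisson_Dirichlet \<theta>) multisubset_of_seq"
  unfolding random_multisubset_def
proof (intro conjI ballI allI impI)
  show "prob_space (Poisson_Dirichlet \<theta>)" by (rule prob_space_Poisson_Dirichlet)
  show "multisubset (multisubset_of_seq X)" for X by (rule multisubset_multisubset_of_seq)
  fix S :: "real set" assume "S \<in> sets borel"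
  then have "(\<lambda>X. \<integral>\<^sup>+u. of_nat (multisubset_of_seq X u) * 1 \<partial>count_space S) \<in> borel_measurable borel_seq"
    by (intro measurable_nn_integral_multisubset_of_seq[of "\<lambda>_. 1" S]) simp_all
  then show "(\<lambda>X. mcount (multisubset_of_seq X) S) \<in> borel_measurable (Poisson_Dirichlet \<theta>)"
    unfolding mcount_def mult_1_right measurable_cong_sets[OF sets_Poisson_Dirichlet refl] .
qed

lemma PD_density_eq: "PD_density \<theta> k = pd_dens \<theta> {..<k}"
  by (rule ext) (simp only: PD_density_def pd_dens_def Let_def card_lessThan)

lemma PD_conditions_Poisson_Dirichlet:
  assumes \<theta>: "0 < \<theta>"
  shows "PD_conditions \<theta> (Poisson_Dirichlet \<theta>) multisubset_of_seq"
  unfolding PD_conditions_def has_multi_intensity_density_def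
proof (intro conjI allI impI)
  let ?X = "\<lambda>u. multisubset_of_seq (desc_sort (stick_breaking \<theta> u))"
  interpret prob_space "Poisson_Dirichlet \<theta>" by (rule prob_space_Poisson_Dirichlet)
  have [measurable]: "(\<lambda>X. msum (multisubset_of_seq X)) \<in> borel_measurable borel_seq"
    unfolding msum_def by (rule measurable_nn_integral_multisubset_of_seq) auto
  have "AE u in unif_seq. msum (?X u) \<le> 1"
    using AE_unif_seq
  proof eventually_elim
    case (elim u)
    then have u: "\<And>n. 0 < u n \<and> u n < 1" by auto
    note b = stick_breaking_bounds[of \<theta> u, OF \<theta> u]
    have "msum (?X u) = (\<Sum>n. indicator {0<..1} (stick_breaking \<theta> u n) * ennreal (stick_breaking \<theta> u n))"
      unfolding msum_def by (rule multisubset_of_desc_sort_stick[OF \<theta> u])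
    also have "\<dots> \<le> (\<Sum>n. ennreal (stick_breaking \<theta> u n))"
      by (intro suminf_le) (auto split: split_indicator)
    also have "\<dots> \<le> 1"
      using b by (intro suminf_le_const) (auto simp: less_imp_le ennreal_le_1 intro: sum_nonneg)
    finally show ?case .
  qed
  then have "AE X in Poisson_Dirichlet \<theta>. msum (multisubset_of_seq X) \<le> 1"
    unfolding Poisson_Dirichlet_def by (subst AE_distr_iff) auto
  then show "measure (Poisson_Dirichlet \<theta>) {X \<in> space (Poisson_Dirichlet \<theta>). msum (multisubset_of_seq X) \<le> 1} = 1"
    using measurable_sets[of "\<lambda>X. msum (multisubset_of_seq X)" borel_seq borel "{..1}"]
    by (subst prob_eq_1) (simp_all add: sets_Poisson_Dirichlet space_PiM vimage_def)
next
  fix k :: nat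
  show "PD_density \<theta> k \<in> borel_measurable (restrict_space (lborel_PiM {..<k}) (off_diagonal k))"
    unfolding PD_density_eq by (rule measurable_restrict_space1) measurable
next
  let ?X = "\<lambda>u. multisubset_of_seq (desc_sort (stick_breaking \<theta> u))"
  fix k :: nat and a b :: "nat \<Rightarrow> real"
  assume k: "1 \<le> k" and ab: "\<forall>i<k. 0 < a i \<and> a i \<le> b i \<and> b i \<le> 1"
    and disj: "disjoint_family_on (\<lambda>i. {a i..b i}) {..<k}"
  \<comment> \<open>The least left end keeps all intervals away from 0, as the comparison of moments
    with intensities requires.\<close>
  define \<epsilon> where "\<epsilon> = Min (a ` {..<k})"
  have ne: "a ` {..<k} \<noteq> {}" using k by (auto simp: lessThan_empty_iff)
  have \<epsilon>: "0 < \<epsilon>" "\<And>i. i < k \<Longrightarrow> \<epsilon> \<le> a i"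
    using ab ne by (auto simp: \<epsilon>_def)
  have [measurable]: "(\<lambda>X. mcount (multisubset_of_seq X) {c..d}) \<in> borel_measurable borel_seq" for c d
    using measurable_nn_integral_multisubset_of_seq[of "\<lambda>_. 1" "{c..d}"] by (simp add: mcount_def)
  have "(\<integral>\<^sup>+X. (\<Prod>i<k. mcount (multisubset_of_seq X) {a i..b i}) \<partial>Poisson_Dirichlet \<theta>) =
      (\<integral>\<^sup>+u. (\<Prod>i<k. mcount (?X u) {a i..b i}) \<partial>unif_seq)"
    unfolding Poisson_Dirichlet_def by (subst nn_integral_distr) auto
  also have "\<dots> = stick_moment \<theta> {..<k} (\<lambda>i. {a i..b i})"
    unfolding stick_moment_def
  proof (intro nn_integral_cong_AE, use AE_unif_seq in eventually_elim)
    case (elim u)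
    have "mcount (?X u) S = stick_count \<theta> u S" for S
      using multisubset_of_desc_sort_stick[OF \<theta>, of u _ "\<lambda>_. 1"] elim by (simp add: mcount_def stick_count_def)
    then show ?case by simp
  qed
  also have "\<dots> = box_intensity \<theta> {..<k} (\<lambda>i. {a i..b i})"
    using \<epsilon> by (intro stick_moment_eq_box_intensity[OF \<theta> \<epsilon>(1)]) (auto intro: disj order_trans)
  also have "\<dots> = (\<integral>\<^sup>+x\<in>(\<Pi>\<^sub>E i\<in>{..<k}. {a i..b i}). PD_density \<theta> k x \<partial>lborel_PiM {..<k})"
    unfolding box_intensity_def PD_density_eq
    by (intro nn_integral_cong) (auto simp: prod_indicator_eq space_PiM PiE_iff split: split_indicator)
  finally show "(\<integral>\<^sup>+X. (\<Prod>i<k. mcount (multisubset_of_seq X) {a i..b i}) \<partial>Poisson_Dirichlet \<theta>) =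
    (\<integral>\<^sup>+x\<in>(\<Pi>\<^sub>E i\<in>{..<k}. {a i..b i}). PD_density \<theta> k x \<partial>lborel_PiM {..<k})" .
qed

subsection \<open>Counts on dyadic cells\<close>

text \<open>A multisubset as an atomic measure on all sets of reals, so that additivity and
  continuity of counts are those of \<open>emeasure\<close>.\<close>

definition count_measure :: "(real \<Rightarrow> nat) \<Rightarrow> real measure" where
  "count_measure m = density (count_space UNIV) (\<lambda>u. of_nat (m u))"

lemma sets_count_measure[simp]: "sets (count_measure m) = UNIV"
  by (simp add: count_measure_def)

lemma nn_integral_count_space_set:
  "(\<integral>\<^sup>+u. f u \<partial>count_space S) = (\<integral>\<^sup>+u. f u * indicator S u \<partial>count_space UNIV)"
  by (rule nn_integral_count_space_indicator) (simp only: NO_MATCH_def)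

lemma mcount_eq_emeasure: "mcount m S = emeasure (count_measure m) S"
  unfolding count_measure_def mcount_def nn_integral_count_space_set[of S]
  by (subst emeasure_density) simp_all

lemma nn_integral_count_measure: "(\<integral>\<^sup>+u. f u \<partial>count_measure m) = (\<integral>\<^sup>+u. of_nat (m u) * f u \<partial>count_space UNIV)"
  unfolding count_measure_def by (subst nn_integral_density) auto

lemma mcount_mono: "S \<subseteq> T \<Longrightarrow> mcount m S \<le> mcount m T"
  by (simp add: mcount_eq_emeasure emeasure_mono)

lemma mcount_UN_finite:
  "finite J \<Longrightarrow> disjoint_family_on S J \<Longrightarrow> mcount m (\<Union>j\<in>J. S j) = (\<Sum>j\<in>J. mcount m (S j))"
  unfolding mcount_eq_emeasure by (rule sum_emeasure[symmetric]) auto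

text \<open>Infinitely many points in S each contribute at least 1. Counts are thus integers or
  infinite, which yields the gaps between 0 and 1 and between 1 and 2 used below.\<close>

lemma mcount_cases:
  obtains "mcount m S = top" | k :: nat where "mcount m S = of_nat k"
proof (cases "finite {u \<in> S. m u \<noteq> 0}")
  case True
  then have f: "finite {u \<in> S. 0 < (of_nat (m u) :: ennreal)}" by simp
  have "mcount m S = of_nat (\<Sum>u | u \<in> S \<and> 0 < (of_nat (m u) :: ennreal). m u)"
    unfolding mcount_def nn_integral_count_space[OF f] by simp
  then show ?thesis by (rule that(2))
next
  case False
  have "top = emeasure (count_space UNIV) {u \<in> S. m u \<noteq> 0}" using False by simp
  also have "\<dots> = (\<integral>\<^sup>+u. indicator {u \<in> S. m u \<noteq> 0} u \<partial>count_space UNIV)" by simp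
  also have "\<dots> \<le> (\<integral>\<^sup>+u. of_nat (m u) * indicator S u \<partial>count_space UNIV)"
  proof (intro nn_integral_mono)
    fix u show "indicator {u \<in> S. m u \<noteq> 0} u \<le> (of_nat (m u) * indicator S u :: ennreal)"
      by (cases "m u") (auto split: split_indicator)
  qed
  also have "\<dots> = mcount m S"
    unfolding mcount_def nn_integral_count_space_set[of S] ..
  finally have "mcount m S = top" by (simp only: top_unique)
  then show ?thesis by (rule that(1))
qed

lemma mcount_zero_or_ge_one: "mcount m S = 0 \<or> 1 \<le> mcount m S"
proof (rule mcount_cases[of m S])
  fix k :: nat assume "mcount m S = of_nat k"
  then show ?thesis by (cases k) auto
qed simp

lemma mcount_le_one_or_ge_two: "mcount m S \<le> 1 \<or> 2 \<le> mcount m S"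
proof (rule mcount_cases[of m S])
  fix k :: nat assume k: "mcount m S = of_nat k"
  show ?thesis
  proof (cases "k \<le> 1")
    case True
    then have "(of_nat k :: ennreal) \<le> of_nat 1" by (subst of_nat_le_iff)
    then show ?thesis by (simp add: k)
  next
    case False
    then have "(of_nat 2 :: ennreal) \<le> of_nat k" by (subst of_nat_le_iff) simp
    then show ?thesis by (simp add: k)
  qed
qed simp

lemma msum_eq: "msum m = (\<integral>\<^sup>+u. ennreal u * indicator {0<..1} u \<partial>count_measure m)"
  unfolding msum_def nn_integral_count_measure nn_integral_count_space_set[of "{0<..1}"]
  by (simp only: mult.assoc)

text \<open>Cells are open on the left and closed on the right so that the 2^n cells of level n tile
  (0,1]; hence the ceiling minus 1. For x \<le> 0 the index is 0 by truncation, which is why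
  membership in a cell is characterised only for 0 < x.\<close>

definition cell_index :: "nat \<Rightarrow> real \<Rightarrow> nat" where
  "cell_index n x = nat (\<lceil>2 ^ n * x\<rceil> - 1)"

definition cell :: "nat \<Rightarrow> nat \<Rightarrow> real set" where
  "cell n j = {real j / 2 ^ n <.. (real j + 1) / 2 ^ n}"

lemma cell_borel[measurable]: "cell n j \<in> sets borel" by (simp add: cell_def)

lemma cell_pos: "x \<in> cell n j \<Longrightarrow> 0 < x"
proof -
  assume "x \<in> cell n j"
  then have "real j / 2 ^ n < x" by (simp add: cell_def)
  moreover have "0 \<le> real j / 2 ^ n" by simp
  ultimately show "0 < x" by linarith
qed

lemma mem_cell_iff:
  assumes "0 < x" shows "x \<in> cell n j \<longleftrightarrow> cell_index n x = j"
proof -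
  have "0 < \<lceil>2 ^ n * x\<rceil>" using assms by simp
  then have "cell_index n x = j \<longleftrightarrow> \<lceil>2 ^ n * x\<rceil> = int j + 1"
    unfolding cell_index_def by linarith
  also have "\<dots> \<longleftrightarrow> real j < 2 ^ n * x \<and> 2 ^ n * x \<le> real j + 1" by (simp add: ceiling_eq_iff)
  also have "\<dots> \<longleftrightarrow> x \<in> cell n j" by (simp add: cell_def field_simps)
  finally show ?thesis by (rule sym)
qed

lemma cell_index_bounds:
  assumes "0 < x" shows "real (cell_index n x) < 2 ^ n * x" "2 ^ n * x \<le> real (cell_index n x) + 1"
  using mem_cell_iff[OF assms, of n "cell_index n x"] by (simp_all add: cell_def field_simps)

lemma disjoint_cells: "disjoint_family_on (cell n) J"
  unfolding disjoint_family_on_def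
proof (intro ballI impI equals0I)
  fix i j x assume "i \<noteq> j" "x \<in> cell n i \<inter> cell n j"
  then show False using mem_cell_iff[OF cell_pos, of x n i n i] mem_cell_iff[OF cell_pos, of x n i n j] by simp
qed

lemma cell_index_eqI:
  assumes "0 < x" "real j < 2 ^ n * x" "2 ^ n * x \<le> real j + 1"
  shows "cell_index n x = j"
proof -
  have "x \<in> cell n j" using assms by (simp add: cell_def field_simps)
  then show ?thesis using mem_cell_iff[OF assms(1)] by simp
qed

lemma cell_index_Suc:
  assumes "0 < x" shows "cell_index n x = cell_index (Suc n) x div 2"
proof (rule cell_index_eqI[OF assms])
  define i where "i = cell_index (Suc n) x"
  define j where "j = i div 2"
  define y where "y = 2 ^ n * x"
  have y: "real i < 2 * y" "2 * y \<le> real i + 1"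
    using cell_index_bounds[OF assms, of "Suc n"] unfolding i_def y_def by (simp_all only: power_Suc mult.assoc)
  have "2 * j \<le> i" "i \<le> 2 * j + 1" unfolding j_def by presburger+
  then have "2 * real j \<le> real i" "real i \<le> 2 * real j + 1" by linarith+
  with y have "real j < y" "y \<le> real j + 1" by linarith+
  then show "real (cell_index (Suc n) x div 2) < 2 ^ n * x" "2 ^ n * x \<le> real (cell_index (Suc n) x div 2) + 1"
    unfolding i_def j_def y_def .
qed

lemma cell_index_add:
  assumes "0 < x" shows "cell_index n x = cell_index (n + k) x div 2 ^ k"
proof (induction k)
  case (Suc k)
  have "cell_index (n + k) x = cell_index (n + Suc k) x div 2"
    using cell_index_Suc[OF assms, of "n + k"] by simp
  then have "cell_index n x = cell_index (n + Suc k) x div 2 div 2 ^ k" using Suc by simp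
  then show ?case by (simp only: div_mult2_eq power_Suc)
qed simp

lemma cell_index_less:
  assumes x: "0 < x" "x \<le> 1" shows "cell_index n x < 2 ^ n"
proof -
  have "2 ^ n * x \<le> 2 ^ n * 1" using x by (intro mult_left_mono) auto
  then have "real (cell_index n x) < 2 ^ n"
    using cell_index_bounds(1)[OF x(1), of n] by linarith
  then have "real (cell_index n x) < real (2 ^ n)" by simp
  then show ?thesis by (simp only: of_nat_less_iff)
qed

text \<open>Unions are later taken over J \<subseteq> {1..<2 ^ n}: leaving out cell 0 keeps them
  away from 0, where points may accumulate.\<close>

definition cell_union :: "nat \<Rightarrow> nat set \<Rightarrow> real set" where
  "cell_union n J = (\<Union>j\<in>J. cell n j)"

lemma cell_union_borel[measurable]: "cell_union n J \<in> sets borel"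
  unfolding cell_union_def by (intro sets.countable_UN'') auto

lemma mem_cell_union_iff: "x \<in> cell_union n J \<longleftrightarrow> 0 < x \<and> cell_index n x \<in> J"
proof
  assume "x \<in> cell_union n J"
  then obtain j where "j \<in> J" "x \<in> cell n j" by (auto simp: cell_union_def)
  then show "0 < x \<and> cell_index n x \<in> J" using cell_pos[of x n j] mem_cell_iff[of x n j] by simp
next
  assume "0 < x \<and> cell_index n x \<in> J"
  then show "x \<in> cell_union n J" using mem_cell_iff[of x n "cell_index n x"] by (auto simp: cell_union_def)
qed

lemma cell_subset_unit: "j < 2 ^ n \<Longrightarrow> cell n j \<subseteq> {0<..1}"
proof
  fix x assume j: "j < 2 ^ n" and x: "x \<in> cell n j"
  have "real (j + 1) \<le> real (2 ^ n)" using j by (subst of_nat_le_iff) simp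
  then have "(real j + 1) / 2 ^ n \<le> 1" by simp
  with x cell_pos[OF x] show "x \<in> {0<..1}" unfolding cell_def by (auto intro: order_trans)
qed

lemma cell_union_subset_unit: "J \<subseteq> {1..<2 ^ n} \<Longrightarrow> cell_union n J \<subseteq> {0<..1}"
  unfolding cell_union_def using cell_subset_unit by fastforce

lemma cell_union_subset_tail: "J \<subseteq> {1..<2 ^ n} \<Longrightarrow> cell_union n J \<subseteq> {1 / 2 ^ n<..1}"
proof
  fix x assume J: "J \<subseteq> {1..<2 ^ n}" and x: "x \<in> cell_union n J"
  then obtain j where "x \<in> cell n j" "1 \<le> j" by (auto simp: cell_union_def)
  then have "real j / 2 ^ n < x" "1 \<le> real j" by (simp_all add: cell_def)
  moreover have "1 / 2 ^ n \<le> real j / 2 ^ n" using \<open>1 \<le> real j\<close> by (rule divide_right_mono) simp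
  ultimately have "1 / 2 ^ n < x" by linarith
  with cell_union_subset_unit[OF J] x show "x \<in> {1 / 2 ^ n<..1}" by auto
qed

text \<open>Cell i of level n + k lies in the cell of level n with index i div 2^k, so these are the
  indices of the subcells of the cells in J.\<close>

definition refine :: "nat \<Rightarrow> nat \<Rightarrow> nat set \<Rightarrow> nat set" where
  "refine n k J = {i. i div 2 ^ k \<in> J}"

lemma cell_union_refine: "cell_union (n + k) (refine n k J) = cell_union n J"
  using cell_index_add by (auto simp: mem_cell_union_iff refine_def)

lemma refine_subset:
  assumes "J \<subseteq> {1..<2 ^ n}" shows "refine n k J \<subseteq> {2 ^ k..<2 ^ (n + k)}"
proof
  fix i assume "i \<in> refine n k J"
  then have "1 \<le> i div 2 ^ k" "i div 2 ^ k < 2 ^ n" using assms by (auto simp: refine_def)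
  then show "i \<in> {2 ^ k..<2 ^ (n + k)}"
    by (auto simp: div_greater_zero_iff Suc_le_eq power_add div_less_iff_less_mult[of "2 ^ k" i "2 ^ n"])
qed

lemma refine_subset': "J \<subseteq> {1..<2 ^ n} \<Longrightarrow> refine n k J \<subseteq> {1..<2 ^ (n + k)}"
  using refine_subset[of J n k] by (auto simp: subset_eq intro: order_trans[rotated])

lemma finite_refine: "J \<subseteq> {1..<2 ^ n} \<Longrightarrow> finite (refine n k J)"
  using finite_subset[OF refine_subset] by blast

subsection \<open>Void events\<close>

text \<open>At level r + k, the indices from 2^k up to 2^(r+k) are the cells inside (2^-r, 1].
  Demanding at most one point in each, for all large k, expresses the absence of multiple points
  through countably many counts.\<close>

definition simple_locally_finite :: "(real \<Rightarrow> nat) \<Rightarrow> bool" where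
  "simple_locally_finite m \<longleftrightarrow>
     (\<forall>r. mcount m {1 / 2 ^ r<..1} < top) \<and>
     (\<forall>r. \<exists>k0. \<forall>k\<ge>k0. \<forall>j\<in>{2 ^ k..<2 ^ (r + k)}. mcount m (cell (r + k) j) \<le> 1)"

definition void_set :: "nat \<times> nat set \<Rightarrow> (real \<Rightarrow> nat) set" where
  "void_set = (\<lambda>(n, J). {m. simple_locally_finite m \<and> mcount m (cell_union n J) = 0})"

definition void_sets :: "(real \<Rightarrow> nat) set set" where
  "void_sets = void_set ` {(n, J). J \<subseteq> {1..<2 ^ n}}"

definition void_space :: "(real \<Rightarrow> nat) measure" where
  "void_space = sigma {m. simple_locally_finite m} void_sets"

lemma void_sets_Pow: "void_sets \<subseteq> Pow {m. simple_locally_finite m}"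
  by (auto simp: void_sets_def void_set_def)

lemma space_void_space: "space void_space = {m. simple_locally_finite m}"
  using void_sets_Pow by (simp add: void_space_def space_measure_of)

lemma sets_void_space: "sets void_space = sigma_sets {m. simple_locally_finite m} void_sets"
  using void_sets_Pow by (simp add: void_space_def sets_measure_of)

text \<open>Both unions are rewritten at the common level n + n', and two sets are void exactly when
  their union is.\<close>

lemma Int_stable_void_sets: "Int_stable void_sets"
proof (rule Int_stableI)
  fix a b assume "a \<in> void_sets" "b \<in> void_sets"
  then obtain n J n' J' where a: "a = void_set (n, J)" "J \<subseteq> {1..<2 ^ n}" and b: "b = void_set (n', J')" "J' \<subseteq> {1..<2 ^ n'}"
    by (auto simp: void_sets_def)
  let ?K = "refine n n' J" and ?K' = "refine n' n J'"
  have K: "cell_union (n + n') ?K = cell_union n J" by (rule cell_union_refine)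
  have K': "cell_union (n + n') ?K' = cell_union n' J'" using cell_union_refine[of n' n J'] by (simp add: add.commute)
  have "?K \<union> ?K' \<subseteq> {1..<2 ^ (n + n')}"
    using refine_subset'[OF a(2), of n'] refine_subset'[OF b(2), of n] by (simp add: add.commute)
  moreover have "cell_union (n + n') (?K \<union> ?K') = cell_union n J \<union> cell_union n' J'"
    unfolding K[symmetric] K'[symmetric] by (auto simp: cell_union_def)
  moreover have "mcount m (S \<union> T) = 0 \<longleftrightarrow> mcount m S = 0 \<and> mcount m T = 0" for m S T
  proof -
    have "mcount m (S \<union> T) \<le> mcount m S + mcount m T"
      unfolding mcount_eq_emeasure by (rule emeasure_subadditive) auto
    moreover have "mcount m S \<le> mcount m (S \<union> T)" "mcount m T \<le> mcount m (S \<union> T)" by (auto intro: mcount_mono)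
    ultimately show ?thesis by auto
  qed
  ultimately have "a \<inter> b = void_set (n + n', ?K \<union> ?K')"
    by (auto simp: a b void_set_def)
  with \<open>?K \<union> ?K' \<subseteq> _\<close> show "a \<inter> b \<in> void_sets" unfolding void_sets_def by blast
qed

lemma void_events_measurable:
  assumes "J \<subseteq> {1..<2 ^ n}"
  shows "Measurable.pred void_space (\<lambda>m. mcount m (cell_union n J) = 0)"
proof -
  have "{m \<in> space void_space. mcount m (cell_union n J) = 0} = void_set (n, J)"
    by (auto simp: space_void_space void_set_def)
  moreover have "void_set (n, J) \<in> sets void_space"
    using assms unfolding sets_void_space void_sets_def by (intro sigma_sets.Basic) blast
  ultimately show ?thesis by (simp add: pred_def)
qed

lemma eventually_simple_cells:
  assumes "simple_locally_finite m" "J \<subseteq> {1..<2 ^ n}"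
  shows "eventually (\<lambda>k. \<forall>i\<in>refine n k J. mcount m (cell (n + k) i) = 0 \<or> mcount m (cell (n + k) i) = 1) sequentially"
proof -
  obtain k0 where "\<And>k j. k0 \<le> k \<Longrightarrow> j \<in> {2 ^ k..<2 ^ (n + k)} \<Longrightarrow> mcount m (cell (n + k) j) \<le> 1"
    using assms(1) unfolding simple_locally_finite_def by metis
  then have "mcount m (cell (n + k) i) = 0 \<or> mcount m (cell (n + k) i) = 1" if "k0 \<le> k" "i \<in> refine n k J" for k i
    using that refine_subset[OF assms(2), of k] mcount_zero_or_ge_one[of m "cell (n + k) i"] by (meson antisym subsetD)
  then show ?thesis unfolding eventually_sequentially by blast
qed

lemma mcount_cell_union:
  assumes "J \<subseteq> {1..<2 ^ n}"
  shows "mcount m (cell_union n J) = (\<Sum>i\<in>refine n k J. mcount m (cell (n + k) i))"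
  unfolding cell_union_refine[of n k J, symmetric] unfolding cell_union_def
  by (rule mcount_UN_finite[OF finite_refine[OF assms] disjoint_cells])

text \<open>On a simple configuration the count is the number of non-void cells of a fine enough
  subdivision, hence a pointwise limit of sums over void events. This is how the void events come to
  generate all counts.\<close>

lemma measurable_mcount_cell_union:
  assumes J: "J \<subseteq> {1..<2 ^ n}"
  shows "(\<lambda>m. mcount m (cell_union n J)) \<in> borel_measurable void_space"
proof (rule borel_measurable_LIMSEQ_order)
  let ?f = "\<lambda>k m. \<Sum>i\<in>refine n k J. (if mcount m (cell (n + k) i) = 0 then 0 else 1 :: ennreal)"
  fix m assume "m \<in> space void_space"
  then have m: "simple_locally_finite m" by (simp add: space_void_space)
  have "eventually (\<lambda>k. ?f k m = mcount m (cell_union n J)) sequentially"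
    using eventually_simple_cells[OF m J]
  proof eventually_elim
    case (elim k)
    show ?case unfolding mcount_cell_union[OF J, of m k] using elim by (intro sum.cong) auto
  qed
  then show "(\<lambda>k. ?f k m) \<longlonglongrightarrow> mcount m (cell_union n J)" by (rule tendsto_eventually)
next
  fix k
  have [measurable]: "Measurable.pred void_space (\<lambda>m. mcount m (cell (n + k) i) = 0)" if "i \<in> refine n k J" for i
    using void_events_measurable[of "{i}" "n + k"] that refine_subset'[OF J, of k] by (auto simp: cell_union_def)
  show "(\<lambda>m. \<Sum>i\<in>refine n k J. (if mcount m (cell (n + k) i) = 0 then 0 else 1 :: ennreal)) \<in> borel_measurable void_space"
    by (intro borel_measurable_sum measurable_If) auto
qed

lemma open_Int_unit_eq_cells:
  assumes "open T"
  shows "T \<inter> {0<..1} = (\<Union>n. cell_union n {j \<in> {1..<2 ^ n}. cell n j \<subseteq> T})" (is "_ = (\<Union>n. ?C n)")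
    and "incseq (\<lambda>n. cell_union n {j \<in> {1..<2 ^ n}. cell n j \<subseteq> T})"
proof -
  have "x \<in> (\<Union>n. ?C n)" if x: "x \<in> T" "0 < x" "x \<le> 1" for x
  proof -
    obtain e where e: "0 < e" "ball x e \<subseteq> T" using assms x by (auto simp: open_contains_ball)
    \<comment> \<open>A mesh below e keeps the cell of x inside T; a mesh below x keeps its index
      different from 0.\<close>
    define d where "d = min e x"
    obtain n where n: "1 / d < 2 ^ n" using real_arch_pow[of 2 "1 / d"] by auto
    let ?j = "cell_index n x"
    have "0 < d" using e x by (simp add: d_def)
    then have "1 / 2 ^ n < d" using n by (simp add: field_simps)
    then have n': "1 / 2 ^ n < e" "1 / 2 ^ n < x" by (simp_all add: d_def)
    have "x \<in> cell n ?j" using mem_cell_iff[OF x(2)] by simp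
    have "1 < 2 ^ n * x" using n'(2) by (simp add: field_simps)
    then have "?j \<noteq> 0" using cell_index_bounds(2)[OF x(2), of n] by (intro notI) simp
    moreover have "?j < 2 ^ n" using x by (intro cell_index_less)
    moreover have "cell n ?j \<subseteq> T"
    proof
      fix y assume "y \<in> cell n ?j"
      with \<open>x \<in> cell n ?j\<close> have "y - x \<le> (real ?j + 1) / 2 ^ n - real ?j / 2 ^ n" "x - y \<le> (real ?j + 1) / 2 ^ n - real ?j / 2 ^ n"
        by (simp_all add: cell_def)
      moreover have "(real ?j + 1) / 2 ^ n - real ?j / 2 ^ n = 1 / 2 ^ n" by (simp add: diff_divide_distrib[symmetric])
      ultimately have "dist x y < e" using n' by (simp add: dist_real_def abs_if)
      then show "y \<in> T" using e by (auto simp: subset_eq)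
    qed
    ultimately have "x \<in> ?C n" using x by (simp add: mem_cell_union_iff Suc_le_eq)
    then show ?thesis by blast
  qed
  moreover have "?C n \<subseteq> T \<inter> {0<..1}" for n
  proof -
    have "?C n \<subseteq> {0<..1}" by (rule cell_union_subset_unit) auto
    moreover have "?C n \<subseteq> T" by (auto simp: cell_union_def)
    ultimately show ?thesis by blast
  qed
  ultimately show "T \<inter> {0<..1} = (\<Union>n. ?C n)" by auto
  show "incseq ?C"
  proof (rule incseq_SucI, rule subsetI)
    fix n x assume x: "x \<in> ?C n"
    let ?i = "cell_index (Suc n) x"
    have pos: "0 < x" and j: "cell_index n x \<in> {j \<in> {1..<2 ^ n}. cell n j \<subseteq> T}"
      using x by (simp_all add: mem_cell_union_iff)
    have "?C n \<subseteq> {0<..1}" by (rule cell_union_subset_unit) auto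
    then have "x \<le> 1" using x by (meson greaterThanAtMost_iff subsetD)
    have d: "?i div 2 = cell_index n x" using cell_index_Suc[OF pos, of n] by simp
    have "cell (Suc n) ?i \<subseteq> cell n (cell_index n x)"
    proof
      fix y assume y: "y \<in> cell (Suc n) ?i"
      then have "0 < y" by (rule cell_pos)
      then show "y \<in> cell n (cell_index n x)" using y mem_cell_iff[OF \<open>0 < y\<close>] cell_index_Suc[OF \<open>0 < y\<close>, of n] d by simp
    qed
    moreover have "?i \<noteq> 0" using d j by (intro notI) simp
    moreover have "?i < 2 ^ Suc n" using pos \<open>x \<le> 1\<close> by (rule cell_index_less)
    ultimately have "?i \<in> {j \<in> {1..<2 ^ Suc n}. cell (Suc n) j \<subseteq> T}" using j by auto
    then show "x \<in> ?C (Suc n)" using pos by (simp add: mem_cell_union_iff)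
  qed
qed

lemma measurable_mcount_open:
  assumes "open T" shows "(\<lambda>m. mcount m (T \<inter> {0<..1})) \<in> borel_measurable void_space"
proof -
  have "mcount m (T \<inter> {0<..1}) = (SUP n. mcount m (cell_union n {j \<in> {1..<2 ^ n}. cell n j \<subseteq> T}))" for m
    unfolding open_Int_unit_eq_cells(1)[OF assms] mcount_eq_emeasure
    by (rule SUP_emeasure_incseq[symmetric]) (use open_Int_unit_eq_cells(2)[OF assms] in auto)
  moreover have "(\<lambda>m. SUP n. mcount m (cell_union n {j \<in> {1..<2 ^ n}. cell n j \<subseteq> T})) \<in> borel_measurable void_space"
    by (intro borel_measurable_SUP measurable_mcount_cell_union) auto
  ultimately show ?thesis by simp
qed

text \<open>A Dynkin class argument starting from the open sets. Truncation at 2^-r makes the counts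
  finite, so that complements can be handled by subtraction.\<close>

lemma measurable_mcount_tail:
  assumes "T \<in> sets borel" shows "(\<lambda>m. mcount m (T \<inter> {1 / 2 ^ r<..1})) \<in> borel_measurable void_space"
proof -
  have E: "T \<inter> {1 / 2 ^ r<..1::real} = (T \<inter> {1 / 2 ^ r<..}) \<inter> {0<..1}" for T
  proof -
    have "{c<..1::real} = {c<..} \<inter> {0<..1}" if "0 < c" for c using that by auto
    from this[of "1 / 2 ^ r"] have "{1 / 2 ^ r<..1::real} = {1 / 2 ^ r<..} \<inter> {0<..1}" by simp
    then show ?thesis by blast
  qed
  have base: "(\<lambda>m. mcount m (T \<inter> {1 / 2 ^ r<..1})) \<in> borel_measurable void_space" if "open T" for T
    unfolding E using that by (intro measurable_mcount_open open_Int) auto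
  have "Int_stable {S :: real set. open S}" "{S :: real set. open S} \<subseteq> Pow UNIV" "T \<in> sigma_sets UNIV {S. open S}"
    using assms by (auto simp: Int_stable_def sets_borel)
  then show ?thesis
  proof (induction rule: sigma_sets_induct_disjoint)
    case (basic A)
    then show ?case using base by simp
  next
    case empty
    show ?case by (simp add: mcount_eq_emeasure)
  next
    case (compl A)
    have "(\<lambda>m. mcount m {1 / 2 ^ r<..1} - mcount m (A \<inter> {1 / 2 ^ r<..1})) \<in> borel_measurable void_space"
      using base[of UNIV] compl(2) by (intro borel_measurable_minus_ennreal) simp_all
    moreover have "mcount m ((UNIV - A) \<inter> {1 / 2 ^ r<..1}) = mcount m {1 / 2 ^ r<..1} - mcount m (A \<inter> {1 / 2 ^ r<..1})"
      if "m \<in> space void_space" for m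
    proof -
      have "mcount m {1 / 2 ^ r<..1} < top" using that by (simp add: space_void_space simple_locally_finite_def)
      moreover have "mcount m (A \<inter> {1 / 2 ^ r<..1}) \<le> mcount m {1 / 2 ^ r<..1}" by (rule mcount_mono) auto
      ultimately have "mcount m (A \<inter> {1 / 2 ^ r<..1}) \<noteq> top" by (auto simp: top_unique)
      then have "mcount m ({1 / 2 ^ r<..1} - A \<inter> {1 / 2 ^ r<..1}) = mcount m {1 / 2 ^ r<..1} - mcount m (A \<inter> {1 / 2 ^ r<..1})"
        unfolding mcount_eq_emeasure by (intro emeasure_Diff) auto
      moreover have "(UNIV - A) \<inter> {1 / 2 ^ r<..1} = {1 / 2 ^ r<..1} - A \<inter> {1 / 2 ^ r<..1}" by auto
      ultimately show ?thesis by simp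
    qed
    ultimately show ?case by (simp cong: measurable_cong)
  next
    case (union A)
    have "mcount m (\<Union> (range A) \<inter> {1 / 2 ^ r<..1}) = (\<Sum>i. mcount m (A i \<inter> {1 / 2 ^ r<..1}))" for m
    proof -
      have "(\<Sum>i. emeasure (count_measure m) (A i \<inter> {1 / 2 ^ r<..1})) = emeasure (count_measure m) (\<Union>i. A i \<inter> {1 / 2 ^ r<..1})"
        using union(1) by (intro suminf_emeasure) (auto simp: disjoint_family_on_def)
      then show ?thesis by (simp add: mcount_eq_emeasure)
    qed
    then show ?case using union(3) by (simp add: borel_measurable_suminf)
  qed
qed

lemma measurable_mcount:
  assumes "T \<in> sets borel" "T \<subseteq> {0<..1}" shows "(\<lambda>m. mcount m T) \<in> borel_measurable void_space"
proof -
  have T: "T = (\<Union>r. T \<inter> {1 / 2 ^ r<..1})"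
  proof (intro equalityI subsetI)
    fix x assume x: "x \<in> T"
    then have "0 < x" "x \<le> 1" using assms(2) by auto
    obtain r where "1 / x < 2 ^ r" using real_arch_pow[of 2 "1 / x"] by auto
    then have "1 / 2 ^ r < x" using \<open>0 < x\<close> by (simp add: field_simps)
    then show "x \<in> (\<Union>r. T \<inter> {1 / 2 ^ r<..1})" using x \<open>x \<le> 1\<close> by auto
  qed auto
  have "incseq (\<lambda>r. T \<inter> {1 / 2 ^ r<..1})"
  proof (rule incseq_SucI)
    fix r :: nat
    have "(1 / 2 ^ Suc r :: real) \<le> 1 / 2 ^ r" by (simp add: field_simps)
    then show "T \<inter> {1 / 2 ^ r<..1} \<subseteq> T \<inter> {1 / 2 ^ Suc r<..1}" by (auto simp del: power_Suc)
  qed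
  then have "mcount m T = (SUP r. mcount m (T \<inter> {1 / 2 ^ r<..1}))" for m
    unfolding mcount_eq_emeasure by (subst T, subst SUP_emeasure_incseq) auto
  then show ?thesis using measurable_mcount_tail[OF assms(1)] by simp
qed

subsection \<open>Processes with the prescribed intensities\<close>

lemma SUP_mult_incseq_ennreal:
  fixes f g :: "nat \<Rightarrow> ennreal"
  assumes "incseq f" "incseq g"
  shows "(SUP m. f m * g m) = (SUP m. f m) * (SUP m. g m)"
proof (rule antisym)
  show "(SUP m. f m * g m) \<le> (SUP m. f m) * (SUP m. g m)"
    by (intro SUP_least mult_mono SUP_upper) auto
  have "f m * g n \<le> (SUP m. f m * g m)" for m n
  proof -
    have "f m * g n \<le> f (max m n) * g (max m n)"
      using assms by (intro mult_mono) (auto simp: incseq_def)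
    also have "\<dots> \<le> (SUP m. f m * g m)" by (rule SUP_upper) simp
    finally show ?thesis .
  qed
  then show "(SUP m. f m) * (SUP m. g m) \<le> (SUP m. f m * g m)"
    unfolding SUP_mult_right_ennreal SUP_mult_left_ennreal by (intro SUP_least)
qed

lemma incseq_prod_ennreal:
  fixes f :: "nat \<Rightarrow> 'i \<Rightarrow> ennreal"
  assumes "\<And>i. i \<in> I \<Longrightarrow> incseq (\<lambda>m. f m i)"
  shows "incseq (\<lambda>m. \<Prod>i\<in>I. f m i)"
  using assms by (auto simp: incseq_def intro!: prod_mono_ennreal)

lemma SUP_prod_incseq_ennreal:
  fixes f :: "nat \<Rightarrow> 'i \<Rightarrow> ennreal"
  assumes "finite I" "\<And>i. i \<in> I \<Longrightarrow> incseq (\<lambda>m. f m i)"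
  shows "(SUP m. \<Prod>i\<in>I. f m i) = (\<Prod>i\<in>I. SUP m. f m i)"
  using assms
proof (induction I rule: finite_induct)
  case (insert i I)
  have "(SUP m. f m i * (\<Prod>i\<in>I. f m i)) = (SUP m. f m i) * (SUP m. \<Prod>i\<in>I. f m i)"
    using insert.prems by (intro SUP_mult_incseq_ennreal incseq_prod_ennreal) auto
  then show ?case using insert by simp
qed simp

lemma SUP_indicator_incseq:
  "(SUP m. indicator (S m) x :: ennreal) = indicator (\<Union>m. S m) x"
proof (cases "\<exists>m. x \<in> S m")
  case True
  then obtain m where "x \<in> S m" by auto
  then have "1 \<le> (SUP m. indicator (S m) x :: ennreal)" by (intro SUP_upper2[of m]) auto
  moreover have "(SUP m. indicator (S m) x :: ennreal) \<le> 1" by (intro SUP_least) (auto split: split_indicator)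
  ultimately show ?thesis using True by (auto intro: antisym)
qed simp

lemma box_intensity_incseq:
  assumes I: "finite I" and S: "\<And>i m. i \<in> I \<Longrightarrow> S m i \<in> sets borel" "\<And>i. i \<in> I \<Longrightarrow> incseq (\<lambda>m. S m i)"
  shows "box_intensity \<theta> I (\<lambda>i. \<Union>m. S m i) = (SUP m. box_intensity \<theta> I (S m))"
proof -
  note [measurable] = S(1)
  let ?f = "\<lambda>m x. (\<Prod>i\<in>I. indicator (S m i) (x i)) * pd_dens \<theta> I x"
  have inc: "incseq (\<lambda>m. indicator (S m i) (x i) :: ennreal)" if "i \<in> I" for i and x :: "'a \<Rightarrow> real"
    using S(2)[OF that] by (auto simp: incseq_def subset_eq split: split_indicator)
  have "(SUP m. box_intensity \<theta> I (S m)) = (\<integral>\<^sup>+x. (SUP m. ?f m x) \<partial>lborel_PiM I)"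
    unfolding box_intensity_def
  proof (rule nn_integral_monotone_convergence_SUP[symmetric])
    show "incseq ?f"
      unfolding incseq_def le_fun_def
    proof (intro allI impI mult_right_mono)
      fix m n :: nat and x :: "'a \<Rightarrow> real" assume "m \<le> n"
      then show "(\<Prod>i\<in>I. indicator (S m i) (x i)) \<le> (\<Prod>i\<in>I. indicator (S n i) (x i) :: ennreal)"
        using inc by (intro prod_mono_ennreal) (auto simp: incseq_def)
    qed simp
  qed measurable
  also have "\<dots> = box_intensity \<theta> I (\<lambda>i. \<Union>m. S m i)"
    unfolding box_intensity_def SUP_mult_right_ennreal[symmetric]
  proof (intro nn_integral_cong arg_cong2[where f="(*)"] refl)
    fix x :: "'a \<Rightarrow> real"
    show "(SUP m. \<Prod>i\<in>I. indicator (S m i) (x i)) = (\<Prod>i\<in>I. indicator (\<Union>m. S m i) (x i) :: ennreal)"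
      by (subst SUP_prod_incseq_ennreal[OF I]) (simp_all add: inc SUP_indicator_incseq)
  qed
  finally show ?thesis ..
qed

lemma box_intensity_PiE:
  "(\<integral>\<^sup>+x\<in>(\<Pi>\<^sub>E i\<in>{..<k}. S i). PD_density \<theta> k x \<partial>lborel_PiM {..<k}) = box_intensity \<theta> {..<k} S"
  unfolding box_intensity_def PD_density_eq
  by (intro nn_integral_cong) (auto simp: prod_indicator_eq space_PiM PiE_iff split: split_indicator)

locale PD_process =
  fixes \<theta> :: real and M :: "'w measure" and A :: "'w \<Rightarrow> real \<Rightarrow> nat"
  assumes \<theta>: "0 < \<theta>" and random: "random_multisubset M A" and conditions: "PD_conditions \<theta> M A"

sublocale PD_process \<subseteq> prob_space M
  using random by (simp add: random_multisubset_def)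

context PD_process begin

lemma measurable_count:
  "S \<in> sets borel \<Longrightarrow> S \<subseteq> {0<..1} \<Longrightarrow> (\<lambda>\<omega>. mcount (A \<omega>) S) \<in> borel_measurable M"
  using random by (simp add: random_multisubset_def)

lemma measurable_count_cell:
  "j < 2 ^ n \<Longrightarrow> (\<lambda>\<omega>. mcount (A \<omega>) (cell n j)) \<in> borel_measurable M"
  by (intro measurable_count cell_borel cell_subset_unit)

lemma AE_msum: "AE \<omega> in M. msum (A \<omega>) \<le> 1"
proof -
  let ?S = "{\<omega> \<in> space M. msum (A \<omega>) \<le> 1}"
  have "prob ?S = 1" using conditions by (simp add: PD_conditions_def)
  \<comment> \<open>A set that is not an event has measure 0, so probability 1 already makes
    \<open>?S\<close> an event.\<close>
  moreover from this have "?S \<in> events" by (metis measure_notin_sets zero_neq_one)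
  ultimately have "AE \<omega> in M. \<omega> \<in> ?S" by (simp only: prob_eq_1)
  then show ?thesis by (rule eventually_mono) simp
qed

text \<open>The conditions cover disjoint closed intervals, but the closures of neighbouring cells
  share an endpoint. The half-open intervals are exhausted from inside by
  [\<open>c m i\<close>, \<open>b i\<close>], with monotone convergence on both sides.\<close>

lemma intensity_half_open:
  fixes a b :: "nat \<Rightarrow> real" and k :: nat
  assumes k: "1 \<le> k" and ab: "\<And>i. i < k \<Longrightarrow> 0 \<le> a i \<and> a i < b i \<and> b i \<le> 1"
    and disj: "disjoint_family_on (\<lambda>i. {a i<..b i}) {..<k}"
  shows "(\<integral>\<^sup>+\<omega>. (\<Prod>i<k. mcount (A \<omega>) {a i<..b i}) \<partial>M) = box_intensity \<theta> {..<k} (\<lambda>i. {a i<..b i})" (is "?L = _")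
proof -
  define c where "c m i = a i + (b i - a i) / (real m + 1)" for m i
  have c: "a i < c m i" "c m i \<le> b i" if "i < k" for m i
  proof -
    have "0 < b i - a i" using ab[OF that] by simp
    then show "a i < c m i" by (simp add: c_def)
    have "(b i - a i) / (real m + 1) \<le> (b i - a i) / 1"
      using \<open>0 < b i - a i\<close> by (intro divide_left_mono) auto
    then show "c m i \<le> b i" by (simp add: c_def)
  qed
  have dec: "c n i \<le> c m i" if "m \<le> n" "i < k" for m n i
    using that ab[OF that(2)] by (auto simp: c_def intro!: divide_left_mono)
  have un: "(\<Union>m. {c m i..b i}) = {a i<..b i}" if i: "i < k" for i
  proof (intro equalityI subsetI)
    fix x assume x: "x \<in> {a i<..b i}"
    obtain m where m: "(b i - a i) / (x - a i) < real m" using reals_Archimedean2 by blast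
    then have "b i - a i < real m * (x - a i)" using x by (simp add: pos_divide_less_eq)
    also have "\<dots> \<le> (real m + 1) * (x - a i)" using x by (intro mult_right_mono) auto
    finally have "(b i - a i) / (real m + 1) < x - a i" by (simp add: pos_divide_less_eq mult.commute)
    then have "c m i \<le> x" unfolding c_def by linarith
    then show "x \<in> (\<Union>m. {c m i..b i})" using x by auto
  next
    fix x assume "x \<in> (\<Union>m. {c m i..b i})"
    then obtain m where "c m i \<le> x" "x \<le> b i" by auto
    with c(1)[OF i, of m] show "x \<in> {a i<..b i}" by simp
  qed
  have inc: "incseq (\<lambda>m. {c m i..b i})" if "i < k" for i
    unfolding incseq_def
  proof (intro allI impI)
    fix m n :: nat assume "m \<le> n"
    then have "c n i \<le> c m i" using that by (rule dec)
    then show "{c m i..b i} \<subseteq> {c n i..b i}" by simp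
  qed
  have inc': "incseq (\<lambda>m. mcount m' {c m i..b i})" if "i < k" for i m'
    unfolding incseq_def by (intro allI impI mcount_mono incseqD[OF inc[OF that]])
  have cnt: "mcount m' {a i<..b i} = (SUP m. mcount m' {c m i..b i})" if "i < k" for i m'
    unfolding un[OF that, symmetric] mcount_eq_emeasure
    by (rule SUP_emeasure_incseq[symmetric]) (use inc[OF that] in auto)
  have meas: "(\<lambda>\<omega>. mcount (A \<omega>) {c m i..b i}) \<in> borel_measurable M" if "i < k" for m i
  proof (rule measurable_count)
    show "{c m i..b i} \<subseteq> {0<..1}" using c(1)[OF that, of m] ab[OF that] by auto
  qed simp
  have "?L = (\<integral>\<^sup>+\<omega>. (SUP m. \<Prod>i<k. mcount (A \<omega>) {c m i..b i}) \<partial>M)"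
  proof (intro nn_integral_cong)
    fix \<omega>
    have "(\<Prod>i<k. mcount (A \<omega>) {a i<..b i}) = (\<Prod>i<k. SUP m. mcount (A \<omega>) {c m i..b i})"
      by (intro prod.cong refl cnt) simp
    also have "\<dots> = (SUP m. \<Prod>i<k. mcount (A \<omega>) {c m i..b i})"
      using inc' by (intro SUP_prod_incseq_ennreal[symmetric]) auto
    finally show "(\<Prod>i<k. mcount (A \<omega>) {a i<..b i}) = (SUP m. \<Prod>i<k. mcount (A \<omega>) {c m i..b i})" .
  qed
  also have "\<dots> = (SUP m. \<integral>\<^sup>+\<omega>. (\<Prod>i<k. mcount (A \<omega>) {c m i..b i}) \<partial>M)"
  proof (rule nn_integral_monotone_convergence_SUP)
    have "incseq (\<lambda>m. \<Prod>i<k. mcount (A \<omega>) {c m i..b i})" for \<omega>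
      using inc' by (intro incseq_prod_ennreal) auto
    then show "incseq (\<lambda>m \<omega>. \<Prod>i<k. mcount (A \<omega>) {c m i..b i})"
      by (simp add: incseq_def le_fun_def)
  qed (use meas in \<open>auto intro!: borel_measurable_prod_ennreal\<close>)
  also have "\<dots> = (SUP m. box_intensity \<theta> {..<k} (\<lambda>i. {c m i..b i}))"
  proof (intro SUP_cong refl)
    fix m
    have "has_multi_intensity_density M A k (PD_density \<theta> k)"
      using conditions k by (simp add: PD_conditions_def)
    moreover have "\<forall>i<k. 0 < c m i \<and> c m i \<le> b i \<and> b i \<le> 1"
      using c ab by (meson le_less_trans)
    moreover have "disjoint_family_on (\<lambda>i. {c m i..b i}) {..<k}"
      unfolding disjoint_family_on_def
    proof (intro ballI impI)
      fix i j assume ij: "i \<in> {..<k}" "j \<in> {..<k}" "i \<noteq> j"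
      have "{c m i..b i} \<subseteq> {a i<..b i}" "{c m j..b j} \<subseteq> {a j<..b j}"
        using c(1)[of i m] c(1)[of j m] ij by auto
      with disjoint_family_onD[OF disj ij] show "{c m i..b i} \<inter> {c m j..b j} = {}" by blast
    qed
    ultimately show "(\<integral>\<^sup>+\<omega>. (\<Prod>i<k. mcount (A \<omega>) {c m i..b i}) \<partial>M) = box_intensity \<theta> {..<k} (\<lambda>i. {c m i..b i})"
      unfolding has_multi_intensity_density_def box_intensity_PiE by blast
  qed
  also have "\<dots> = box_intensity \<theta> {..<k} (\<lambda>i. \<Union>m. {c m i..b i})"
    using inc by (intro box_intensity_incseq[symmetric]) auto
  also have "\<dots> = box_intensity \<theta> {..<k} (\<lambda>i. {a i<..b i})"
    unfolding box_intensity_def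
    by (intro nn_integral_cong arg_cong2[where f="(*)"] prod.cong) (use un in auto)
  finally show ?thesis .
qed

abbreviation cell_moment :: "nat \<Rightarrow> nat set \<Rightarrow> ennreal" where
  "cell_moment n K \<equiv> \<integral>\<^sup>+\<omega>. (\<Prod>j\<in>K. mcount (A \<omega>) (cell n j)) \<partial>M"

text \<open>The right side depends only on \<theta> and the cells, so any two processes satisfying
  the conditions have the same cell moments.\<close>

lemma cell_moment_eq:
  fixes e :: "nat \<Rightarrow> nat" and k :: nat
  assumes J: "J \<subseteq> {1..<2 ^ n}" "J \<noteq> {}" and e: "bij_betw e {..<k} J"
  shows "(\<integral>\<^sup>+\<omega>. (\<Prod>j\<in>J. mcount (A \<omega>) (cell n j)) \<partial>M) = box_intensity \<theta> {..<k} (\<lambda>i. cell n (e i))" (is "?L = _")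
proof -
  have k: "1 \<le> k" using J(2) e by (cases k) (auto simp: bij_betw_def)
  have m: "e i \<in> J" if "i < k" for i using e that by (auto simp: bij_betw_def)
  have "?L = (\<integral>\<^sup>+\<omega>. (\<Prod>i<k. mcount (A \<omega>) (cell n (e i))) \<partial>M)"
    by (intro nn_integral_cong prod.reindex_bij_betw[OF e, symmetric])
  also have "\<dots> = box_intensity \<theta> {..<k} (\<lambda>i. cell n (e i))"
    unfolding cell_def
  proof (rule intensity_half_open[OF k])
    fix i assume "i < k"
    then have "e i \<in> {1..<2 ^ n}" using m[of i] J(1) by blast
    then have "e i < 2 ^ n" by simp
    then have "real (e i + 1) \<le> real (2 ^ n)" by (subst of_nat_le_iff) simp
    then show "0 \<le> real (e i) / 2 ^ n \<and> real (e i) / 2 ^ n < (real (e i) + 1) / 2 ^ n \<and> (real (e i) + 1) / 2 ^ n \<le> 1"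
      by (simp add: divide_strict_right_mono)
  next
    have "disjoint_family_on (\<lambda>i. cell n (e i)) {..<k}"
      unfolding disjoint_family_on_def
    proof (intro ballI impI)
      fix i j assume ij: "i \<in> {..<k}" "j \<in> {..<k}" "i \<noteq> j"
      then have "e i \<noteq> e j" using e by (auto simp: bij_betw_def inj_on_def)
      then show "cell n (e i) \<inter> cell n (e j) = {}"
        using disjoint_family_onD[OF disjoint_cells[of n UNIV], of "e i" "e j"] by simp
    qed
    then show "disjoint_family_on (\<lambda>i. {real (e i) / 2 ^ n<..(real (e i) + 1) / 2 ^ n}) {..<k}"
      by (simp only: cell_def)
  qed
  finally show ?thesis .
qed

text \<open>Each point of (2^-r, 1] contributes more than 2^-r to T \<le> 1.\<close>

lemma AE_count_tail: "AE \<omega> in M. \<forall>r. mcount (A \<omega>) {1 / 2 ^ r<..1} \<le> 2 ^ r"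
  using AE_msum
proof eventually_elim
  case (elim \<omega>)
  show ?case
  proof
    fix r :: nat
    have "ennreal (1 / 2 ^ r) * mcount (A \<omega>) {1 / 2 ^ r<..1} = (\<integral>\<^sup>+u. ennreal (1 / 2 ^ r) * indicator {1 / 2 ^ r<..1} u \<partial>count_measure (A \<omega>))"
      by (simp add: mcount_eq_emeasure nn_integral_cmult_indicator)
    also have "\<dots> \<le> msum (A \<omega>)"
      unfolding msum_eq
    proof (intro nn_integral_mono)
      fix u :: real
      have "c \<le> u \<and> 0 < u" if "0 < c" "c < u" for c using that by auto
      from this[of "1 / 2 ^ r"] show "ennreal (1 / 2 ^ r) * indicator {1 / 2 ^ r<..1} u \<le> ennreal u * indicator {0<..1} u"
        by (auto split: split_indicator intro!: ennreal_leI)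
    qed
    also have "\<dots> \<le> 1" by (rule elim)
    finally have "2 ^ r * (ennreal (1 / 2 ^ r) * mcount (A \<omega>) {1 / 2 ^ r<..1}) \<le> 2 ^ r * 1" by (intro mult_left_mono) auto
    moreover have "2 ^ r * ennreal (1 / 2 ^ r) = 1"
    proof -
      have "2 ^ r * ennreal (1 / 2 ^ r) = ennreal (2 ^ r) * ennreal (1 / 2 ^ r)" by (simp flip: ennreal_power)
      also have "\<dots> = ennreal (2 ^ r * (1 / 2 ^ r))" by (rule ennreal_mult[symmetric]) auto
      finally show ?thesis by simp
    qed
    ultimately show "mcount (A \<omega>) {1 / 2 ^ r<..1} \<le> 2 ^ r" by (simp add: mult.assoc[symmetric])
  qed
qed

text \<open>A single good level suffices, because every finer cell lies in a cell of that level.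
  Local finiteness is supplied by \<open>AE_count_tail\<close>.\<close>

lemma AE_simple_locally_finiteI:
  assumes "\<And>r. AE \<omega> in M. \<exists>k. \<forall>j\<in>{2 ^ k..<2 ^ (r + k)}. mcount (A \<omega>) (cell (r + k) j) \<le> 1"
  shows "AE \<omega> in M. simple_locally_finite (A \<omega>)"
proof -
  have "AE \<omega> in M. \<forall>r. \<exists>k. \<forall>j\<in>{2 ^ k..<2 ^ (r + k)}. mcount (A \<omega>) (cell (r + k) j) \<le> 1"
    using assms by (subst AE_all_countable) blast
  then show ?thesis using AE_count_tail
  proof eventually_elim
    case (elim \<omega>)
    have "\<exists>k0. \<forall>k\<ge>k0. \<forall>j\<in>{2 ^ k..<2 ^ (r + k)}. mcount (A \<omega>) (cell (r + k) j) \<le> 1" for r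
    proof -
      obtain k0 where k0: "\<And>j. j \<in> {2 ^ k0..<2 ^ (r + k0)} \<Longrightarrow> mcount (A \<omega>) (cell (r + k0) j) \<le> 1"
        using elim(1) by blast
      have "mcount (A \<omega>) (cell (r + (k0 + l)) j) \<le> 1" if j: "j \<in> {2 ^ (k0 + l)..<2 ^ (r + (k0 + l))}" for l j
      proof -
        have "2 ^ k0 * 2 ^ l \<le> j" "j < 2 ^ (r + k0) * 2 ^ l" using j by (simp_all add: power_add mult.assoc)
        then have "j div 2 ^ l \<in> {2 ^ k0..<2 ^ (r + k0)}"
          by (simp add: less_eq_div_iff_mult_less_eq div_less_iff_less_mult)
        then have "mcount (A \<omega>) (cell (r + k0) (j div 2 ^ l)) \<le> 1" by (rule k0)
        moreover have "cell (r + (k0 + l)) j \<subseteq> cell (r + k0) (j div 2 ^ l)"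
        proof
          fix y assume y: "y \<in> cell (r + (k0 + l)) j"
          then have "0 < y" by (rule cell_pos)
          with y show "y \<in> cell (r + k0) (j div 2 ^ l)"
            using cell_index_add[of y "r + k0" l] by (simp add: mem_cell_iff add.assoc)
        qed
        ultimately show ?thesis using mcount_mono order_trans by blast
      qed
      then have "\<forall>j\<in>{2 ^ k..<2 ^ (r + k)}. mcount (A \<omega>) (cell (r + k) j) \<le> 1" if "k0 \<le> k" for k
        using that le_Suc_ex by blast
      then show ?thesis by blast
    qed
    moreover have "mcount (A \<omega>) {1 / 2 ^ r<..1} < top" for r
      using elim(2) by (meson ennreal_numeral_less_top le_less_trans power_less_top_ennreal)
    ultimately show ?case by (simp add: simple_locally_finite_def)
  qed
qed

end

subsection \<open>Simplicity\<close>

definition intensity1 :: "real \<Rightarrow> real \<Rightarrow> ennreal" where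
  "intensity1 \<theta> x = (if x < 1 then ennreal (\<theta> * (1 - x) powr (\<theta> - 1) / x) else 0)"

definition intensity2 :: "real \<Rightarrow> real \<Rightarrow> real \<Rightarrow> ennreal" where
  "intensity2 \<theta> x y = (if x + y < 1 then ennreal (\<theta>\<^sup>2 * (1 - (x + y)) powr (\<theta> - 1) / (x * y)) else 0)"

lemma measurable_intensity1[measurable]: "intensity1 \<theta> \<in> borel_measurable borel"
  unfolding intensity1_def by measurable

lemma measurable_intensity2[measurable (raw)]:
  assumes [measurable]: "f \<in> borel_measurable M" "g \<in> borel_measurable M"
  shows "(\<lambda>z. intensity2 \<theta> (f z) (g z)) \<in> borel_measurable M"
  unfolding intensity2_def by measurable

lemma pd_dens_one: "pd_dens \<theta> {..<Suc 0} x = intensity1 \<theta> (x 0)"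
  unfolding pd_dens_def intensity1_def lessThan_Suc lessThan_0 by simp

lemma pd_dens_two: "pd_dens \<theta> {..<Suc (Suc 0)} x = intensity2 \<theta> (x 0) (x (Suc 0))"
proof -
  have "sum x {..<Suc (Suc 0)} = x 0 + x (Suc 0)" "prod x {..<Suc (Suc 0)} = x 0 * x (Suc 0)"
    by (simp_all only: sum.lessThan_Suc prod.lessThan_Suc lessThan_0 sum.empty prod.empty add_0_left mult_1_left)
  moreover have "card {..<Suc (Suc 0)} = 2" by (simp only: card_lessThan numeral_2_eq_2)
  ultimately show ?thesis unfolding pd_dens_def intensity2_def by (simp only:)
qed

lemma box_intensity_one:
  assumes [measurable]: "S \<in> sets borel"
  shows "box_intensity \<theta> {..<Suc 0} (\<lambda>_. S) = (\<integral>\<^sup>+x. indicator S x * intensity1 \<theta> x \<partial>lborel)"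
proof -
  interpret product_sigma_finite "\<lambda>_::nat. lborel :: real measure" ..
  let ?g = "\<lambda>z. indicator S z * intensity1 \<theta> z"
  have "box_intensity \<theta> {..<Suc 0} (\<lambda>_. S) = (\<integral>\<^sup>+x. ?g (x 0) \<partial>lborel_PiM {..<Suc 0})"
    unfolding box_intensity_def pd_dens_one
    by (simp only: prod.lessThan_Suc lessThan_0 prod.empty mult_1_left)
  also have "\<dots> = (\<integral>\<^sup>+x. ?g (x 0) \<partial>lborel_PiM {0 :: nat})"
    by (simp only: lessThan_Suc lessThan_0)
  also have "\<dots> = (\<integral>\<^sup>+x. ?g x \<partial>lborel)"
    by (rule product_nn_integral_singleton) measurable
  finally show ?thesis .
qed

lemma box_intensity_two:
  assumes S[measurable]: "\<And>i. S i \<in> sets borel"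
  shows "box_intensity \<theta> {..<Suc (Suc 0)} S =
    (\<integral>\<^sup>+x. \<integral>\<^sup>+y. indicator (S 0) x * (indicator (S (Suc 0)) y * intensity2 \<theta> x y) \<partial>lborel \<partial>lborel)"
proof -
  interpret product_sigma_finite "\<lambda>_::nat. lborel :: real measure" ..
  let ?f = "\<lambda>x y. indicator (S 0) x * (indicator (S (Suc 0)) y * intensity2 \<theta> x y)"
  have m: "case_prod ?f \<in> borel_measurable (lborel \<Otimes>\<^sub>M lborel)" by measurable
  have "box_intensity \<theta> {..<Suc (Suc 0)} S = (\<integral>\<^sup>+x. ?f (x 0) (x (Suc 0)) \<partial>lborel_PiM {..<Suc (Suc 0)})"
    unfolding box_intensity_def pd_dens_two
    by (simp only: prod.lessThan_Suc lessThan_0 prod.empty mult_1_left mult.assoc)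
  also have "\<dots> = (\<integral>\<^sup>+x. ?f (x 0) (x (Suc 0)) \<partial>lborel_PiM {0, Suc 0})"
    by (simp only: lessThan_Suc lessThan_0 insert_commute)
  also have "\<dots> = (\<integral>\<^sup>+z. ?f (fst z) (snd z) \<partial>(lborel \<Otimes>\<^sub>M lborel))"
    by (rule product_nn_integral_pair[OF m]) simp
  also have "\<dots> = (\<integral>\<^sup>+x. \<integral>\<^sup>+y. ?f x y \<partial>lborel \<partial>lborel)"
    using lborel.nn_integral_fst[OF m] by (simp add: split_beta')
  finally show ?thesis .
qed

text \<open>Points are rounded down to the left end of their cell, so that weighted cell counts stay
  below T; for positive points the rounded value increases with n.\<close>

definition left_end :: "nat \<Rightarrow> real \<Rightarrow> real" where
  "left_end n x = real (cell_index n x) / 2 ^ n"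

lemma measurable_cell_index[measurable]: "cell_index n \<in> borel \<rightarrow>\<^sub>M count_space UNIV"
  unfolding cell_index_def by measurable

lemma measurable_left_end[measurable]: "left_end n \<in> borel_measurable borel"
  unfolding left_end_def by measurable

lemma left_end_nonneg: "0 \<le> left_end n x" by (simp add: left_end_def)

lemma left_end_bounds:
  assumes "0 < x" shows "left_end n x < x" "x - 1 / 2 ^ n \<le> left_end n x"
proof -
  show "left_end n x < x"
    using cell_index_bounds(1)[OF assms, of n] by (simp add: left_end_def field_simps)
  have "(2 ^ n * x - 1) / 2 ^ n \<le> left_end n x"
    using cell_index_bounds(2)[OF assms, of n] unfolding left_end_def by (intro divide_right_mono) auto
  then show "x - 1 / 2 ^ n \<le> left_end n x" by (simp add: diff_divide_distrib)
qed

lemma left_end_mono: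
  assumes "0 < x" "m \<le> n" shows "left_end m x \<le> left_end n x"
proof -
  have "left_end n x \<le> left_end (Suc n) x" for n
  proof -
    have "2 * (cell_index (Suc n) x div 2) \<le> cell_index (Suc n) x" by simp
    then have "2 * cell_index n x \<le> cell_index (Suc n) x" using cell_index_Suc[OF assms(1), of n] by simp
    then have "2 * real (cell_index n x) \<le> real (cell_index (Suc n) x)" by linarith
    then show ?thesis by (simp add: left_end_def field_simps)
  qed
  then show ?thesis using lift_Suc_mono_le[of "\<lambda>n. left_end n x"] assms(2) by blast
qed

lemma left_end_tendsto:
  assumes "0 < x" shows "(\<lambda>n. left_end n x) \<longlonglongrightarrow> x"
proof (rule tendsto_sandwich)
  have "(\<lambda>n. 1 / 2 ^ n :: real) \<longlonglongrightarrow> 0"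
    using LIMSEQ_realpow_zero[of "1/2::real"] by (simp add: power_one_over)
  then have "(\<lambda>n. x - 1 / 2 ^ n) \<longlonglongrightarrow> x - 0" by (intro tendsto_diff tendsto_const)
  then show "(\<lambda>n. x - 1 / 2 ^ n) \<longlonglongrightarrow> x" by simp
  show "eventually (\<lambda>n. x - 1 / 2 ^ n \<le> left_end n x) sequentially"
    using left_end_bounds(2)[OF assms] by (rule always_eventually[OF allI])
  show "eventually (\<lambda>n. left_end n x \<le> x) sequentially"
    using left_end_bounds(1)[OF assms, THEN less_imp_le] by (rule always_eventually[OF allI])
qed simp

lemma cell_index_neq_mono:
  assumes "0 < x" "0 < y" "cell_index m x \<noteq> cell_index m y" "m \<le> n"
  shows "cell_index n x \<noteq> cell_index n y"
  using cell_index_add[OF assms(1), of m "n - m"] cell_index_add[OF assms(2), of m "n - m"] assms(3,4) by auto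

lemma eventually_cell_index_neq:
  assumes "0 < x" "0 < y" "x \<noteq> y"
  shows "eventually (\<lambda>n. cell_index n x \<noteq> cell_index n y) sequentially"
proof -
  have "(\<lambda>n. left_end n x - left_end n y) \<longlonglongrightarrow> x - y"
    using assms by (intro tendsto_diff left_end_tendsto)
  then have "eventually (\<lambda>n. left_end n x - left_end n y \<noteq> 0) sequentially"
    using assms(3) by (intro tendsto_imp_eventually_ne) auto
  then show ?thesis by eventually_elim (auto simp: left_end_def)
qed

text \<open>The integrand x y f_2 with both weights rounded down, restricted to pairs in different
  cells because the intensities concern disjoint sets only. For fixed x > 0 it increases with n to
  the integrand off the diagonal.\<close>

definition pair_kernel :: "real \<Rightarrow> nat \<Rightarrow> real \<Rightarrow> real \<Rightarrow> ennreal" where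
  "pair_kernel \<theta> n x y = (if 0 < y \<and> y \<le> 1 \<and> cell_index n x \<noteq> cell_index n y
     then ennreal (left_end n x * left_end n y) * intensity2 \<theta> x y else 0)"

abbreviation pair_limit :: "real \<Rightarrow> real \<Rightarrow> real \<Rightarrow> ennreal" where
  "pair_limit \<theta> x y \<equiv> if 0 < y \<and> y \<le> 1 \<and> x \<noteq> y then ennreal (x * y) * intensity2 \<theta> x y else 0"

definition second_moment_kernel :: "real \<Rightarrow> nat \<Rightarrow> real \<Rightarrow> ennreal" where
  "second_moment_kernel \<theta> n x = (if 0 < x \<and> x < 1
     then ennreal ((left_end n x)\<^sup>2) * intensity1 \<theta> x + (\<integral>\<^sup>+y. pair_kernel \<theta> n x y \<partial>lborel) else 0)"

text \<open>Real inequalities replace the comparison of indices so that measurability of the kernel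
  is immediate.\<close>

lemma cell_index_neq_iff: "cell_index n x \<noteq> cell_index n y \<longleftrightarrow> left_end n x < left_end n y \<or> left_end n y < left_end n x"
proof -
  have "cell_index n x = cell_index n y \<longleftrightarrow> left_end n x = left_end n y" by (simp add: left_end_def)
  then show ?thesis by linarith
qed

lemma measurable_pair_kernel[measurable]:
  "case_prod (pair_kernel \<theta> n) \<in> borel_measurable (borel \<Otimes>\<^sub>M borel)"
  unfolding pair_kernel_def cell_index_neq_iff by measurable

lemma measurable_second_moment_kernel[measurable]: "second_moment_kernel \<theta> n \<in> borel_measurable borel"
  unfolding second_moment_kernel_def by measurable

lemma incseq_pair_kernel:
  assumes "0 < x" shows "incseq (\<lambda>n. pair_kernel \<theta> n x)"
  unfolding incseq_def le_fun_def
proof (intro allI impI)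
  fix m n :: nat and y :: real assume mn: "m \<le> n"
  show "pair_kernel \<theta> m x y \<le> pair_kernel \<theta> n x y"
  proof (cases "0 < y \<and> y \<le> 1 \<and> cell_index m x \<noteq> cell_index m y")
    case True
    then have "cell_index n x \<noteq> cell_index n y" using cell_index_neq_mono[OF assms _ _ mn] by blast
    moreover have "left_end m x * left_end m y \<le> left_end n x * left_end n y"
      using True assms mn by (intro mult_mono left_end_mono) (auto simp: left_end_nonneg)
    then have "ennreal (left_end m x * left_end m y) * intensity2 \<theta> x y \<le> ennreal (left_end n x * left_end n y) * intensity2 \<theta> x y"
      by (intro mult_right_mono ennreal_leI) auto
    ultimately show ?thesis using True unfolding pair_kernel_def by simp
  next
    case False
    then have "pair_kernel \<theta> m x y = 0" unfolding pair_kernel_def by (rule if_not_P)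
    then show ?thesis by simp
  qed
qed

lemma pair_kernel_tendsto:
  assumes "0 < x"
  shows "(\<lambda>n. pair_kernel \<theta> n x y) \<longlonglongrightarrow> pair_limit \<theta> x y"
proof (cases "0 < y \<and> y \<le> 1 \<and> x \<noteq> y")
  case True
  have "(\<lambda>n. intensity2 \<theta> x y * ennreal (left_end n x * left_end n y)) \<longlonglongrightarrow> intensity2 \<theta> x y * ennreal (x * y)"
    using assms True by (intro ennreal_tendsto_cmult tendsto_ennrealI tendsto_mult left_end_tendsto) (auto simp: intensity2_def)
  then have "(\<lambda>n. ennreal (left_end n x * left_end n y) * intensity2 \<theta> x y) \<longlonglongrightarrow> ennreal (x * y) * intensity2 \<theta> x y"
    unfolding mult.commute[of "intensity2 \<theta> x y"] .
  moreover have "eventually (\<lambda>n. ennreal (left_end n x * left_end n y) * intensity2 \<theta> x y = pair_kernel \<theta> n x y) sequentially"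
    using eventually_cell_index_neq[OF assms conjunct1[OF True]] True
    by (auto simp: pair_kernel_def elim!: eventually_mono)
  ultimately have "(\<lambda>n. pair_kernel \<theta> n x y) \<longlonglongrightarrow> ennreal (x * y) * intensity2 \<theta> x y"
    by (rule Lim_transform_eventually)
  then show ?thesis using True by simp
next
  case False
  have "pair_kernel \<theta> n x y = 0" for n using False by (auto simp: pair_kernel_def)
  moreover have "pair_limit \<theta> x y = 0"
    using False by (rule if_not_P)
  ultimately show ?thesis by (simp only: tendsto_const)
qed

text \<open>The weights cancel the denominator and leave \<theta>^2 (1 - x - y)^(\<theta>-1), a beta
  integral; the missing point y = x is a null set.\<close>

lemma nn_integral_intensity2:
  assumes \<theta>: "0 < \<theta>" and x: "0 < x" "x < 1"
  shows "(\<integral>\<^sup>+y. pair_limit \<theta> x y \<partial>lborel) =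
    ennreal (\<theta> * (1 - x) powr \<theta>)" (is "?L = _")
proof -
  have "?L =
    (\<integral>\<^sup>+y. ennreal \<theta> * (ennreal (\<theta> * ((1 - x) - y) powr (\<theta> - 1)) * indicator {0<..<1 - x} y) \<partial>lborel)"
  proof (rule nn_integral_cong_AE, rule AE_mp[OF AE_lborel_singleton[of x]], intro AE_I2 impI)
    fix y :: real assume y: "y \<noteq> x"
    show "pair_limit \<theta> x y =
      ennreal \<theta> * (ennreal (\<theta> * ((1 - x) - y) powr (\<theta> - 1)) * indicator {0<..<1 - x} y)"
    proof (cases "0 < y \<and> x + y < 1")
      case True
      have "x * y * (\<theta>\<^sup>2 * (1 - (x + y)) powr (\<theta> - 1) / (x * y)) = \<theta> * (\<theta> * ((1 - x) - y) powr (\<theta> - 1))"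
        using True x by (simp add: power2_eq_square diff_diff_eq)
      moreover have "0 \<le> x * y" "0 \<le> \<theta>\<^sup>2 * (1 - (x + y)) powr (\<theta> - 1) / (x * y)" "0 \<le> \<theta> * ((1 - x) - y) powr (\<theta> - 1)"
        using True x \<theta> by auto
      ultimately have "ennreal (x * y) * ennreal (\<theta>\<^sup>2 * (1 - (x + y)) powr (\<theta> - 1) / (x * y)) =
         ennreal \<theta> * ennreal (\<theta> * ((1 - x) - y) powr (\<theta> - 1))"
        using \<theta> by (metis ennreal_mult less_imp_le)
      moreover have "y \<le> 1" "y \<in> {0<..<1 - x}" using True x by auto
      ultimately show ?thesis using True y by (simp add: intensity2_def)
    qed (auto simp: intensity2_def)
  qed
  also have "\<dots> = ennreal \<theta> * ennreal ((1 - x) powr \<theta>)"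
    using nn_integral_powr_reflect[OF \<theta>, of "1 - x"] x by (subst nn_integral_cmult) auto
  also have "\<dots> = ennreal (\<theta> * (1 - x) powr \<theta>)"
    using \<theta> by (simp add: ennreal_mult)
  finally show ?thesis .
qed

text \<open>The diagonal contributes x^2 f_1(x) = \<theta> x (1 - x)^(\<theta>-1), and the pairs
  contribute \<theta> (1 - x)^\<theta>. Since x + (1 - x) = 1, they add up to the Beta(1, \<theta>)
  density, whose total mass is 1.\<close>

lemma second_moment_kernel_tendsto:
  assumes \<theta>: "0 < \<theta>"
  shows "(\<lambda>n. second_moment_kernel \<theta> n x) \<longlonglongrightarrow> ennreal (\<theta> * (1 - x) powr (\<theta> - 1)) * indicator {0<..<1} x"
proof (cases "0 < x \<and> x < 1")
  case x: True
  have "(\<lambda>n. intensity1 \<theta> x * ennreal ((left_end n x)\<^sup>2)) \<longlonglongrightarrow> intensity1 \<theta> x * ennreal (x\<^sup>2)"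
    using x by (intro ennreal_tendsto_cmult tendsto_ennrealI tendsto_power left_end_tendsto) (auto simp: intensity1_def)
  moreover have "(\<lambda>n. \<integral>\<^sup>+y. pair_kernel \<theta> n x y \<partial>lborel) \<longlonglongrightarrow>
      (\<integral>\<^sup>+y. pair_limit \<theta> x y \<partial>lborel)"
    using x by (intro nn_integral_LIMSEQ incseq_pair_kernel pair_kernel_tendsto) auto
  ultimately have "(\<lambda>n. intensity1 \<theta> x * ennreal ((left_end n x)\<^sup>2) + (\<integral>\<^sup>+y. pair_kernel \<theta> n x y \<partial>lborel)) \<longlonglongrightarrow>
      intensity1 \<theta> x * ennreal (x\<^sup>2) + ennreal (\<theta> * (1 - x) powr \<theta>)"
    unfolding nn_integral_intensity2[OF \<theta> conjunct1[OF x] conjunct2[OF x]] by (rule tendsto_add)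
  moreover have "intensity1 \<theta> x * ennreal (x\<^sup>2) + ennreal (\<theta> * (1 - x) powr \<theta>) = ennreal (\<theta> * (1 - x) powr (\<theta> - 1))"
  proof -
    have i: "intensity1 \<theta> x = ennreal (\<theta> * (1 - x) powr (\<theta> - 1) / x)"
      using x by (simp add: intensity1_def)
    have "intensity1 \<theta> x * ennreal (x\<^sup>2) = ennreal (\<theta> * (1 - x) powr (\<theta> - 1) / x * x\<^sup>2)"
      unfolding i by (rule ennreal_mult[symmetric]) (use x \<theta> in auto)
    also have "\<theta> * (1 - x) powr (\<theta> - 1) / x * x\<^sup>2 = x * (\<theta> * (1 - x) powr (\<theta> - 1))"
      using x by (simp add: power2_eq_square)
    also have "ennreal \<dots> + ennreal (\<theta> * (1 - x) powr \<theta>) = ennreal (x * (\<theta> * (1 - x) powr (\<theta> - 1)) + \<theta> * (1 - x) powr \<theta>)"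
      using x \<theta> by (intro ennreal_plus[symmetric]) auto
    also have "x * (\<theta> * (1 - x) powr (\<theta> - 1)) + \<theta> * (1 - x) powr \<theta> = \<theta> * (1 - x) powr (\<theta> - 1)"
    proof -
      have p: "(1 - x) powr \<theta> = (1 - x) * (1 - x) powr (\<theta> - 1)"
        using powr_mult_base[of "1 - x" "\<theta> - 1"] x by simp
      show ?thesis unfolding p by (simp add: algebra_simps)
    qed
    finally show ?thesis .
  qed
  ultimately show ?thesis using x by (simp add: second_moment_kernel_def mult.commute)
qed (auto simp: second_moment_kernel_def)

lemma incseq_second_moment_kernel: "incseq (second_moment_kernel \<theta>)"
  unfolding incseq_def le_fun_def
proof (intro allI impI)
  fix m n :: nat and x :: real assume mn: "m \<le> n"
  show "second_moment_kernel \<theta> m x \<le> second_moment_kernel \<theta> n x"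
  proof (cases "0 < x \<and> x < 1")
    case True
    have "(\<integral>\<^sup>+y. pair_kernel \<theta> m x y \<partial>lborel) \<le> (\<integral>\<^sup>+y. pair_kernel \<theta> n x y \<partial>lborel)"
      using incseq_pair_kernel[of x \<theta>] mn True by (intro nn_integral_mono) (auto simp: incseq_def le_fun_def)
    moreover have "(left_end m x)\<^sup>2 \<le> (left_end n x)\<^sup>2"
      using True mn by (intro power_mono left_end_mono) (auto simp: left_end_nonneg)
    ultimately show ?thesis
      using True by (auto simp: second_moment_kernel_def intro!: add_mono mult_right_mono ennreal_leI)
  qed (auto simp: second_moment_kernel_def)
qed

lemma second_moment_total:
  assumes \<theta>: "0 < \<theta>"
  shows "(\<lambda>n. \<integral>\<^sup>+x. second_moment_kernel \<theta> n x \<partial>lborel) \<longlonglongrightarrow> 1"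
proof -
  have "(\<lambda>n. \<integral>\<^sup>+x. second_moment_kernel \<theta> n x \<partial>lborel) \<longlonglongrightarrow>
      (\<integral>\<^sup>+x. ennreal (\<theta> * (1 - x) powr (\<theta> - 1)) * indicator {0<..<1} x \<partial>lborel)"
    by (intro nn_integral_LIMSEQ incseq_second_moment_kernel second_moment_kernel_tendsto \<theta>) measurable
  then show ?thesis using nn_integral_powr_reflect[OF \<theta>, of 1] by simp
qed

lemma sum_indicator_cell:
  fixes h :: "nat \<Rightarrow> ennreal"
  assumes "finite K"
  shows "(\<Sum>j\<in>K. indicator (cell n j) y * h j) = (if 0 < y \<and> cell_index n y \<in> K then h (cell_index n y) else 0)"
proof (cases "0 < y")
  case True
  have "(\<Sum>j\<in>K. indicator (cell n j) y * h j) = (\<Sum>j\<in>K. if j = cell_index n y then h j else 0)"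
    using mem_cell_iff[OF True] by (intro sum.cong) (auto simp: indicator_def)
  also have "\<dots> = (if cell_index n y \<in> K then h (cell_index n y) else 0)"
    using assms by (rule sum.delta)
  finally show ?thesis using True by simp
next
  case False
  then have "indicator (cell n j) y = (0 :: ennreal)" for j using cell_pos[of y n j] by (auto simp: indicator_def)
  then show ?thesis using False by simp
qed

lemma cell_index_pos_le: "0 < x \<Longrightarrow> cell_index n x < 2 ^ n \<Longrightarrow> x \<le> 1"
  using mem_cell_iff[of x n "cell_index n x"] cell_subset_unit[of "cell_index n x" n] by auto

text \<open>At most one i has x in its cell and at most one j has y in its cell. Cell 0, absent from
  J, has left end 0 and hence weight 0, and for x \<ge> 1 both terms vanish.\<close>

lemma second_moment_kernel_eq_cells:
  defines "J \<equiv> \<lambda>n. {1..<2 ^ n :: nat}" and "c \<equiv> \<lambda>n i. ennreal (real i / 2 ^ n)"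
  shows "second_moment_kernel \<theta> n x = (\<Sum>i\<in>J n. indicator (cell n i) x * ((c n i)\<^sup>2 * intensity1 \<theta> x +
      (\<integral>\<^sup>+y. (\<Sum>j\<in>J n - {i}. indicator (cell n j) y * (c n i * c n j * intensity2 \<theta> x y)) \<partial>lborel)))"
    (is "_ = (\<Sum>i\<in>J n. indicator (cell n i) x * ?h i)")
proof -
  let ?i = "cell_index n x"
  have c: "c n (cell_index n y) = ennreal (left_end n y)" for y by (simp add: c_def left_end_def)
  have fin: "finite (J n)" "finite (J n - {i})" for i by (auto simp: J_def)
  have pair: "(\<Sum>j\<in>J n - {?i}. indicator (cell n j) y * (c n ?i * c n j * intensity2 \<theta> x y)) = pair_kernel \<theta> n x y" for y
  proof (cases "0 < y \<and> cell_index n y \<in> J n - {?i}")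
    case True
    then have "y \<le> 1" by (intro cell_index_pos_le[of y n]) (auto simp: J_def)
    moreover have "c n ?i * c n (cell_index n y) = ennreal (left_end n x * left_end n y)"
      unfolding c by (rule ennreal_mult[symmetric]) (simp_all add: left_end_nonneg)
    ultimately show ?thesis using True unfolding sum_indicator_cell[OF fin(2)] pair_kernel_def by auto
  next
    case False
    have "left_end n y = 0" if "0 < y" "y \<le> 1" "?i \<noteq> cell_index n y"
    proof -
      have "cell_index n y < 2 ^ n" using that by (intro cell_index_less)
      then have "cell_index n y = 0" using False that by (auto simp: J_def)
      then show ?thesis by (simp add: left_end_def)
    qed
    then have "pair_kernel \<theta> n x y = 0" by (auto simp: pair_kernel_def)
    then show ?thesis unfolding sum_indicator_cell[OF fin(2)] if_not_P[OF False] by (rule sym)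
  qed
  have hi: "?h ?i = ennreal ((left_end n x)\<^sup>2) * intensity1 \<theta> x + (\<integral>\<^sup>+y. pair_kernel \<theta> n x y \<partial>lborel)"
    unfolding pair unfolding c by (simp add: ennreal_power left_end_nonneg)
  show ?thesis
  proof (cases "0 < x \<and> ?i \<in> J n")
    case True
    then have S: "(\<Sum>i\<in>J n. indicator (cell n i) x * ?h i) = ?h ?i"
      unfolding sum_indicator_cell[OF fin(1)] by simp
    show ?thesis
    proof (cases "x < 1")
      case False
      have "pair_kernel \<theta> n x = (\<lambda>_. 0)" using False by (intro ext) (auto simp: pair_kernel_def intensity2_def)
      moreover have "intensity1 \<theta> x = 0" using False by (simp add: intensity1_def)
      ultimately show ?thesis using False unfolding S hi by (simp add: second_moment_kernel_def)
    qed (use True in \<open>simp add: S hi second_moment_kernel_def\<close>)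
  next
    case False
    then have S: "(\<Sum>i\<in>J n. indicator (cell n i) x * ?h i) = 0"
      unfolding sum_indicator_cell[OF fin(1)] by (rule if_not_P)
    have "left_end n x = 0" if "0 < x" "x < 1"
    proof -
      have "?i < 2 ^ n" using that by (intro cell_index_less) auto
      then have "?i = 0" using False that by (auto simp: J_def)
      then show ?thesis by (simp add: left_end_def)
    qed
    moreover have "pair_kernel \<theta> n x = (\<lambda>_. 0)" if "left_end n x = 0"
      using that by (intro ext) (simp add: pair_kernel_def)
    ultimately have "second_moment_kernel \<theta> n x = 0" by (simp add: second_moment_kernel_def)
    then show ?thesis unfolding S .
  qed
qed

section \<open>Expected second moments of the cell counts\<close>

context PD_process begin

lemma expectation_cell:
  assumes "j \<in> {1..<2 ^ n}"
  shows "(\<integral>\<^sup>+\<omega>. mcount (A \<omega>) (cell n j) \<partial>M) = (\<integral>\<^sup>+x. indicator (cell n j) x * intensity1 \<theta> x \<partial>lborel)"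
proof -
  have "bij_betw (\<lambda>_. j) {..<Suc 0} {j}" by (auto simp: bij_betw_def inj_on_def)
  then show ?thesis
    using cell_moment_eq[of "{j}" n "\<lambda>_. j" "Suc 0"] assms by (simp add: box_intensity_one)
qed

lemma expectation_cell_pair:
  assumes "i \<in> {1..<2 ^ n}" "j \<in> {1..<2 ^ n}" "i \<noteq> j"
  shows "(\<integral>\<^sup>+\<omega>. mcount (A \<omega>) (cell n i) * mcount (A \<omega>) (cell n j) \<partial>M) =
    (\<integral>\<^sup>+x. \<integral>\<^sup>+y. indicator (cell n i) x * (indicator (cell n j) y * intensity2 \<theta> x y) \<partial>lborel \<partial>lborel)"
proof -
  let ?e = "\<lambda>t::nat. if t = 0 then i else j"
  have e: "bij_betw ?e {..<Suc (Suc 0)} {i, j}" using assms(3) by (auto simp: bij_betw_def inj_on_def lessThan_Suc)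
  have "(\<integral>\<^sup>+\<omega>. (\<Prod>j\<in>{i, j}. mcount (A \<omega>) (cell n j)) \<partial>M) = box_intensity \<theta> {..<Suc (Suc 0)} (\<lambda>t. cell n (?e t))"
    by (rule cell_moment_eq[OF _ _ e]) (use assms in auto)
  also have "\<dots> = (\<integral>\<^sup>+x. \<integral>\<^sup>+y. indicator (cell n (?e 0)) x * (indicator (cell n (?e (Suc 0))) y * intensity2 \<theta> x y) \<partial>lborel \<partial>lborel)"
    by (rule box_intensity_two) simp
  finally show ?thesis using assms(3) by simp
qed

text \<open>The integrand is the square of the sum of c N with every diagonal N^2 replaced by N. The
  replacement is forced: the intensities give the mean of a single count and of products over
  different cells, but not directly the mean of N^2.\<close>

lemma expectation_second_moment:
  defines "J \<equiv> \<lambda>n. {1..<2 ^ n :: nat}" and "c \<equiv> \<lambda>n i. ennreal (real i / 2 ^ n)"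
    and "N \<equiv> \<lambda>n i \<omega>. mcount (A \<omega>) (cell n i)"
  shows "(\<integral>\<^sup>+\<omega>. (\<Sum>i\<in>J n. (c n i)\<^sup>2 * N n i \<omega> + (\<Sum>j\<in>J n - {i}. c n i * c n j * (N n i \<omega> * N n j \<omega>))) \<partial>M) =
    (\<integral>\<^sup>+x. second_moment_kernel \<theta> n x \<partial>lborel)" (is "?L = _")
proof -
  let ?E2 = "\<lambda>i j. \<integral>\<^sup>+x. \<integral>\<^sup>+y. indicator (cell n i) x * (indicator (cell n j) y * intensity2 \<theta> x y) \<partial>lborel \<partial>lborel"
  let ?E1 = "\<lambda>i. \<integral>\<^sup>+x. indicator (cell n i) x * intensity1 \<theta> x \<partial>lborel"
  let ?H = "\<lambda>i x. \<integral>\<^sup>+y. (\<Sum>j\<in>J n - {i}. indicator (cell n j) y * (c n i * c n j * intensity2 \<theta> x y)) \<partial>lborel"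
  let ?y = "\<lambda>j x. \<integral>\<^sup>+y. indicator (cell n j) y * intensity2 \<theta> x y \<partial>lborel"
  let ?z = "\<lambda>i j x. \<integral>\<^sup>+y. indicator (cell n i) x * (indicator (cell n j) y * intensity2 \<theta> x y) \<partial>lborel"
  have [measurable]: "N n i \<in> borel_measurable M" if "i \<in> J n" for i
    using that measurable_count_cell by (auto simp: N_def J_def)
  have [measurable]: "N n i \<in> borel_measurable M" if "i \<in> J n - {k}" for i k
    using that measurable_count_cell by (auto simp: N_def J_def)
  have "?L =
    (\<Sum>i\<in>J n. (\<integral>\<^sup>+\<omega>. (c n i)\<^sup>2 * N n i \<omega> \<partial>M) + (\<Sum>j\<in>J n - {i}. \<integral>\<^sup>+\<omega>. c n i * c n j * (N n i \<omega> * N n j \<omega>) \<partial>M))"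
    by (simp add: nn_integral_sum nn_integral_add)
  also have "\<dots> = (\<Sum>i\<in>J n. (c n i)\<^sup>2 * ?E1 i +
     (\<Sum>j\<in>J n - {i}. c n i * c n j * ?E2 i j))"
  proof (intro sum.cong refl arg_cong2[where f="(+)"])
    fix i assume i: "i \<in> J n"
    then show "(\<integral>\<^sup>+\<omega>. (c n i)\<^sup>2 * N n i \<omega> \<partial>M) = (c n i)\<^sup>2 * ?E1 i"
      using expectation_cell[of i n] by (simp add: nn_integral_cmult N_def J_def measurable_count_cell)
    fix j assume j: "j \<in> J n - {i}"
    with i have "(\<integral>\<^sup>+\<omega>. N n i \<omega> * N n j \<omega> \<partial>M) =
       ?E2 i j"
      unfolding N_def by (intro expectation_cell_pair) (auto simp: J_def)
    then show "(\<integral>\<^sup>+\<omega>. c n i * c n j * (N n i \<omega> * N n j \<omega>) \<partial>M) =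
       c n i * c n j * ?E2 i j"
      using i j by (subst nn_integral_cmult) auto
  qed
  also have "\<dots> = (\<Sum>i\<in>J n. \<integral>\<^sup>+x. indicator (cell n i) x * ((c n i)\<^sup>2 * intensity1 \<theta> x +
      ?H i x) \<partial>lborel)"
  proof (intro sum.cong refl)
    fix i
    have "(\<integral>\<^sup>+x. indicator (cell n i) x * ((c n i)\<^sup>2 * intensity1 \<theta> x +
        ?H i x) \<partial>lborel) =
      (\<integral>\<^sup>+x. (c n i)\<^sup>2 * (indicator (cell n i) x * intensity1 \<theta> x) +
        (\<Sum>j\<in>J n - {i}. c n i * c n j * ?z i j x) \<partial>lborel)"
    proof (intro nn_integral_cong)
      fix x :: real
      have "?H i x =
        (\<Sum>j\<in>J n - {i}. \<integral>\<^sup>+y. c n i * c n j * (indicator (cell n j) y * intensity2 \<theta> x y) \<partial>lborel)"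
        by (subst nn_integral_sum) (simp_all add: mult_ac)
      also have "\<dots> = (\<Sum>j\<in>J n - {i}. c n i * c n j * ?y j x)"
        by (intro sum.cong refl nn_integral_cmult) measurable
      finally have *: "?H i x = \<dots>" .
      have **: "?z i j x =
        indicator (cell n i) x * ?y j x" for j
        by (rule nn_integral_cmult) measurable
      show "indicator (cell n i) x * ((c n i)\<^sup>2 * intensity1 \<theta> x +
        ?H i x) =
        (c n i)\<^sup>2 * (indicator (cell n i) x * intensity1 \<theta> x) +
        (\<Sum>j\<in>J n - {i}. c n i * c n j * ?z i j x)"
        unfolding * ** by (simp add: indicator_def)
    qed
    also have "\<dots> = (c n i)\<^sup>2 * ?E1 i +
      (\<Sum>j\<in>J n - {i}. c n i * c n j * ?E2 i j)"
      by (simp add: nn_integral_add nn_integral_sum nn_integral_cmult)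
    finally show "(c n i)\<^sup>2 * ?E1 i +
      (\<Sum>j\<in>J n - {i}. c n i * c n j * ?E2 i j) =
      (\<integral>\<^sup>+x. indicator (cell n i) x * ((c n i)\<^sup>2 * intensity1 \<theta> x +
      ?H i x) \<partial>lborel)" by (rule sym)
  qed
  also have "\<dots> = (\<integral>\<^sup>+x. second_moment_kernel \<theta> n x \<partial>lborel)"
    unfolding second_moment_kernel_eq_cells J_def c_def
    by (rule nn_integral_sum[symmetric]) measurable
  finally show ?thesis .
qed

end

lemma sum_power2_split_diagonal:
  fixes a :: "'i \<Rightarrow> 'a :: comm_semiring_1"
  assumes "finite J"
  shows "(\<Sum>i\<in>J. a i)\<^sup>2 = (\<Sum>i\<in>J. (a i)\<^sup>2 + (\<Sum>j\<in>J - {i}. a i * a j))"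
proof -
  have "(\<Sum>i\<in>J. a i)\<^sup>2 = (\<Sum>i\<in>J. \<Sum>j\<in>J. a i * a j)"
    by (simp add: power2_eq_square sum_product)
  also have "\<dots> = (\<Sum>i\<in>J. (a i)\<^sup>2 + (\<Sum>j\<in>J - {i}. a i * a j))"
    using assms by (intro sum.cong refl) (simp add: sum.remove power2_eq_square)
  finally show ?thesis .
qed

lemma sum_cells_le_msum:
  "(\<Sum>i\<in>{1..<2 ^ n}. ennreal (real i / 2 ^ n) * mcount m (cell n i)) \<le> msum m"
proof -
  let ?d = "\<lambda>u. \<Sum>i\<in>{1..<2 ^ n}. ennreal (real i / 2 ^ n) * indicator (cell n i) u"
  have "(\<Sum>i\<in>{1..<2 ^ n}. ennreal (real i / 2 ^ n) * mcount m (cell n i)) =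
    (\<integral>\<^sup>+u. ?d u \<partial>count_measure m)"
    by (subst nn_integral_sum) (simp_all add: mcount_eq_emeasure nn_integral_cmult_indicator count_measure_def)
  also have "\<dots> \<le> msum m"
    unfolding msum_eq
  proof (intro nn_integral_mono)
    fix u :: real
    have "?d u =
      (\<Sum>i\<in>{1..<2 ^ n}. indicator (cell n i) u * ennreal (real i / 2 ^ n))"
      by (simp only: mult.commute)
    also have "\<dots> = (if 0 < u \<and> cell_index n u \<in> {1..<2 ^ n} then ennreal (left_end n u) else 0)"
      by (subst sum_indicator_cell) (simp_all add: left_end_def)
    also have "\<dots> \<le> ennreal u * indicator {0<..1} u"
    proof (cases "0 < u \<and> cell_index n u \<in> {1..<2 ^ n}")
      case True
      then have "u \<le> 1" by (intro cell_index_pos_le[of u n]) auto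
      moreover have "left_end n u \<le> u" using left_end_bounds(1)[of u n] True by simp
      ultimately show ?thesis using True by (simp add: ennreal_leI)
    next
      case False
      show ?thesis unfolding if_not_P[OF False] by simp
    qed
    finally show "?d u \<le> ennreal u * indicator {0<..1} u" .
  qed
  finally show ?thesis .
qed

text \<open>The square of the sum of c N is at most 1. Replacing N^2 by N on the diagonal never
  increases it, as counts are integers, and for a cell with N \<ge> 2 it loses at least the squared
  weight, since N^2 \<ge> N + 1. From index 2^k on the weight is at least 2^k / 2^(r+k) =
  2^-r.\<close>

lemma double_point_excess:
  fixes r k :: nat and m :: "real \<Rightarrow> nat"
  defines "n \<equiv> r + k"
  defines "J \<equiv> {1..<2 ^ n :: nat}" and "c \<equiv> \<lambda>i. ennreal (real i / 2 ^ n)" and "N \<equiv> \<lambda>i. mcount m (cell n i)"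
  assumes m: "msum m \<le> 1"
  shows "ennreal ((1 / 2 ^ r)\<^sup>2) * (if \<exists>j\<in>{2 ^ k..<2 ^ n}. \<not> N j \<le> 1 then 1 else 0) +
     (\<Sum>i\<in>J. (c i)\<^sup>2 * N i + (\<Sum>j\<in>J - {i}. c i * c j * (N i * N j))) \<le> 1"
proof -
  have fin: "finite J" by (simp add: J_def)
  let ?d = "\<lambda>i. c i * N i"
  have "(\<Sum>i\<in>J. ?d i) \<le> 1"
    using sum_cells_le_msum[of n m] m unfolding J_def c_def N_def by (rule order_trans)
  then have "(\<Sum>i\<in>J. ?d i)\<^sup>2 \<le> 1" by (simp add: power_le_one)
  then have le1: "(\<Sum>i\<in>J. (?d i)\<^sup>2 + (\<Sum>j\<in>J - {i}. ?d i * ?d j)) \<le> 1"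
    using sum_power2_split_diagonal[OF fin, of ?d] by simp
  have N2: "N i \<le> N i * N i" for i
    using mcount_zero_or_ge_one[of m "cell n i"] mult_right_mono[of 1 "N i" "N i"] by (auto simp: N_def)
  have sq: "(c i)\<^sup>2 * N i \<le> (?d i)\<^sup>2" for i
    using mult_left_mono[OF N2, of "(c i)\<^sup>2" i] by (simp add: power2_eq_square mult_ac)
  have cross: "c i * c j * (N i * N j) = ?d i * ?d j" for i j by (simp add: mult_ac)
  show ?thesis
  proof (cases "\<exists>j\<in>{2 ^ k..<2 ^ n}. \<not> N j \<le> 1")
    case False
    have "(\<Sum>i\<in>J. (c i)\<^sup>2 * N i + (\<Sum>j\<in>J - {i}. c i * c j * (N i * N j))) \<le> 1"
      unfolding cross by (rule order_trans[OF _ le1]) (intro sum_mono add_mono sq order_refl)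
    then show ?thesis unfolding if_not_P[OF False] by simp
  next
    case True
    then obtain i where i: "2 ^ k \<le> i" "i < 2 ^ n" "\<not> N i \<le> 1" by auto
    have "(1 :: nat) \<le> 2 ^ k" by simp
    then have "1 \<le> i" using i(1) by (rule order_trans)
    then have iJ: "i \<in> J" using i(2) by (simp add: J_def)
    have "2 \<le> N i" using i(3) mcount_le_one_or_ge_two[of m "cell n i"] by (auto simp: N_def)
    have "N i + 1 \<le> N i * N i"
    proof -
      have "1 \<le> N i" using mcount_zero_or_ge_one[of m "cell n i"] i(3) by (auto simp: N_def)
      then have "N i + 1 \<le> N i + N i" by (rule add_left_mono)
      also have "\<dots> = 2 * N i" by (simp only: mult_2)
      also have "\<dots> \<le> N i * N i" using \<open>2 \<le> N i\<close> by (rule mult_right_mono) simp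
      finally show ?thesis .
    qed
    then have "(c i)\<^sup>2 * (N i + 1) \<le> (c i)\<^sup>2 * (N i * N i)" by (rule mult_left_mono) simp
    then have d: "(c i)\<^sup>2 * N i + (c i)\<^sup>2 \<le> (?d i)\<^sup>2" by (simp add: distrib_left power2_eq_square mult_ac)
    have "real (2 ^ k) \<le> real i" using i(1) by (simp only: of_nat_le_iff)
    then have "2 ^ k / 2 ^ n \<le> real i / 2 ^ n" by (intro divide_right_mono) auto
    moreover have "(2::real) ^ k / 2 ^ n = 1 / 2 ^ r" by (simp add: n_def power_add)
    ultimately have "(1 / 2 ^ r)\<^sup>2 \<le> (real i / 2 ^ n)\<^sup>2" by (intro power_mono) auto
    then have cr: "ennreal ((1 / 2 ^ r)\<^sup>2) \<le> (c i)\<^sup>2"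
      unfolding c_def by (subst ennreal_power) (auto intro: ennreal_leI)
    let ?s = "\<lambda>i. (c i)\<^sup>2 * N i + (\<Sum>j\<in>J - {i}. ?d i * ?d j)"
    let ?t = "\<lambda>i. (?d i)\<^sup>2 + (\<Sum>j\<in>J - {i}. ?d i * ?d j)"
    have "ennreal ((1 / 2 ^ r)\<^sup>2) + (\<Sum>i\<in>J. ?s i) = (ennreal ((1 / 2 ^ r)\<^sup>2) + ?s i) + (\<Sum>i\<in>J - {i}. ?s i)"
      using fin iJ by (simp add: sum.remove add.assoc)
    also have "\<dots> \<le> ?t i + (\<Sum>i\<in>J - {i}. ?t i)"
    proof (rule add_mono)
      show "(\<Sum>i\<in>J - {i}. ?s i) \<le> (\<Sum>i\<in>J - {i}. ?t i)"
        by (intro sum_mono add_mono sq order_refl)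
      have "ennreal ((1 / 2 ^ r)\<^sup>2) + (c i)\<^sup>2 * N i \<le> (c i)\<^sup>2 + (c i)\<^sup>2 * N i" using cr by (rule add_right_mono)
      also have "\<dots> \<le> (?d i)\<^sup>2" using d by (simp only: add.commute)
      finally show "ennreal ((1 / 2 ^ r)\<^sup>2) + ?s i \<le> ?t i" unfolding add.assoc[symmetric] by (rule add_right_mono)
    qed
    also have "\<dots> = (\<Sum>i\<in>J. ?t i)" using fin iJ by (simp add: sum.remove)
    also have "\<dots> \<le> 1" by (rule le1)
    finally show ?thesis unfolding cross if_P[OF True] by simp
  qed
qed

abbreviation ennreal_vectors :: "nat \<Rightarrow> (nat \<Rightarrow> ennreal) measure" where
  "ennreal_vectors k \<equiv> Pi\<^sub>M {..<k} (\<lambda>_. borel)"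

abbreviation counts :: "nat \<Rightarrow> (nat \<Rightarrow> real set) \<Rightarrow> (real \<Rightarrow> nat) \<Rightarrow> nat \<Rightarrow> ennreal" where
  "counts k S m \<equiv> \<lambda>i\<in>{..<k}. mcount m (S i)"

context PD_process begin

text \<open>Let B be the event that every level has a crowded cell beyond 2^-r. Taking expectations
  in \<open>double_point_excess\<close> bounds a fixed positive multiple of the probability of B,
  plus a term tending to 1 by \<open>second_moment_total\<close>, by 1. Hence B is null.\<close>

lemma AE_simple_locally_finite: "AE \<omega> in M. simple_locally_finite (A \<omega>)"
proof (rule AE_simple_locally_finiteI)
  fix r :: nat
  let ?P = "\<lambda>k \<omega>. \<exists>j\<in>{2 ^ k..<2 ^ (r + k)}. \<not> mcount (A \<omega>) (cell (r + k) j) \<le> 1"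
  let ?B = "{\<omega> \<in> space M. \<forall>k. ?P k \<omega>}"
  let ?\<kappa> = "ennreal ((1 / 2 ^ r)\<^sup>2)"
  let ?Q = "\<lambda>n. \<integral>\<^sup>+x. second_moment_kernel \<theta> n x \<partial>lborel"
  have P[measurable]: "Measurable.pred M (?P k)" for k
  proof -
    have [measurable]: "(\<lambda>\<omega>. mcount (A \<omega>) (cell (r + k) j)) \<in> borel_measurable M" if "j \<in> {2 ^ k..<2 ^ (r + k)}" for j
      using that by (intro measurable_count_cell) auto
    show ?thesis by (intro pred_intros_finite pred_intros_logic) auto
  qed
  have B: "?B \<in> sets M" by measurable
  have "?\<kappa> * emeasure M ?B + ?Q (r + k) \<le> 1" for k
  proof -
    let ?n = "r + k"
    let ?J = "{1..<2 ^ ?n :: nat}"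
    let ?c = "\<lambda>i. ennreal (real i / 2 ^ ?n)"
    let ?N = "\<lambda>i \<omega>. mcount (A \<omega>) (cell ?n i)"
    let ?S = "\<lambda>\<omega>. \<Sum>i\<in>?J. (?c i)\<^sup>2 * ?N i \<omega> + (\<Sum>j\<in>?J - {i}. ?c i * ?c j * (?N i \<omega> * ?N j \<omega>))"
    have N: "?N i \<in> borel_measurable M" if "i \<in> ?J" for i
      using that by (intro measurable_count_cell) auto
    have S: "?S \<in> borel_measurable M"
      by (intro borel_measurable_sum borel_measurable_add borel_measurable_times_ennreal borel_measurable_const N) auto
    have "?\<kappa> * emeasure M ?B + ?Q ?n = (\<integral>\<^sup>+\<omega>. ?\<kappa> * indicator ?B \<omega> \<partial>M) + (\<integral>\<^sup>+\<omega>. ?S \<omega> \<partial>M)"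
      unfolding expectation_second_moment[of ?n] using B by (simp add: nn_integral_cmult_indicator)
    also have "\<dots> = (\<integral>\<^sup>+\<omega>. ?\<kappa> * indicator ?B \<omega> + ?S \<omega> \<partial>M)"
      using B S by (intro nn_integral_add[symmetric]) auto
    also have "\<dots> \<le> (\<integral>\<^sup>+\<omega>. 1 \<partial>M)"
    proof (intro nn_integral_mono_AE, use AE_msum in eventually_elim)
      case (elim \<omega>)
      have "?\<kappa> * indicator ?B \<omega> \<le> ?\<kappa> * (if ?P k \<omega> then 1 else 0)"
        by (intro mult_left_mono) (auto simp: indicator_def)
      then have "?\<kappa> * indicator ?B \<omega> + ?S \<omega> \<le> ?\<kappa> * (if ?P k \<omega> then 1 else 0) + ?S \<omega>"
        by (rule add_right_mono)
      also have "\<dots> \<le> 1" by (rule double_point_excess[OF elim])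
      finally show ?case .
    qed
    also have "\<dots> = 1" by (simp add: emeasure_space_1)
    finally show ?thesis .
  qed
  moreover have "(\<lambda>k. ?\<kappa> * emeasure M ?B + ?Q (r + k)) \<longlonglongrightarrow> ?\<kappa> * emeasure M ?B + 1"
    using LIMSEQ_ignore_initial_segment[OF second_moment_total[OF \<theta>], of r]
    by (intro tendsto_add tendsto_const) (simp add: add.commute)
  ultimately have "?\<kappa> * emeasure M ?B + 1 \<le> 1" by (intro LIMSEQ_le_const2) auto
  then have "?\<kappa> * emeasure M ?B = 0"
    using ennreal_add_left_cancel_le[of 1 "?\<kappa> * emeasure M ?B" 0] by (simp add: add.commute)
  then have "emeasure M ?B = 0" by (simp add: zero_less_power)
  then have "AE \<omega> in M. \<not> (\<forall>k. ?P k \<omega>)" using B by (subst AE_iff_measurable[OF B]) auto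
  then show "AE \<omega> in M. \<exists>k. \<forall>j\<in>{2 ^ k..<2 ^ (r + k)}. mcount (A \<omega>) (cell (r + k) j) \<le> 1"
    by (rule eventually_mono) blast
qed

text \<open>Real-valued because the factors 1 - N may be negative. \<open>enn2real\<close> turns an
  infinite count into 0, but for the cells other than 0 this happens only on a null set, by
  \<open>AE_cell_count\<close>.\<close>

definition cell_count :: "nat \<Rightarrow> nat \<Rightarrow> 'w \<Rightarrow> real" where
  "cell_count n j \<omega> = enn2real (mcount (A \<omega>) (cell n j))"

abbreviation cell_product :: "nat \<Rightarrow> nat set \<Rightarrow> 'w \<Rightarrow> real" where
  "cell_product n K \<omega> \<equiv> \<Prod>j\<in>K. cell_count n j \<omega>"

lemma cell_count_nonneg: "0 \<le> cell_count n j \<omega>"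
  by (simp add: cell_count_def)

lemma measurable_cell_count:
  "j \<in> {1..<2 ^ n} \<Longrightarrow> cell_count n j \<in> borel_measurable M"
  unfolding cell_count_def by (intro borel_measurable_enn2real measurable_count_cell) auto

lemma AE_count_union:
  "AE \<omega> in M. \<forall>n. \<forall>J\<subseteq>{1..<2 ^ n}. mcount (A \<omega>) (cell_union n J) \<le> 2 ^ n"
  using AE_count_tail
proof eventually_elim
  case (elim \<omega>)
  show ?case
  proof (intro allI impI)
    fix n J assume "J \<subseteq> {1..<2 ^ n :: nat}"
    then have "mcount (A \<omega>) (cell_union n J) \<le> mcount (A \<omega>) {1 / 2 ^ n<..1}"
      by (intro mcount_mono cell_union_subset_tail)
    with elim show "mcount (A \<omega>) (cell_union n J) \<le> 2 ^ n" by (meson order_trans)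
  qed
qed

lemma AE_cell_count:
  "AE \<omega> in M. \<forall>n. \<forall>j\<in>{1..<2 ^ n}. ennreal (cell_count n j \<omega>) = mcount (A \<omega>) (cell n j) \<and> cell_count n j \<omega> \<le> 2 ^ n"
  using AE_count_union
proof eventually_elim
  case (elim \<omega>)
  show ?case
  proof (intro allI ballI)
    fix n j assume "j \<in> {1..<2 ^ n :: nat}"
    then have "{j} \<subseteq> {1..<2 ^ n}" by simp
    with elim have "mcount (A \<omega>) (cell_union n {j}) \<le> 2 ^ n" by blast
    then have le: "mcount (A \<omega>) (cell n j) \<le> ennreal (2 ^ n)" by (simp add: cell_union_def ennreal_power[symmetric])
    then have "mcount (A \<omega>) (cell n j) < top" by (rule le_less_trans) simp
    then have eq: "ennreal (cell_count n j \<omega>) = mcount (A \<omega>) (cell n j)" by (simp add: cell_count_def)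
    moreover from le have "cell_count n j \<omega> \<le> 2 ^ n" unfolding eq[symmetric] by (simp add: ennreal_le_iff)
    ultimately show "ennreal (cell_count n j \<omega>) = mcount (A \<omega>) (cell n j) \<and> cell_count n j \<omega> \<le> 2 ^ n" ..
  qed
qed

text \<open>Counts away from cell 0 are almost surely at most 2^n, so all products are integrable
  and the signed expansion below can be integrated term by term.\<close>

lemma expectation_prod_cell_count:
  assumes K: "K \<subseteq> {1..<2 ^ n}"
  shows "integrable M (cell_product n K)"
    and "(\<integral>\<omega>. cell_product n K \<omega> \<partial>M) = enn2real (cell_moment n K)" (is "?L = _")
proof -
  have m: "(cell_product n K) \<in> borel_measurable M"
    using K by (intro borel_measurable_prod measurable_cell_count) auto
  have "AE \<omega> in M. norm (cell_product n K \<omega>) \<le> (2 ^ n) ^ card K"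
    using AE_cell_count
  proof eventually_elim
    case (elim \<omega>)
    have "cell_product n K \<omega> \<le> (\<Prod>j\<in>K. 2 ^ n)"
    proof (rule prod_mono)
      fix j assume "j \<in> K"
      then have "j \<in> {1..<2 ^ n}" using K by blast
      with elim show "0 \<le> cell_count n j \<omega> \<and> cell_count n j \<omega> \<le> 2 ^ n" by (simp add: cell_count_nonneg)
    qed
    moreover have "0 \<le> cell_product n K \<omega>" by (intro prod_nonneg cell_count_nonneg)
    ultimately show ?case by simp
  qed
  with m show "integrable M (cell_product n K)" by (intro integrable_const_bound)
  have "?L = enn2real (\<integral>\<^sup>+\<omega>. ennreal (cell_product n K \<omega>) \<partial>M)"
    using m by (intro integral_eq_nn_integral AE_I2 prod_nonneg cell_count_nonneg)
  also have "(\<integral>\<^sup>+\<omega>. ennreal (cell_product n K \<omega>) \<partial>M) = cell_moment n K"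
  proof (intro nn_integral_cong_AE, use AE_cell_count in eventually_elim)
    case (elim \<omega>)
    have "ennreal (cell_product n K \<omega>) = (\<Prod>j\<in>K. ennreal (cell_count n j \<omega>))"
      by (intro prod_ennreal[symmetric] cell_count_nonneg)
    also have "\<dots> = (\<Prod>j\<in>K. mcount (A \<omega>) (cell n j))"
    proof (rule prod.cong[OF refl])
      fix j assume "j \<in> K"
      then have "j \<in> {1..<2 ^ n}" using K by blast
      with elim show "ennreal (cell_count n j \<omega>) = mcount (A \<omega>) (cell n j)" by blast
    qed
    finally show ?case .
  qed
  finally show "(\<integral>\<omega>. cell_product n K \<omega> \<partial>M) = enn2real (cell_moment n K)" .
qed

lemma expectation_void_product:
  assumes J: "J \<subseteq> {1..<2 ^ n}"
  shows "(\<integral>\<omega>. (\<Prod>j\<in>J. 1 - cell_count n j \<omega>) \<partial>M) =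
    (\<Sum>K\<in>Pow J. (-1) ^ card K * enn2real (cell_moment n K))" (is "?L = _")
proof -
  have fin: "finite J" using J by (rule finite_subset) simp
  have "(\<Prod>j\<in>J. 1 - cell_count n j \<omega>) = (\<Sum>K\<in>Pow J. (-1) ^ card K * cell_product n K \<omega>)" for \<omega>
  proof -
    have "(\<Prod>j\<in>J. 1 - cell_count n j \<omega>) = (\<Prod>j\<in>J. (- 1) * cell_count n j \<omega> + 1)"
      by (intro prod.cong) auto
    also have "\<dots> = (\<Sum>K\<in>Pow J. (\<Prod>j\<in>K. (- 1) * cell_count n j \<omega>) * (\<Prod>j\<in>J - K. 1))"
      by (rule prod_add[OF fin])
    also have "\<dots> = (\<Sum>K\<in>Pow J. (-1) ^ card K * cell_product n K \<omega>)"
      unfolding prod.distrib by simp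
    finally show ?thesis .
  qed
  then have "?L =
    (\<integral>\<omega>. (\<Sum>K\<in>Pow J. (-1) ^ card K * cell_product n K \<omega>) \<partial>M)" by (simp only:)
  also have "\<dots> = (\<Sum>K\<in>Pow J. \<integral>\<omega>. (-1) ^ card K * cell_product n K \<omega> \<partial>M)"
  proof (rule Bochner_Integration.integral_sum)
    fix K assume "K \<in> Pow J"
    then have "K \<subseteq> {1..<2 ^ n}" using J by blast
    then show "integrable M (\<lambda>\<omega>. (-1) ^ card K * cell_product n K \<omega>)"
      by (intro integrable_mult_right expectation_prod_cell_count(1))
  qed
  also have "\<dots> = (\<Sum>K\<in>Pow J. (-1) ^ card K * enn2real (cell_moment n K))"
  proof (rule sum.cong[OF refl])
    fix K assume "K \<in> Pow J"
    then have K: "K \<subseteq> {1..<2 ^ n}" using J by blast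
    show "(\<integral>\<omega>. (-1) ^ card K * cell_product n K \<omega> \<partial>M) =
      (-1) ^ card K * enn2real (cell_moment n K)"
      unfolding expectation_prod_cell_count(2)[OF K, symmetric] by (rule integral_mult_right_zero)
  qed
  finally show ?thesis .
qed

abbreviation void_event :: "nat \<Rightarrow> nat set \<Rightarrow> 'w set" where
  "void_event n J \<equiv> {\<omega> \<in> space M. mcount (A \<omega>) (cell_union n J) = 0}"

text \<open>On a simple configuration the product over a fine enough partition is the indicator of having
  no point.\<close>

lemma void_probability_limit:
  assumes J: "J \<subseteq> {1..<2 ^ n}"
  shows "(\<lambda>k. \<integral>\<omega>. (\<Prod>i\<in>refine n k J. 1 - cell_count (n + k) i \<omega>) \<partial>M) \<longlonglongrightarrow>
    prob (void_event n J)"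
proof -
  let ?V = "void_event n J"
  let ?s = "\<lambda>k \<omega>. \<Prod>i\<in>refine n k J. 1 - cell_count (n + k) i \<omega>"
  have R: "i \<in> {1..<2 ^ (n + k)}" if "i \<in> refine n k J" for i k
    using refine_subset'[OF J, of k] that by blast
  have "(\<lambda>\<omega>. mcount (A \<omega>) (cell_union n J)) \<in> borel_measurable M"
    using J by (intro measurable_count cell_union_borel cell_union_subset_unit)
  then have V: "?V \<in> sets M" by measurable
  have "(\<lambda>k. \<integral>\<omega>. ?s k \<omega> \<partial>M) \<longlonglongrightarrow> (\<integral>\<omega>. indicator ?V \<omega> \<partial>M)"
  proof (rule integral_dominated_convergence)
    show "(\<lambda>\<omega>. indicator ?V \<omega> :: real) \<in> borel_measurable M" using V by simp
    show "?s k \<in> borel_measurable M" for k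
      using R by (intro borel_measurable_prod borel_measurable_diff borel_measurable_const measurable_cell_count)
    show "integrable M (\<lambda>\<omega>. exp (2 ^ n :: real))" by simp
    \<comment> \<open>Since |1 - N| \<le> 1 + N \<le> exp N, the product is at most exp of the count
      of the whole union. That count does not depend on k and is almost surely at most 2^n.\<close>
    show "AE \<omega> in M. norm (?s k \<omega>) \<le> exp (2 ^ n)" for k
      using AE_cell_count AE_count_union
    proof eventually_elim
      case (elim \<omega>)
      have "ennreal (\<Sum>i\<in>refine n k J. cell_count (n + k) i \<omega>) = (\<Sum>i\<in>refine n k J. ennreal (cell_count (n + k) i \<omega>))"
        by (rule sum_ennreal[symmetric]) (rule cell_count_nonneg)
      also have "\<dots> = (\<Sum>i\<in>refine n k J. mcount (A \<omega>) (cell (n + k) i))"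
        using elim(1) R by (intro sum.cong refl) blast
      also have "\<dots> = mcount (A \<omega>) (cell_union n J)" by (rule mcount_cell_union[OF J, symmetric])
      also have "\<dots> \<le> 2 ^ n" using elim(2) J by blast
      also have "\<dots> = ennreal (2 ^ n)" by (simp add: ennreal_power[symmetric])
      finally have le: "(\<Sum>i\<in>refine n k J. cell_count (n + k) i \<omega>) \<le> 2 ^ n" by (simp add: ennreal_le_iff)
      have "norm (?s k \<omega>) = (\<Prod>i\<in>refine n k J. \<bar>1 - cell_count (n + k) i \<omega>\<bar>)"
        by (simp add: abs_prod)
      also have "\<dots> \<le> (\<Prod>i\<in>refine n k J. exp (cell_count (n + k) i \<omega>))"
      proof (intro prod_mono conjI)
        fix i
        have "\<bar>1 - cell_count (n + k) i \<omega>\<bar> \<le> 1 + cell_count (n + k) i \<omega>"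
          using cell_count_nonneg[of "n + k" i \<omega>] by linarith
        also have "\<dots> \<le> exp (cell_count (n + k) i \<omega>)" by (rule exp_ge_add_one_self)
        finally show "\<bar>1 - cell_count (n + k) i \<omega>\<bar> \<le> exp (cell_count (n + k) i \<omega>)" .
      qed simp
      also have "\<dots> = exp (\<Sum>i\<in>refine n k J. cell_count (n + k) i \<omega>)"
        by (rule exp_sum[OF finite_refine[OF J], symmetric])
      also have "\<dots> \<le> exp (2 ^ n)" using le by simp
      finally show ?case .
    qed
    show "AE \<omega> in M. (\<lambda>k. ?s k \<omega>) \<longlonglongrightarrow> indicator ?V \<omega>"
      using AE_simple_locally_finite AE_space
    proof eventually_elim
      case (elim \<omega>)
      have "eventually (\<lambda>k. ?s k \<omega> = indicator ?V \<omega>) sequentially"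
        using eventually_simple_cells[OF elim(1) J]
      proof eventually_elim
        case (elim k)
        have fin: "finite (refine n k J)" by (rule finite_refine[OF J])
        have sum: "mcount (A \<omega>) (cell_union n J) = (\<Sum>i\<in>refine n k J. mcount (A \<omega>) (cell (n + k) i))"
          by (rule mcount_cell_union[OF J])
        show ?case
        proof (cases "mcount (A \<omega>) (cell_union n J) = 0")
          case True
          then have "mcount (A \<omega>) (cell (n + k) i) = 0" if "i \<in> refine n k J" for i
            using that fin unfolding sum by simp
          then have "?s k \<omega> = 1" by (intro prod.neutral) (simp add: cell_count_def)
          then show ?thesis using True \<open>\<omega> \<in> space M\<close> by simp
        next
          case False
          then obtain i where i: "i \<in> refine n k J" "mcount (A \<omega>) (cell (n + k) i) \<noteq> 0"
            unfolding sum using fin by (metis sum.neutral)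
          then have "mcount (A \<omega>) (cell (n + k) i) = 1" using elim by blast
          then have "1 - cell_count (n + k) i \<omega> = 0" by (simp add: cell_count_def)
          then have "?s k \<omega> = 0" using i(1) fin by (intro prod_zero) blast+
          then show ?thesis using False by simp
        qed
      qed
      then show ?case by (rule tendsto_eventually)
    qed
  qed
  also have "(\<integral>\<omega>. indicator ?V \<omega> \<partial>M) = prob ?V" using V by simp
  finally show ?thesis .
qed

text \<open>The empty configuration replaces A on the exceptional null set, so that the map takes
  values in \<open>void_space\<close> everywhere and not only almost surely.\<close>

definition simple_version :: "'w \<Rightarrow> real \<Rightarrow> nat" where
  "simple_version \<omega> = (if simple_locally_finite (A \<omega>) then A \<omega> else (\<lambda>_. 0))"

lemma simple_locally_finite_simple_version: "simple_locally_finite (simple_version \<omega>)"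
proof -
  have "mcount (\<lambda>_. 0) S = 0" for S by (simp add: mcount_def)
  then show ?thesis by (simp add: simple_version_def simple_locally_finite_def)
qed

lemma AE_simple_version: "AE \<omega> in M. simple_version \<omega> = A \<omega>"
  using AE_simple_locally_finite by (rule eventually_mono) (simp add: simple_version_def)

lemma measurable_simple_version[measurable]: "simple_version \<in> M \<rightarrow>\<^sub>M void_space"
  unfolding void_space_def
proof (rule measurable_measure_of[OF void_sets_Pow])
  show "simple_version \<in> space M \<rightarrow> {m. simple_locally_finite m}"
    using simple_locally_finite_simple_version by auto
  have tail: "(\<lambda>\<omega>. mcount (A \<omega>) {1 / 2 ^ r<..1}) \<in> borel_measurable M" for r :: nat
  proof (rule measurable_count)
    have "{c<..1::real} \<subseteq> {0<..1}" if "0 < c" for c using that by auto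
    then show "{1 / 2 ^ r<..1::real} \<subseteq> {0<..1}" by simp
  qed simp
  have cells: "Measurable.pred M (\<lambda>\<omega>. \<forall>j\<in>{2 ^ k..<2 ^ (r + k)}. mcount (A \<omega>) (cell (r + k) j) \<le> 1)" for r k :: nat
  proof (rule pred_intros_finite(3))
    fix j :: nat assume "j \<in> {2 ^ k..<2 ^ (r + k)}"
    then have [measurable]: "(\<lambda>\<omega>. mcount (A \<omega>) (cell (r + k) j)) \<in> borel_measurable M"
      by (intro measurable_count_cell) auto
    show "Measurable.pred M (\<lambda>\<omega>. mcount (A \<omega>) (cell (r + k) j) \<le> 1)" by measurable
  qed simp
  have slf: "Measurable.pred M (\<lambda>\<omega>. simple_locally_finite (A \<omega>))"
    unfolding simple_locally_finite_def using tail cells by measurable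
  fix V assume "V \<in> void_sets"
  then obtain n J where V: "V = void_set (n, J)" "J \<subseteq> {1..<2 ^ n}" by (auto simp: void_sets_def)
  have [measurable]: "(\<lambda>\<omega>. mcount (A \<omega>) (cell_union n J)) \<in> borel_measurable M"
    using V by (intro measurable_count cell_union_borel cell_union_subset_unit)
  \<comment> \<open>An implication and not a conjunction: the empty configuration, used where A is
    not simple, is void on every set.\<close>
  let ?V = "{\<omega> \<in> space M. simple_locally_finite (A \<omega>) \<longrightarrow> mcount (A \<omega>) (cell_union n J) = 0}"
  have "?V \<in> sets M"
    using slf by measurable
  also have "?V =
    simple_version -` V \<inter> space M"
  proof (intro set_eqI)
    fix \<omega>
    have "mcount (\<lambda>_. 0) S = 0" for S by (simp add: mcount_def)
    then show "\<omega> \<in> ?V \<longleftrightarrow>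
      \<omega> \<in> simple_version -` V \<inter> space M"
      using simple_locally_finite_simple_version[of \<omega>]
      by (cases "simple_locally_finite (A \<omega>)") (auto simp: V void_set_def simple_version_def)
  qed
  finally show "simple_version -` V \<inter> space M \<in> sets M" .
qed

lemma emeasure_law_void:
  assumes J: "J \<subseteq> {1..<2 ^ n}"
  shows "emeasure (distr M void_space simple_version) (void_set (n, J)) =
    ennreal (prob (void_event n J))"
proof -
  have V: "void_set (n, J) \<in> sets void_space"
    using J unfolding sets_void_space void_sets_def by (intro sigma_sets.Basic) blast
  have "(\<lambda>\<omega>. mcount (A \<omega>) (cell_union n J)) \<in> borel_measurable M"
    using J by (intro measurable_count cell_union_borel cell_union_subset_unit)
  then have B: "(void_event n J) \<in> sets M" by measurable
  have "emeasure (distr M void_space simple_version) (void_set (n, J)) = emeasure M (simple_version -` void_set (n, J) \<inter> space M)"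
    using V by (intro emeasure_distr) measurable
  also have "\<dots> = emeasure M (void_event n J)"
  proof (rule emeasure_eq_AE)
    show "AE \<omega> in M. \<omega> \<in> simple_version -` void_set (n, J) \<inter> space M \<longleftrightarrow> \<omega> \<in> (void_event n J)"
      using AE_simple_version
    proof eventually_elim
      case (elim \<omega>)
      then show ?case using simple_locally_finite_simple_version[of \<omega>] by (auto simp: void_set_def)
    qed
  qed (use B V measurable_sets[OF measurable_simple_version V] in auto)
  finally show ?thesis by (simp add: emeasure_eq_measure)
qed

text \<open>All counts are measurable on \<open>void_space\<close>, so their joint law is an image
  of the law of the simple version, which differs from A only on a null set.\<close>

lemma distr_counts_eq:
  assumes S: "\<And>i. i < k \<Longrightarrow> S i \<in> sets borel \<and> S i \<subseteq> {0<..1}"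
  shows "distr M (ennreal_vectors k) (\<lambda>\<omega>. counts k S (A \<omega>)) =
    distr (distr M void_space simple_version) (ennreal_vectors k) (counts k S)"
proof -
  have m1: "(counts k S) \<in> void_space \<rightarrow>\<^sub>M ennreal_vectors k"
    using S by (intro measurable_restrict measurable_mcount) auto
  have m2: "(\<lambda>\<omega>. counts k S (A \<omega>)) \<in> M \<rightarrow>\<^sub>M ennreal_vectors k"
    using S by (intro measurable_restrict measurable_count) auto
  have "distr M (ennreal_vectors k) (\<lambda>\<omega>. counts k S (A \<omega>)) =
    distr M (ennreal_vectors k) ((counts k S) \<circ> simple_version)"
  proof (rule distr_cong_AE[OF refl refl])
    show "AE \<omega> in M. counts k S (A \<omega>) = ((counts k S) \<circ> simple_version) \<omega>"
      using AE_simple_version by (rule eventually_mono) simp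
  qed (use m1 m2 measurable_comp[OF measurable_simple_version m1] in auto)
  also have "\<dots> = distr (distr M void_space simple_version) (ennreal_vectors k) (counts k S)"
    by (rule distr_distr[symmetric, OF m1 measurable_simple_version])
  finally show ?thesis .
qed

end

section \<open>Uniqueness in distribution\<close>

lemma PD_process_unique:
  assumes "PD_process \<theta> M A" "PD_process \<theta> N B"
  shows "same_distribution M A N B"
proof -
  interpret A: PD_process \<theta> M A by fact
  interpret B: PD_process \<theta> N B by fact
  have moment: "A.cell_moment n K = B.cell_moment n K"
    if K: "K \<subseteq> {1..<2 ^ n}" for n K
  proof (cases "K = {}")
    case True
    \<comment> \<open>The intensity conditions start at k = 1; the empty product has expectation 1
      on either space.\<close>
    then show ?thesis by (simp add: A.emeasure_space_1 B.emeasure_space_1)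
  next
    case False
    have "finite K" using K by (rule finite_subset) simp
    then obtain e where "bij_betw e {..<card K} K"
      using ex_bij_betw_nat_finite[of K] by (auto simp: atLeast0LessThan)
    with A.cell_moment_eq[OF K False] B.cell_moment_eq[OF K False] show ?thesis by simp
  qed
  have void: "A.prob (A.void_event n J) = B.prob (B.void_event n J)"
    if J: "J \<subseteq> {1..<2 ^ n}" for n J
  proof (rule LIMSEQ_unique[OF A.void_probability_limit[OF J]])
    have "(\<integral>\<omega>. (\<Prod>i\<in>refine n k J. 1 - A.cell_count (n + k) i \<omega>) \<partial>M) = (\<integral>\<omega>. (\<Prod>i\<in>refine n k J. 1 - B.cell_count (n + k) i \<omega>) \<partial>N)" for k
      unfolding A.expectation_void_product[OF refine_subset'[OF J]] B.expectation_void_product[OF refine_subset'[OF J]]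
    proof (rule sum.cong[OF refl])
      fix K assume "K \<in> Pow (refine n k J)"
      then have "K \<subseteq> {1..<2 ^ (n + k)}" using refine_subset'[OF J, of k] by blast
      from moment[OF this]
      show "(-1) ^ card K * enn2real (A.cell_moment (n + k) K) =
        (-1) ^ card K * enn2real (B.cell_moment (n + k) K)" by (simp only:)
    qed
    then show "(\<lambda>k. \<integral>\<omega>. (\<Prod>i\<in>refine n k J. 1 - A.cell_count (n + k) i \<omega>) \<partial>M) \<longlonglongrightarrow>
      B.prob (B.void_event n J)"
      using B.void_probability_limit[OF J] by (simp only:)
  qed
  have law: "distr M void_space A.simple_version = distr N void_space B.simple_version"
  \<comment> \<open>\<open>void_set (0, {})\<close> is the whole space, as the empty union contains
    no point; for finite measures this one set, repeated, serves as the exhausting sequence.\<close>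
  proof (rule measure_eqI_generator_eq[OF Int_stable_void_sets void_sets_Pow, where A="\<lambda>_. void_set (0, {})"])
    fix V assume "V \<in> void_sets"
    then obtain n J where "V = void_set (n, J)" "J \<subseteq> {1..<2 ^ n}" by (auto simp: void_sets_def)
    then show "emeasure (distr M void_space A.simple_version) V = emeasure (distr N void_space B.simple_version) V"
      by (simp add: A.emeasure_law_void B.emeasure_law_void void)
  next
    have "void_set (0, {}) \<in> void_sets" unfolding void_sets_def by (rule imageI) simp
    then show "range (\<lambda>_::nat. void_set (0, {})) \<subseteq> void_sets" by blast
    show "(\<Union>i::nat. void_set (0, {})) = {m. simple_locally_finite m}"
      by (simp add: void_set_def cell_union_def mcount_eq_emeasure)
    show "emeasure (distr M void_space A.simple_version) (void_set (0, {})) \<noteq> \<infinity>" for i :: nat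
      by (subst A.emeasure_law_void) simp_all
  qed (simp_all add: sets_void_space)
  show ?thesis
    unfolding same_distribution_def
  proof (intro allI impI)
    fix k and S :: "nat \<Rightarrow> real set"
    assume "\<forall>i<k. S i \<in> sets borel \<and> S i \<subseteq> {0<..1}"
    then have S: "\<And>i. i < k \<Longrightarrow> S i \<in> sets borel \<and> S i \<subseteq> {0<..1}" by blast
    let ?law = "\<lambda>L. distr L (ennreal_vectors k) (counts k S)"
    have "distr M (ennreal_vectors k) (\<lambda>\<omega>. counts k S (A \<omega>)) = ?law (distr M void_space A.simple_version)"
      by (rule A.distr_counts_eq) (rule S)
    also have "\<dots> = ?law (distr N void_space B.simple_version)" by (simp only: law)
    also have "\<dots> = distr N (ennreal_vectors k) (\<lambda>\<omega>. counts k S (B \<omega>))"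
      by (rule B.distr_counts_eq[symmetric]) (rule S)
    finally show "distr M (ennreal_vectors k) (\<lambda>\<omega>. counts k S (A \<omega>)) =
      distr N (ennreal_vectors k) (\<lambda>\<omega>. counts k S (B \<omega>))" .
  qed
qed

theorem corollary2:
  fixes \<theta> :: real
  assumes "\<theta> > 0"
  shows "random_multisubset (Poisson_Dirichlet \<theta>) multisubset_of_seq \<and>
         PD_conditions \<theta> (Poisson_Dirichlet \<theta>) multisubset_of_seq \<and>
         (\<forall>(M :: 'w measure) A. random_multisubset M A \<and> PD_conditions \<theta> M A \<longrightarrow>
            same_distribution M A (Poisson_Dirichlet \<theta>) multisubset_of_seq)"
proof -
  note PD = random_multisubset_Poisson_Dirichlet[of \<theta>] PD_conditions_Poisson_Dirichlet[OF assms]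
  have "same_distribution M A (Poisson_Dirichlet \<theta>) multisubset_of_seq"
    if "random_multisubset M A \<and> PD_conditions \<theta> M A" for M :: "'w measure" and A
    by (rule PD_process_unique[of \<theta>]) (use assms that PD in \<open>auto intro: PD_process.intro\<close>)
  with PD show ?thesis by blast
qed

end
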